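(* Let $d=1$ and let $a:\mathbb{R}\to\mathbb{C}$ satisfy $a\in L^\infty(\mathbb{R})\cap L^1(\mathbb{R})$. If $\|a\|_{L^1(\mathbb{R})}<2$, then the operators $A_a$ and $A_0$ are similar to each other, i.e. there exists a bounded operator $W$ on $\mathcal{H}$ with bounded inverse $W^{-1}$ on $\mathcal{H}$ such that $A_a=WA_0W^{-1}$ (in particular $\operatorname{dom}A_a=W\operatorname{dom}A_0$). Moreover, the constant $2$ is optimal, i.e. it cannot be replaced by any larger constant: for every $c>2$ there exists $a\in L^\infty(\mathbb{R})\cap L^1(\mathbb{R})$ with $\|a\|_{L^1(\mathbb{R})}<c$ such that $A_a$ and $A_0$ are not similar.
   Context: All function spaces consist of complex-valued functions. $\dot H^1(\mathbb{R}^d)$ denotes the completion of $C_0^\infty(\mathbb{R}^d)$ with respect to the norm $\psi\mapsto\|\nabla\psi\|_{L^2(\mathbb{R}^d)}$; the gradient extends to an isometry of $\dot H^1(\mathbb{R}^d)$ into $L^2(\mathbb{R}^d)^d$, $\Delta\psi$ for $\psi\in\dot H^1(\mathbb{R}^d)$ is the distributional divergence of $\nabla\psi$, and $H^1(\mathbb{R}^d)$ is naturally (injectively) contained in $\dot H^1(\mathbb{R}^d)$. For a damping $a\in L^\infty(\mathbb{R}^d)$ (possibly complex-valued), the damped wave operator $A_a$ acts in the Hilbert space $\mathcal{H}:=\dot H^1(\mathbb{R}^d)\times L^2(\mathbb{R}^d)$ (with norm $\|(\psi_1,\psi_2)\|^2=\|\nabla\psi_1\|^2_{L^2}+\|\psi_2\|_{L^2}^2$)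 by $$A_a\begin{pmatrix}\psi_1\\ \psi_2\end{pmatrix}:=\begin{pmatrix}\psi_2\\ \Delta\psi_1-a\,\psi_2\end{pmatrix},\qquad \operatorname{dom}A_a:=\{\psi_1\in\dot H^1(\mathbb{R}^d):\Delta\psi_1\in L^2(\mathbb{R}^d)\}\times H^1(\mathbb{R}^d).$$ This is the closure of the operator given by the same formula on $H^2(\mathbb{R}^d)\times H^1(\mathbb{R}^d)$. $A_0$ is the (skew-adjoint) undamped operator, obtained for $a=0$. Here $d=1$. *)

theory Defs
  imports "HOL-Analysis.Analysis"
begin

section \<open>Complex normed spaces\<close>

class complex_normed_vector = real_normed_vector +
  fixes scaleC :: "complex \<Rightarrow> 'a \<Rightarrow> 'a"  (infixr \<open>*\<^sub>C\<close> 75)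
  assumes scaleC_add_right: "c *\<^sub>C (x + y) = c *\<^sub>C x + c *\<^sub>C y"
    and scaleC_add_left: "(c + d) *\<^sub>C x = c *\<^sub>C x + d *\<^sub>C x"
    and scaleC_scaleC: "c *\<^sub>C (d *\<^sub>C x) = (c * d) *\<^sub>C x"
    and scaleC_of_real: "of_real r *\<^sub>C x = r *\<^sub>R x"
    and norm_scaleC: "norm (c *\<^sub>C x) = cmod c * norm x"
begin

lemma scaleC_diff_right: "c *\<^sub>C (x - y) = c *\<^sub>C x - c *\<^sub>C y"
  using scaleC_add_right [of c "x - y" y] by (simp add: algebra_simps)

end

definition bounded_clinear :: "('a::complex_normed_vector \<Rightarrow> 'b::complex_normed_vector) \<Rightarrow> bool"
  where "bounded_clinear f \<longleftrightarrow> bounded_linear f \<and> (\<forall>c x. f (c *\<^sub>C x) = c *\<^sub>C f x)"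

text \<open>The norm on products is the Hilbert sum \<open>sqrt ((norm x)\<^sup>2 + (norm y)\<^sup>2)\<close>.\<close>

instantiation prod :: (complex_normed_vector, complex_normed_vector) complex_normed_vector
begin

definition scaleC_prod_def: "c *\<^sub>C x = (c *\<^sub>C fst x, c *\<^sub>C snd x)"

instance
proof
  fix c d :: complex and r :: real and x y :: "'a \<times> 'b"
  show "c *\<^sub>C (x + y) = c *\<^sub>C x + c *\<^sub>C y"
    by (simp add: scaleC_prod_def scaleC_add_right)
  show "(c + d) *\<^sub>C x = c *\<^sub>C x + d *\<^sub>C x"
    by (simp add: scaleC_prod_def scaleC_add_left)
  show "c *\<^sub>C (d *\<^sub>C x) = (c * d) *\<^sub>C x"
    by (simp add: scaleC_prod_def scaleC_scaleC)
  show "of_real r *\<^sub>C x = r *\<^sub>R x"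
    by (simp add: scaleC_prod_def scaleC_of_real scaleR_prod_def)
  have "norm (c *\<^sub>C x) = sqrt ((cmod c)\<^sup>2 * ((norm (fst x))\<^sup>2 + (norm (snd x))\<^sup>2))"
    by (simp add: scaleC_prod_def norm_prod_def norm_scaleC power_mult_distrib algebra_simps)
  then show "norm (c *\<^sub>C x) = cmod c * norm x"
    by (simp add: norm_prod_def real_sqrt_mult)
qed

end


section \<open>Operators with a domain and similarity\<close>

text \<open>An operator \<open>A\<close> is a partial map with \<open>dom A\<close> as its domain; the equation
  \<open>A = W \<circ> B \<circ> W\<inverse>\<close> below thus includes \<open>dom A = W ` dom B\<close>.\<close>

definition similar :: "('a::complex_normed_vector \<rightharpoonup> 'a) \<Rightarrow> ('a \<rightharpoonup> 'a) \<Rightarrow> bool"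
  where "similar A B \<longleftrightarrow>
    (\<exists>W. bounded_clinear W \<and> bij W \<and> bounded_clinear (inv W) \<and>
         A = map_option W \<circ> B \<circ> inv W)"

lemma similar_dom:
  assumes "bij W" "A = map_option W \<circ> B \<circ> inv W"
  shows "dom A = W ` dom B"
  using assms by (auto simp: dom_def bij_is_surj surj_f_inv_f bij_is_inj image_iff)
    (metis bij_is_surj surj_f_inv_f)


section \<open>The Lebesgue spaces of complex-valued functions on the line\<close>

definition square_integrable :: "(real \<Rightarrow> complex) \<Rightarrow> bool"
  where "square_integrable f \<longleftrightarrow>
    f \<in> borel_measurable lebesgue \<and> integrable lebesgue (\<lambda>x. (cmod (f x))\<^sup>2)"

definition in_Linf :: "(real \<Rightarrow> complex) \<Rightarrow> bool"
  where "in_Linf a \<longleftrightarrow>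
    a \<in> borel_measurable lebesgue \<and> (\<exists>C. AE x in lebesgue. cmod (a x) \<le> C)"

definition in_L1 :: "(real \<Rightarrow> complex) \<Rightarrow> bool"
  where "in_L1 a \<longleftrightarrow> integrable lebesgue a"

definition L1_norm :: "(real \<Rightarrow> complex) \<Rightarrow> real"
  where "L1_norm a = (LINT x|lebesgue. cmod (a x))"

lemma square_integrable_zero: "square_integrable (\<lambda>_. 0)"
  by (simp add: square_integrable_def)

lemma square_integrable_add:
  assumes "square_integrable f" "square_integrable g"
  shows "square_integrable (\<lambda>x. f x + g x)"
proof -
  let ?h = "\<lambda>x. 2 * (cmod (f x))\<^sup>2 + 2 * (cmod (g x))\<^sup>2"
  have [measurable]: "f \<in> borel_measurable lebesgue" "g \<in> borel_measurable lebesgue"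
    using assms by (auto simp: square_integrable_def)
  have "integrable lebesgue ?h"
    using assms unfolding square_integrable_def
    by (intro Bochner_Integration.integrable_add integrable_mult_right) blast+
  moreover have "(\<lambda>x. (cmod (f x + g x))\<^sup>2) \<in> borel_measurable lebesgue"
    by measurable
  moreover have "AE x in lebesgue. norm ((cmod (f x + g x))\<^sup>2) \<le> norm (?h x)"
  proof (rule AE_I2)
    fix x
    have "(cmod (f x + g x))\<^sup>2 \<le> (cmod (f x) + cmod (g x))\<^sup>2"
      by (intro power_mono norm_triangle_ineq norm_ge_zero)
    also have "\<dots> \<le> ?h x"
      using sum_squares_bound [of "cmod (f x)" "cmod (g x)"] unfolding power2_sum by linarith
    finally show "norm ((cmod (f x + g x))\<^sup>2) \<le> norm (?h x)"
      by simp
  qed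
  ultimately have "integrable lebesgue (\<lambda>x. (cmod (f x + g x))\<^sup>2)"
    by (rule Bochner_Integration.integrable_bound)
  then show ?thesis
    by (simp add: square_integrable_def)
qed

lemma square_integrable_cmult:
  assumes "square_integrable f"
  shows "square_integrable (\<lambda>x. c * f x)"
  using assms by (auto simp: square_integrable_def norm_mult power_mult_distrib)

lemma square_integrable_mult_bounded:
  assumes "in_Linf a" "square_integrable f"
  shows "square_integrable (\<lambda>x. a x * f x)"
proof -
  have m [measurable]: "f \<in> borel_measurable lebesgue" "a \<in> borel_measurable lebesgue"
    using assms by (auto simp: square_integrable_def in_Linf_def)
  obtain C where C: "AE x in lebesgue. cmod (a x) \<le> C"
    using assms by (auto simp: in_Linf_def)
  have "integrable lebesgue (\<lambda>x. C\<^sup>2 * (cmod (f x))\<^sup>2)"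
    using assms by (auto simp: square_integrable_def)
  moreover have "(\<lambda>x. (cmod (a x * f x))\<^sup>2) \<in> borel_measurable lebesgue"
    by measurable
  moreover have "AE x in lebesgue. norm ((cmod (a x * f x))\<^sup>2) \<le> norm (C\<^sup>2 * (cmod (f x))\<^sup>2)"
    using C by eventually_elim (auto simp: norm_mult power_mult_distrib intro!: mult_right_mono power_mono)
  ultimately have "integrable lebesgue (\<lambda>x. (cmod (a x * f x))\<^sup>2)"
    by (rule Bochner_Integration.integrable_bound)
  then show ?thesis
    by (simp add: square_integrable_def)
qed

lemma integrable_mult_square_integrable:
  fixes b :: "complex \<Rightarrow> complex \<Rightarrow> 'a::{banach, second_countable_topology}"
  assumes "square_integrable f" "square_integrable g"
    and [measurable]: "(\<lambda>x. b (f x) (g x)) \<in> borel_measurable lebesgue"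
    and b: "\<And>z w. norm (b z w) \<le> cmod z * cmod w"
  shows "integrable lebesgue (\<lambda>x. b (f x) (g x))"
proof -
  let ?h = "\<lambda>x. (cmod (f x))\<^sup>2 + (cmod (g x))\<^sup>2"
  have "integrable lebesgue ?h"
    using assms unfolding square_integrable_def
    by (intro Bochner_Integration.integrable_add) blast+
  moreover note assms(3)
  moreover have "AE x in lebesgue. norm (b (f x) (g x)) \<le> norm (?h x)"
  proof (rule AE_I2)
    fix x
    have "norm (b (f x) (g x)) \<le> cmod (f x) * cmod (g x)"
      by (rule b)
    also have "\<dots> \<le> 2 * cmod (f x) * cmod (g x)"
      by simp
    also have "\<dots> \<le> ?h x"
      by (rule sum_squares_bound)
    finally show "norm (b (f x) (g x)) \<le> norm (?h x)"
      by simp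
  qed
  ultimately show ?thesis
    by (rule Bochner_Integration.integrable_bound)
qed

lemma integrable_inner_square_integrable:
  assumes "square_integrable f" "square_integrable g"
  shows "integrable lebesgue (\<lambda>x. f x \<bullet> g x)"
proof -
  have [measurable]: "f \<in> borel_measurable lebesgue" "g \<in> borel_measurable lebesgue"
    using assms by (auto simp: square_integrable_def)
  show ?thesis
    by (rule integrable_mult_square_integrable [OF assms, where b = inner])
      (measurable, simp add: Cauchy_Schwarz_ineq2)
qed

quotient_type L2 = "real \<Rightarrow> complex" / partial:
  "\<lambda>f g. square_integrable f \<and> square_integrable g \<and> (AE x in lebesgue. f x = g x)"
proof (rule part_equivpI)
  show "\<exists>f. square_integrable f \<and> square_integrable f \<and> (AE x in lebesgue. f x = f x)"
    using square_integrable_zero by auto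
  show "symp (\<lambda>f g. square_integrable f \<and> square_integrable g \<and> (AE x in lebesgue. f x = g x))"
    by (auto simp: symp_def elim: eventually_mono)
  show "transp (\<lambda>f g. square_integrable f \<and> square_integrable g \<and> (AE x in lebesgue. f x = g x))"
    by (auto simp: transp_def elim: eventually_elim2)
qed

instantiation L2 :: real_inner
begin

lift_definition zero_L2 :: L2 is "\<lambda>_. 0"
  by (simp add: square_integrable_zero)

lift_definition plus_L2 :: "L2 \<Rightarrow> L2 \<Rightarrow> L2" is "\<lambda>f g x. f x + g x"
  by (auto intro: square_integrable_add elim: eventually_elim2)

lift_definition uminus_L2 :: "L2 \<Rightarrow> L2" is "\<lambda>f x. - f x"
  by (auto simp: square_integrable_def elim: eventually_mono)

definition minus_L2 :: "L2 \<Rightarrow> L2 \<Rightarrow> L2" where "u - v = u + - v" for u v :: L2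

lift_definition scaleR_L2 :: "real \<Rightarrow> L2 \<Rightarrow> L2" is "\<lambda>r f x. of_real r * f x"
  by (auto intro: square_integrable_cmult elim: eventually_mono)

text \<open>The inner product on \<^typ>\<open>complex\<close> is \<open>z \<bullet> w = Re (z * cnj w)\<close>, so this is the
  real part of the usual inner product and induces the usual norm.\<close>

lift_definition inner_L2 :: "L2 \<Rightarrow> L2 \<Rightarrow> real" is "\<lambda>f g. LINT x|lebesgue. f x \<bullet> g x"
proof goal_cases
  case (1 f f' g g')
  then have [measurable]: "f \<in> borel_measurable lebesgue" "f' \<in> borel_measurable lebesgue"
      "g \<in> borel_measurable lebesgue" "g' \<in> borel_measurable lebesgue"
    by (auto simp: square_integrable_def)
  have ae: "AE x in lebesgue. f x = f' x" "AE x in lebesgue. g x = g' x"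
    using 1 by auto
  show ?case
    by (rule integral_cong_AE) (measurable, use ae in eventually_elim, simp)
qed

definition norm_L2 :: "L2 \<Rightarrow> real" where "norm_L2 u = sqrt (u \<bullet> u)"
definition sgn_L2 :: "L2 \<Rightarrow> L2" where "sgn_L2 u = inverse (norm u) *\<^sub>R u" for u :: L2
definition dist_L2 :: "L2 \<Rightarrow> L2 \<Rightarrow> real" where "dist_L2 u v = norm (u - v)"
definition uniformity_L2 :: "(L2 \<times> L2) filter"
  where "uniformity_L2 = (INF e\<in>{0 <..}. principal {(x, y). dist x y < e})"
definition open_L2 :: "L2 set \<Rightarrow> bool"
  where "open_L2 U \<longleftrightarrow> (\<forall>x\<in>U. eventually (\<lambda>(x', y). x' = x \<longrightarrow> y \<in> U) uniformity)"

instance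
proof
  fix u v w :: L2 and r s :: real
  show "u + v + w = u + (v + w)"
    by transfer (auto intro: square_integrable_add simp: add.assoc)
  show "u + v = v + u"
    by transfer (auto intro: square_integrable_add simp: add.commute)
  show "0 + u = u"
    by transfer auto
  show "- u + u = 0"
    by transfer (auto simp: square_integrable_zero)
  show "u - v = u + - v"
    by (rule minus_L2_def)
  show "r *\<^sub>R (u + v) = r *\<^sub>R u + r *\<^sub>R v"
    by transfer (auto intro!: square_integrable_add square_integrable_cmult simp flip: distrib_left)
  show "(r + s) *\<^sub>R u = r *\<^sub>R u + s *\<^sub>R u"
    by transfer (auto intro!: square_integrable_add square_integrable_cmult simp: distrib_right)
  show "r *\<^sub>R s *\<^sub>R u = (r * s) *\<^sub>R u"
    by transfer (auto intro!: square_integrable_cmult simp: mult.assoc simp flip: of_real_mult)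
  show "1 *\<^sub>R u = u"
    by transfer auto
  show "u \<bullet> v = v \<bullet> u"
    by transfer (simp add: inner_commute)
  show "(u + v) \<bullet> w = u \<bullet> w + v \<bullet> w"
    by transfer (simp add: inner_add_left integrable_inner_square_integrable)
  show "(r *\<^sub>R u) \<bullet> v = r * (u \<bullet> v)"
    by transfer (simp flip: scaleR_conv_of_real)
  show "0 \<le> u \<bullet> u"
    by transfer simp
  show "(u \<bullet> u = 0) = (u = 0)"
  proof transfer
    fix f :: "real \<Rightarrow> complex"
    assume f: "square_integrable f \<and> square_integrable f \<and> (AE x in lebesgue. f x = f x)"
    then have "integrable lebesgue (\<lambda>x. f x \<bullet> f x)"
      by (simp add: integrable_inner_square_integrable)
    then have "(LINT x|lebesgue. f x \<bullet> f x) = 0 \<longleftrightarrow> (AE x in lebesgue. f x \<bullet> f x = 0)"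
      by (rule integral_nonneg_eq_0_iff_AE) simp
    then show "((LINT x|lebesgue. f x \<bullet> f x) = 0) =
        (square_integrable f \<and> square_integrable (\<lambda>_. 0) \<and> (AE x in lebesgue. f x = 0))"
      using f by (simp add: square_integrable_zero)
  qed
qed (simp_all add: norm_L2_def sgn_L2_def dist_L2_def uniformity_L2_def open_L2_def)

end

instantiation L2 :: complex_normed_vector
begin

lift_definition scaleC_L2 :: "complex \<Rightarrow> L2 \<Rightarrow> L2" is "\<lambda>c f x. c * f x"
  by (auto intro: square_integrable_cmult elim: eventually_mono)

instance
proof
  fix c d :: complex and r :: real and u v :: L2
  show "c *\<^sub>C (u + v) = c *\<^sub>C u + c *\<^sub>C v"
    by transfer (auto intro!: square_integrable_add square_integrable_cmult simp flip: distrib_left)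
  show "(c + d) *\<^sub>C u = c *\<^sub>C u + d *\<^sub>C u"
    by transfer (auto intro!: square_integrable_add square_integrable_cmult simp flip: distrib_right)
  show "c *\<^sub>C d *\<^sub>C u = (c * d) *\<^sub>C u"
    by transfer (auto intro!: square_integrable_cmult simp: mult.assoc)
  show "of_real r *\<^sub>C u = r *\<^sub>R u"
    by transfer (auto intro!: square_integrable_cmult)
  have "(c *\<^sub>C u) \<bullet> (c *\<^sub>C u) = (cmod c)\<^sup>2 * (u \<bullet> u)"
    by transfer (simp add: dot_square_norm norm_mult power_mult_distrib)
  then show "norm (c *\<^sub>C u) = cmod c * norm u"
    by (simp add: norm_L2_def real_sqrt_mult)
qed

end

text \<open>The bilinear pairing \<open>\<integral> f g\<close>, without complex conjugation.\<close>

lift_definition pairing :: "L2 \<Rightarrow> L2 \<Rightarrow> complex" is "\<lambda>f g. LINT x|lebesgue. f x * g x"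
proof goal_cases
  case (1 f f' g g')
  then have [measurable]: "f \<in> borel_measurable lebesgue" "f' \<in> borel_measurable lebesgue"
      "g \<in> borel_measurable lebesgue" "g' \<in> borel_measurable lebesgue"
    by (auto simp: square_integrable_def)
  have ae: "AE x in lebesgue. f x = f' x" "AE x in lebesgue. g x = g' x"
    using 1 by auto
  show ?case
    by (rule integral_cong_AE) (measurable, use ae in eventually_elim, simp)
qed

text \<open>Multiplication by an essentially bounded function; other functions are mapped to the
  zero operator as a dummy value.\<close>

lift_definition Linf_mult :: "(real \<Rightarrow> complex) \<Rightarrow> L2 \<Rightarrow> L2"
  is "\<lambda>a f. if in_Linf a then (\<lambda>x. a x * f x) else (\<lambda>_. 0)"
  by (auto intro: square_integrable_mult_bounded square_integrable_zero elim: eventually_mono)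


section \<open>Test functions\<close>

definition smooth :: "(real \<Rightarrow> complex) \<Rightarrow> bool"
  where "smooth f \<longleftrightarrow>
    (\<exists>F. F 0 = f \<and> (\<forall>n x. (F n has_vector_derivative F (Suc n) x) (at x)))"

lemma smoothI:
  assumes "F 0 = f" "\<And>n x. (F n has_vector_derivative F (Suc n) x) (at x)"
  shows "smooth f"
  using assms unfolding smooth_def by blast

lemma smooth_zero: "smooth (\<lambda>_. 0)"
  by (rule smoothI [where F = "\<lambda>_ _. 0"]) simp_all

lemma smooth_add:
  assumes "smooth f" "smooth g" shows "smooth (\<lambda>x. f x + g x)"
proof -
  obtain F where "F 0 = f \<and> (\<forall>n x. (F n has_vector_derivative F (Suc n) x) (at x))"
    using assms(1) unfolding smooth_def ..
  then have F: "F 0 = f" "\<And>n x. (F n has_vector_derivative F (Suc n) x) (at x)"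
    by simp_all
  obtain G where "G 0 = g \<and> (\<forall>n x. (G n has_vector_derivative G (Suc n) x) (at x))"
    using assms(2) unfolding smooth_def ..
  then have G: "G 0 = g" "\<And>n x. (G n has_vector_derivative G (Suc n) x) (at x)"
    by simp_all
  show ?thesis
    by (rule smoothI [where F = "\<lambda>n x. F n x + G n x"])
      (simp_all add: F(1) G(1) has_vector_derivative_add F(2) G(2))
qed

lemma smooth_cmult:
  assumes "smooth f" shows "smooth (\<lambda>x. c * f x)"
proof -
  obtain F where "F 0 = f \<and> (\<forall>n x. (F n has_vector_derivative F (Suc n) x) (at x))"
    using assms unfolding smooth_def ..
  then have F: "F 0 = f" "\<And>n x. (F n has_vector_derivative F (Suc n) x) (at x)"
    by simp_all
  show ?thesis
    by (rule smoothI [where F = "\<lambda>n x. c * F n x"])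
      (simp_all add: F(1) has_vector_derivative_mult_right F(2))
qed

lemma smooth_has_derivative:
  assumes "smooth f"
  shows "(f has_vector_derivative vector_derivative f (at x)) (at x)"
proof -
  obtain F where "F 0 = f \<and> (\<forall>n x. (F n has_vector_derivative F (Suc n) x) (at x))"
    using assms unfolding smooth_def ..
  then have F: "F 0 = f" "\<And>n x. (F n has_vector_derivative F (Suc n) x) (at x)"
    by simp_all
  show ?thesis
    using F(2) [of 0 x] by (simp add: F(1) vector_derivative_at)
qed

lemma smooth_derivative:
  assumes "smooth f" shows "smooth (\<lambda>x. vector_derivative f (at x))"
proof -
  obtain F where "F 0 = f \<and> (\<forall>n x. (F n has_vector_derivative F (Suc n) x) (at x))"
    using assms unfolding smooth_def ..
  then have F: "F 0 = f" "\<And>n x. (F n has_vector_derivative F (Suc n) x) (at x)"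
    by simp_all
  have "vector_derivative f (at x) = F (Suc 0) x" for x
    using F(2) [of 0 x] by (simp add: F(1) vector_derivative_at)
  then show ?thesis
    by (intro smoothI [where F = "\<lambda>n. F (Suc n)"]) (auto simp: F(2))
qed

lemma smooth_continuous:
  assumes "smooth f" shows "continuous_on UNIV f"
  by (intro continuous_at_imp_continuous_on ballI
      has_vector_derivative_continuous [OF smooth_has_derivative [OF assms]])

typedef test_function =
  "{f :: real \<Rightarrow> complex. smooth f \<and> compact (closure {x. f x \<noteq> 0})}"
  by (intro exI [of _ "\<lambda>_. 0"]) (simp add: smooth_zero)

setup_lifting type_definition_test_function

lift_definition test_deriv :: "test_function \<Rightarrow> test_function"
  is "\<lambda>f x. vector_derivative f (at x)"
proof
  fix f :: "real \<Rightarrow> complex"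
  assume f: "smooth f \<and> compact (closure {x. f x \<noteq> 0})"
  show "smooth (\<lambda>x. vector_derivative f (at x))"
    using f by (simp add: smooth_derivative)
  have "{x. vector_derivative f (at x) \<noteq> 0} \<subseteq> closure {x. f x \<noteq> 0}"
  proof (rule ccontr)
    assume "\<not> ?thesis"
    then obtain x where x: "vector_derivative f (at x) \<noteq> 0" "x \<in> - closure {x. f x \<noteq> 0}"
      by auto
    have zero: "0 = f y" if "y \<in> - closure {x. f x \<noteq> 0}" for y
      using that closure_subset [of "{x. f x \<noteq> 0}"] by auto
    have "((\<lambda>_. 0) has_vector_derivative 0) (at x)"
      by simp
    then have "(f has_vector_derivative 0) (at x)"
    proof (rule has_vector_derivative_transform_within_open)
      show "open (- closure {x. f x \<noteq> 0})"
        by (simp add: open_Compl)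
    qed (use x(2) in assumption, rule zero)
    with x show False
      by (simp add: vector_derivative_at)
  qed
  moreover have "bounded (closure {x. f x \<noteq> 0})"
    using f compact_imp_bounded by blast
  ultimately have "bounded {x. vector_derivative f (at x) \<noteq> 0}"
    by (rule bounded_subset [rotated])
  then show "compact (closure {x. vector_derivative f (at x) \<noteq> 0})"
    by (rule compact_closure [THEN iffD2])
qed

lemma test_square_integrable:
  assumes "smooth f \<and> compact (closure {x. f x \<noteq> 0})"
  shows "square_integrable f"
proof -
  let ?S = "closure {x. f x \<noteq> 0}"
  have cont: "continuous_on UNIV f"
    using assms by (simp add: smooth_continuous)
  have [measurable]: "f \<in> borel_measurable lebesgue"
    by (intro measurable_completion) (simp add: borel_measurable_continuous_onI cont)
  have cont2: "continuous_on UNIV (\<lambda>x. (cmod (f x))\<^sup>2)"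
    by (intro continuous_intros cont)
  have "set_integrable lborel ?S (\<lambda>x. (cmod (f x))\<^sup>2)"
    unfolding set_integrable_def using assms
    by (intro borel_integrable_compact continuous_on_subset [OF cont2]) auto
  moreover have "(\<lambda>x. indicator ?S x *\<^sub>R (cmod (f x))\<^sup>2) = (\<lambda>x. (cmod (f x))\<^sup>2)"
  proof
    fix x
    show "indicator ?S x *\<^sub>R (cmod (f x))\<^sup>2 = (cmod (f x))\<^sup>2"
      using subsetD [OF closure_subset, of x "{x. f x \<noteq> 0}"] by (cases "f x = 0") auto
  qed
  ultimately have "integrable lborel (\<lambda>x. (cmod (f x))\<^sup>2)"
    by (simp add: set_integrable_def)
  then have "integrable lebesgue (\<lambda>x. (cmod (f x))\<^sup>2)"
    by (subst integrable_completion) (auto dest: borel_measurable_integrable)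
  then show ?thesis
    by (simp add: square_integrable_def)
qed

lift_definition test_to_L2 :: "test_function \<Rightarrow> L2" is "\<lambda>f. f"
  by (simp add: test_square_integrable)

text \<open>Test functions carry the norm \<open>\<psi> \<mapsto> \<parallel>\<psi>'\<parallel>\<close>, which stems from an inner product.\<close>

instantiation test_function :: real_inner
begin

lift_definition zero_test_function :: test_function is "\<lambda>_. 0"
  by (simp add: smooth_zero)

lift_definition plus_test_function :: "test_function \<Rightarrow> test_function \<Rightarrow> test_function"
  is "\<lambda>f g x. f x + g x"
proof goal_cases
  case (1 f g)
  then have "bounded ({x. f x \<noteq> 0} \<union> {x. g x \<noteq> 0})"
    by simp
  then have "bounded {x. f x + g x \<noteq> 0}"
    by (rule bounded_subset) auto
  with 1 show ?case
    by (simp add: smooth_add)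
qed

lift_definition uminus_test_function :: "test_function \<Rightarrow> test_function" is "\<lambda>f x. - f x"
  using smooth_cmult [where c = "-1"] by simp

definition minus_test_function :: "test_function \<Rightarrow> test_function \<Rightarrow> test_function"
  where "\<phi> - \<psi> = \<phi> + - \<psi>" for \<phi> \<psi> :: test_function

lift_definition scaleR_test_function :: "real \<Rightarrow> test_function \<Rightarrow> test_function"
  is "\<lambda>r f x. of_real r * f x"
proof goal_cases
  case (1 r f)
  then have "bounded {x. f x \<noteq> 0}"
    by simp
  then have "bounded {x. of_real r * f x \<noteq> 0}"
    by (rule bounded_subset) auto
  with 1 show ?case
    by (simp add: smooth_cmult)
qed

definition inner_test_function :: "test_function \<Rightarrow> test_function \<Rightarrow> real"
  where "\<phi> \<bullet> \<psi> = test_to_L2 (test_deriv \<phi>) \<bullet> test_to_L2 (test_deriv \<psi>)"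

definition norm_test_function :: "test_function \<Rightarrow> real"
  where "norm_test_function \<phi> = norm (test_to_L2 (test_deriv \<phi>))"

definition sgn_test_function :: "test_function \<Rightarrow> test_function"
  where "sgn_test_function \<phi> = inverse (norm \<phi>) *\<^sub>R \<phi>" for \<phi> :: test_function
definition dist_test_function :: "test_function \<Rightarrow> test_function \<Rightarrow> real"
  where "dist_test_function \<phi> \<psi> = norm (\<phi> - \<psi>)"
definition uniformity_test_function :: "(test_function \<times> test_function) filter"
  where "uniformity_test_function = (INF e\<in>{0 <..}. principal {(x, y). dist x y < e})"
definition open_test_function :: "test_function set \<Rightarrow> bool"
  where "open_test_function U \<longleftrightarrow>
    (\<forall>x\<in>U. eventually (\<lambda>(x', y). x' = x \<longrightarrow> y \<in> U) uniformity)"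

lemma test_deriv_add: "test_deriv (\<phi> + \<psi>) = test_deriv \<phi> + test_deriv \<psi>"
  by transfer
    (intro ext vector_derivative_at has_vector_derivative_add smooth_has_derivative; simp)

lemma test_deriv_scaleR: "test_deriv (r *\<^sub>R \<phi>) = r *\<^sub>R test_deriv \<phi>"
  by transfer
    (intro ext vector_derivative_at has_vector_derivative_mult_right smooth_has_derivative; simp)

lemma test_to_L2_add: "test_to_L2 (\<phi> + \<psi>) = test_to_L2 \<phi> + test_to_L2 \<psi>"
  by transfer (simp add: test_square_integrable square_integrable_add)

lemma test_to_L2_scaleR: "test_to_L2 (r *\<^sub>R \<phi>) = r *\<^sub>R test_to_L2 \<phi>"
  by transfer (simp add: test_square_integrable square_integrable_cmult)

lemma test_to_L2_eq_0: "test_to_L2 \<phi> = 0 \<longleftrightarrow> \<phi> = 0"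
proof (transfer, safe)
  fix f :: "real \<Rightarrow> complex"
  assume f: "smooth f" "compact (closure {x. f x \<noteq> 0})" and ae: "AE x in lebesgue. f x = 0"
  have cont: "continuous_on UNIV f"
    using f by (simp add: smooth_continuous)
  then have "closed {x. f x = 0}"
    by (intro closed_Collect_eq continuous_on_const)
  then have "f x = 0" if "x \<in> UNIV" for x
    using mem_closed_if_AE_lebesgue_open [of UNIV "{x. f x = 0}" x] ae that by simp
  then show "f = (\<lambda>_. 0)"
    by auto
qed (auto simp: square_integrable_zero test_square_integrable)

lemma test_deriv_eq_0: "test_deriv \<phi> = 0 \<longleftrightarrow> \<phi> = 0"
proof (transfer, safe)
  fix f :: "real \<Rightarrow> complex"
  assume f: "smooth f" "compact (closure {x. f x \<noteq> 0})"
    and deriv: "(\<lambda>x. vector_derivative f (at x)) = (\<lambda>_. 0)"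
  have "(f has_vector_derivative 0) (at x)" for x
    using smooth_has_derivative [OF f(1), of x] fun_cong [OF deriv, of x] by simp
  then have "(f has_derivative (\<lambda>_. 0)) (at x)" for x
    by (simp add: has_vector_derivative_def)
  then have "\<exists>c. \<forall>x\<in>UNIV. f x = c"
    by (intro has_derivative_zero_constant convex_UNIV)
  then obtain c where "\<forall>x\<in>UNIV. f x = c" ..
  then have c: "f x = c" for x
    by simp
  have "c = 0"
  proof (rule ccontr)
    assume "c \<noteq> 0"
    with c have "{x. f x \<noteq> 0} = UNIV"
      by auto
    with f(2) show False
      by (simp add: not_bounded_UNIV)
  qed
  with c show "f = (\<lambda>_. 0)"
    by auto
qed auto

instance
proof
  fix \<phi> \<psi> \<theta> :: test_function and r s :: real
  show "\<phi> + \<psi> + \<theta> = \<phi> + (\<psi> + \<theta>)"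
    by transfer (simp add: add.assoc)
  show "\<phi> + \<psi> = \<psi> + \<phi>"
    by transfer (simp add: add.commute)
  show "0 + \<phi> = \<phi>"
    by transfer simp
  show "- \<phi> + \<phi> = 0"
    by transfer simp
  show "\<phi> - \<psi> = \<phi> + - \<psi>"
    by (rule minus_test_function_def)
  show "r *\<^sub>R (\<phi> + \<psi>) = r *\<^sub>R \<phi> + r *\<^sub>R \<psi>"
    by transfer (simp add: distrib_left)
  show "(r + s) *\<^sub>R \<phi> = r *\<^sub>R \<phi> + s *\<^sub>R \<phi>"
    by transfer (simp add: distrib_right)
  show "r *\<^sub>R s *\<^sub>R \<phi> = (r * s) *\<^sub>R \<phi>"
    by transfer (simp add: mult.assoc)
  show "1 *\<^sub>R \<phi> = \<phi>"
    by transfer simp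
  show "\<phi> \<bullet> \<psi> = \<psi> \<bullet> \<phi>"
    unfolding inner_test_function_def by (rule inner_commute)
  show "(\<phi> + \<psi>) \<bullet> \<theta> = \<phi> \<bullet> \<theta> + \<psi> \<bullet> \<theta>"
    unfolding inner_test_function_def test_deriv_add test_to_L2_add by (rule inner_add_left)
  show "(r *\<^sub>R \<phi>) \<bullet> \<psi> = r * (\<phi> \<bullet> \<psi>)"
    unfolding inner_test_function_def test_deriv_scaleR test_to_L2_scaleR
    by (rule inner_scaleR_left)
  show "0 \<le> \<phi> \<bullet> \<phi>"
    unfolding inner_test_function_def by (rule inner_ge_zero)
  show "(\<phi> \<bullet> \<phi> = 0) = (\<phi> = 0)"
    unfolding inner_test_function_def inner_eq_zero_iff test_to_L2_eq_0 test_deriv_eq_0 ..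
  show "norm \<phi> = sqrt (\<phi> \<bullet> \<phi>)"
    unfolding inner_test_function_def norm_test_function_def by (rule norm_eq_sqrt_inner)
  show "sgn \<phi> = inverse (norm \<phi>) *\<^sub>R \<phi>"
    by (rule sgn_test_function_def)
  show "dist \<phi> \<psi> = norm (\<phi> - \<psi>)"
    by (rule dist_test_function_def)
  show "uniformity = (INF e\<in>{0 <..}. principal {(x, y :: test_function). dist x y < e})"
    by (rule uniformity_test_function_def)
  show "open U = (\<forall>x\<in>U. eventually (\<lambda>(x', y). x' = x \<longrightarrow> y \<in> U) uniformity)"
    for U :: "test_function set"
    by (rule open_test_function_def)
qed

end

instantiation test_function :: complex_normed_vector
begin

lift_definition scaleC_test_function :: "complex \<Rightarrow> test_function \<Rightarrow> test_function"
  is "\<lambda>c f x. c * f x"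
proof goal_cases
  case (1 c f)
  then have "bounded {x. f x \<noteq> 0}"
    by simp
  then have "bounded {x. c * f x \<noteq> 0}"
    by (rule bounded_subset) auto
  with 1 show ?case
    by (simp add: smooth_cmult)
qed

lemma test_deriv_scaleC: "test_deriv (c *\<^sub>C \<phi>) = c *\<^sub>C test_deriv \<phi>"
  by transfer
    (intro ext vector_derivative_at has_vector_derivative_mult_right smooth_has_derivative; simp)

lemma test_to_L2_scaleC: "test_to_L2 (c *\<^sub>C \<phi>) = c *\<^sub>C test_to_L2 \<phi>"
  by transfer (simp add: test_square_integrable square_integrable_cmult)

instance
proof
  fix c d :: complex and r :: real and \<phi> \<psi> :: test_function
  show "c *\<^sub>C (\<phi> + \<psi>) = c *\<^sub>C \<phi> + c *\<^sub>C \<psi>"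
    by transfer (simp add: distrib_left)
  show "(c + d) *\<^sub>C \<phi> = c *\<^sub>C \<phi> + d *\<^sub>C \<phi>"
    by transfer (simp add: distrib_right)
  show "c *\<^sub>C d *\<^sub>C \<phi> = (c * d) *\<^sub>C \<phi>"
    by transfer (simp add: mult.assoc)
  show "of_real r *\<^sub>C \<phi> = r *\<^sub>R \<phi>"
    by transfer simp
  show "norm (c *\<^sub>C \<phi>) = cmod c * norm \<phi>"
    by (simp add: norm_test_function_def test_deriv_scaleC test_to_L2_scaleC norm_scaleC)
qed

end


section \<open>Completion of a normed space\<close>

quotient_type (overloaded) 'a cauchy_completion = "nat \<Rightarrow> 'a::real_normed_vector" / partial:
  "\<lambda>X Y. Cauchy X \<and> Cauchy Y \<and> (\<lambda>n. X n - Y n) \<longlonglongrightarrow> 0"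
proof (rule part_equivpI)
  let ?R = "\<lambda>X Y :: nat \<Rightarrow> 'a. Cauchy X \<and> Cauchy Y \<and> (\<lambda>n. X n - Y n) \<longlonglongrightarrow> 0"
  show "\<exists>X. ?R X X"
    by (intro exI [of _ "\<lambda>_. 0"]) (simp add: convergent_Cauchy convergent_const)
  show "symp ?R"
    by (auto simp: symp_def dest: tendsto_minus)
  show "transp ?R"
    by (auto simp: transp_def dest: tendsto_add)
qed

lemma Cauchy_add:
  fixes X Y :: "nat \<Rightarrow> 'a::real_normed_vector"
  assumes "Cauchy X" "Cauchy Y" shows "Cauchy (\<lambda>n. X n + Y n)"
proof (rule CauchyI)
  fix e :: real assume "0 < e"
  then have "0 < e / 2"
    by simp
  obtain M where M: "\<forall>m\<ge>M. \<forall>n\<ge>M. norm (X m - X n) < e / 2"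
    using CauchyD [OF assms(1) \<open>0 < e / 2\<close>] by blast
  obtain N where N: "\<forall>m\<ge>N. \<forall>n\<ge>N. norm (Y m - Y n) < e / 2"
    using CauchyD [OF assms(2) \<open>0 < e / 2\<close>] by blast
  have "norm (X m + Y m - (X n + Y n)) < e" if "m \<ge> max M N" "n \<ge> max M N" for m n
    unfolding add_diff_add using M N that by (intro norm_triangle_lt) fastforce
  then show "\<exists>K. \<forall>m\<ge>K. \<forall>n\<ge>K. norm (X m + Y m - (X n + Y n)) < e"
    by blast
qed

lemma Cauchy_norm:
  fixes X :: "nat \<Rightarrow> 'a::real_normed_vector"
  assumes "Cauchy X" shows "(\<lambda>n. norm (X n)) \<longlonglongrightarrow> lim (\<lambda>n. norm (X n))"
proof -
  have "Cauchy (\<lambda>n. norm (X n))"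
  proof (rule CauchyI)
    fix e :: real assume "0 < e"
    then obtain M where "\<forall>m\<ge>M. \<forall>n\<ge>M. norm (X m - X n) < e"
      using CauchyD [OF assms] by blast
    then show "\<exists>M. \<forall>m\<ge>M. \<forall>n\<ge>M. norm (norm (X m) - norm (X n)) < e"
      unfolding real_norm_def by (meson norm_triangle_ineq3 order.strict_trans1)
  qed
  then show ?thesis
    by (intro convergent_LIMSEQ_iff [THEN iffD1] Cauchy_convergent)
qed

instantiation cauchy_completion :: (real_normed_vector) real_normed_vector
begin

lift_definition zero_cauchy_completion :: "'a cauchy_completion" is "\<lambda>_. 0"
  by (simp add: convergent_Cauchy convergent_const)

lift_definition plus_cauchy_completion ::
  "'a cauchy_completion \<Rightarrow> 'a cauchy_completion \<Rightarrow> 'a cauchy_completion"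
  is "\<lambda>X Y n. X n + Y n"
proof goal_cases
  case (1 X X' Y Y')
  then have "(\<lambda>n. (X n - X' n) + (Y n - Y' n)) \<longlonglongrightarrow> 0"
    by (intro tendsto_add_zero) simp_all
  with 1 show ?case
    by (simp add: Cauchy_add add_diff_add)
qed

lift_definition uminus_cauchy_completion :: "'a cauchy_completion \<Rightarrow> 'a cauchy_completion"
  is "\<lambda>X n. - X n"
proof goal_cases
  case (1 X Y)
  then have "(\<lambda>n. - (X n - Y n)) \<longlonglongrightarrow> - 0"
    by (intro tendsto_minus) simp
  with 1 show ?case
    by (simp add: bounded_linear.Cauchy [OF bounded_linear_minus [OF bounded_linear_ident]])
qed

definition minus_cauchy_completion ::
  "'a cauchy_completion \<Rightarrow> 'a cauchy_completion \<Rightarrow> 'a cauchy_completion"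
  where "x - y = x + - y" for x y :: "'a cauchy_completion"

lift_definition scaleR_cauchy_completion ::
  "real \<Rightarrow> 'a cauchy_completion \<Rightarrow> 'a cauchy_completion"
  is "\<lambda>r X n. r *\<^sub>R X n"
  by (simp add: bounded_linear.Cauchy [OF bounded_linear_scaleR_right]
      bounded_linear.tendsto_zero [OF bounded_linear_scaleR_right] flip: scaleR_diff_right)

lift_definition norm_cauchy_completion :: "'a cauchy_completion \<Rightarrow> real"
  is "\<lambda>X. lim (\<lambda>n. norm (X n))"
proof goal_cases
  case (1 X Y)
  have "(\<lambda>n. norm (X n) - norm (Y n)) \<longlonglongrightarrow> 0"
    by (rule Lim_null_comparison [where g = "\<lambda>n. norm (X n - Y n)"])
      (use 1 in \<open>simp_all add: tendsto_norm_zero norm_triangle_ineq3\<close>)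
  moreover have "(\<lambda>n. norm (Y n)) \<longlonglongrightarrow> lim (\<lambda>n. norm (Y n))"
    using 1 by (intro Cauchy_norm) simp
  ultimately have "(\<lambda>n. norm (X n)) \<longlonglongrightarrow> lim (\<lambda>n. norm (Y n))"
    by (rule Lim_transform [rotated])
  then show ?case
    by (rule limI)
qed

definition sgn_cauchy_completion :: "'a cauchy_completion \<Rightarrow> 'a cauchy_completion"
  where "sgn_cauchy_completion x = inverse (norm x) *\<^sub>R x" for x :: "'a cauchy_completion"
definition dist_cauchy_completion :: "'a cauchy_completion \<Rightarrow> 'a cauchy_completion \<Rightarrow> real"
  where "dist_cauchy_completion x y = norm (x - y)"
definition uniformity_cauchy_completion :: "('a cauchy_completion \<times> 'a cauchy_completion) filter"
  where "uniformity_cauchy_completion = (INF e\<in>{0 <..}. principal {(x, y). dist x y < e})"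
definition open_cauchy_completion :: "'a cauchy_completion set \<Rightarrow> bool"
  where "open_cauchy_completion U \<longleftrightarrow>
    (\<forall>x\<in>U. eventually (\<lambda>(x', y). x' = x \<longrightarrow> y \<in> U) uniformity)"

instance
proof
  fix x y z :: "'a cauchy_completion" and r s :: real
  note Cauchy_intros = Cauchy_add bounded_linear.Cauchy [OF bounded_linear_scaleR_right]
  show "x + y + z = x + (y + z)"
    by transfer (simp add: Cauchy_intros add.assoc)
  show "x + y = y + x"
    by transfer (simp add: Cauchy_intros add.commute)
  show "0 + x = x"
    by transfer auto
  show "- x + x = 0"
    by transfer (auto simp: convergent_Cauchy convergent_const)
  show "x - y = x + - y"
    by (rule minus_cauchy_completion_def)
  show "r *\<^sub>R (x + y) = r *\<^sub>R x + r *\<^sub>R y"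
    by transfer (simp add: Cauchy_intros scaleR_add_right)
  show "(r + s) *\<^sub>R x = r *\<^sub>R x + s *\<^sub>R x"
    by transfer (simp add: Cauchy_intros scaleR_add_left)
  show "r *\<^sub>R s *\<^sub>R x = (r * s) *\<^sub>R x"
    by transfer (simp add: Cauchy_intros)
  show "1 *\<^sub>R x = x"
    by transfer auto
  show "(norm x = 0) = (x = 0)"
  proof transfer
    fix X :: "nat \<Rightarrow> 'a"
    assume X: "Cauchy X \<and> Cauchy X \<and> (\<lambda>n. X n - X n) \<longlonglongrightarrow> 0"
    then have "(\<lambda>n. norm (X n)) \<longlonglongrightarrow> lim (\<lambda>n. norm (X n))"
      by (intro Cauchy_norm) simp
    then have "lim (\<lambda>n. norm (X n)) = 0 \<longleftrightarrow> (\<lambda>n. norm (X n)) \<longlonglongrightarrow> 0"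
      by (metis limI)
    then show "(lim (\<lambda>n. norm (X n)) = 0) =
        (Cauchy X \<and> Cauchy (\<lambda>_. 0 :: 'a) \<and> (\<lambda>n. X n - 0) \<longlonglongrightarrow> 0)"
      using X by (simp add: tendsto_norm_zero_iff convergent_Cauchy convergent_const)
  qed
  show "norm (x + y) \<le> norm x + norm y"
  proof transfer
    fix X Y :: "nat \<Rightarrow> 'a"
    assume "Cauchy X \<and> Cauchy X \<and> (\<lambda>n. X n - X n) \<longlonglongrightarrow> 0"
      "Cauchy Y \<and> Cauchy Y \<and> (\<lambda>n. Y n - Y n) \<longlonglongrightarrow> 0"
    then have X: "Cauchy X" and Y: "Cauchy Y"
      by simp_all
    have "(\<lambda>n. norm (X n) + norm (Y n)) \<longlonglongrightarrow> lim (\<lambda>n. norm (X n)) + lim (\<lambda>n. norm (Y n))"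
      by (rule tendsto_add [OF Cauchy_norm [OF X] Cauchy_norm [OF Y]])
    then show "lim (\<lambda>n. norm (X n + Y n)) \<le> lim (\<lambda>n. norm (X n)) + lim (\<lambda>n. norm (Y n))"
      by (rule LIMSEQ_le [OF Cauchy_norm [OF Cauchy_add [OF X Y]]]) (simp add: norm_triangle_ineq)
  qed
  show "norm (r *\<^sub>R x) = \<bar>r\<bar> * norm x"
  proof transfer
    fix r :: real and X :: "nat \<Rightarrow> 'a"
    assume "Cauchy X \<and> Cauchy X \<and> (\<lambda>n. X n - X n) \<longlonglongrightarrow> 0"
    then have "(\<lambda>n. norm (X n)) \<longlonglongrightarrow> lim (\<lambda>n. norm (X n))"
      by (intro Cauchy_norm) simp
    then show "lim (\<lambda>n. norm (r *\<^sub>R X n)) = \<bar>r\<bar> * lim (\<lambda>n. norm (X n))"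
      unfolding norm_scaleR by (intro limI tendsto_mult tendsto_const)
  qed
  show "sgn x = inverse (norm x) *\<^sub>R x"
    by (rule sgn_cauchy_completion_def)
  show "dist x y = norm (x - y)"
    by (rule dist_cauchy_completion_def)
  show "uniformity = (INF e\<in>{0 <..}. principal {(x, y :: 'a cauchy_completion). dist x y < e})"
    by (rule uniformity_cauchy_completion_def)
  show "open U = (\<forall>x\<in>U. eventually (\<lambda>(x', y). x' = x \<longrightarrow> y \<in> U) uniformity)"
    for U :: "'a cauchy_completion set"
    by (rule open_cauchy_completion_def)
qed

end

lemma bounded_linear_scaleC: "bounded_linear (\<lambda>x :: 'a::complex_normed_vector. c *\<^sub>C x)"
proof (rule bounded_linear_intro [where K = "cmod c"])
  fix x y :: 'a and r :: real
  show "c *\<^sub>C (x + y) = c *\<^sub>C x + c *\<^sub>C y"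
    by (rule scaleC_add_right)
  show "c *\<^sub>C (r *\<^sub>R x) = r *\<^sub>R c *\<^sub>C x"
    by (simp only: scaleC_scaleC mult.commute flip: scaleC_of_real)
  show "norm (c *\<^sub>C x) \<le> norm x * cmod c"
    by (simp add: norm_scaleC)
qed

instantiation cauchy_completion :: (complex_normed_vector) complex_normed_vector
begin

lift_definition scaleC_cauchy_completion ::
  "complex \<Rightarrow> 'a cauchy_completion \<Rightarrow> 'a cauchy_completion"
  is "\<lambda>c X n. c *\<^sub>C X n"
  by (simp add: bounded_linear.Cauchy [OF bounded_linear_scaleC]
      bounded_linear.tendsto_zero [OF bounded_linear_scaleC] flip: scaleC_diff_right)

instance
proof
  fix c d :: complex and r :: real and x y :: "'a cauchy_completion"
  note Cauchy_intros = Cauchy_add bounded_linear.Cauchy [OF bounded_linear_scaleC]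
    bounded_linear.Cauchy [OF bounded_linear_scaleR_right]
  show "c *\<^sub>C (x + y) = c *\<^sub>C x + c *\<^sub>C y"
    by transfer (simp add: Cauchy_intros scaleC_add_right)
  show "(c + d) *\<^sub>C x = c *\<^sub>C x + d *\<^sub>C x"
    by transfer (simp add: Cauchy_intros scaleC_add_left)
  show "c *\<^sub>C d *\<^sub>C x = (c * d) *\<^sub>C x"
    by transfer (simp add: Cauchy_intros scaleC_scaleC)
  show "of_real r *\<^sub>C x = r *\<^sub>R x"
    by transfer (simp add: Cauchy_intros scaleC_of_real)
  show "norm (c *\<^sub>C x) = cmod c * norm x"
  proof transfer
    fix c :: complex and X :: "nat \<Rightarrow> 'a"
    assume "Cauchy X \<and> Cauchy X \<and> (\<lambda>n. X n - X n) \<longlonglongrightarrow> 0"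
    then have "(\<lambda>n. norm (X n)) \<longlonglongrightarrow> lim (\<lambda>n. norm (X n))"
      by (intro Cauchy_norm) simp
    then show "lim (\<lambda>n. norm (c *\<^sub>C X n)) = cmod c * lim (\<lambda>n. norm (X n))"
      unfolding norm_scaleC by (intro limI tendsto_mult tendsto_const)
  qed
qed

end


section \<open>The homogeneous Sobolev space and weak derivatives\<close>

type_synonym Hdot1 = "test_function cauchy_completion"

text \<open>The gradient is the isometric extension of \<^const>\<open>test_deriv\<close> to the completion; the
  limit exists as \<^typ>\<open>L2\<close> is complete.\<close>

lift_definition grad :: "Hdot1 \<Rightarrow> L2" is "\<lambda>X. lim (\<lambda>n. test_to_L2 (test_deriv (X n)))"
proof goal_cases
  case (1 X Y)
  let ?D = "\<lambda>\<phi>. test_to_L2 (test_deriv \<phi>)"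
  have "?D \<phi> - ?D \<psi> = ?D (\<phi> - \<psi>)" for \<phi> \<psi>
    using test_to_L2_add [of "test_deriv (\<phi> - \<psi>)" "test_deriv \<psi>"]
    by (simp flip: test_deriv_add)
  then have "norm (?D \<phi> - ?D \<psi>) = norm (\<phi> - \<psi>)" for \<phi> \<psi>
    by (simp add: norm_test_function_def)
  then have "(\<lambda>n. norm (?D (X n) - ?D (Y n))) \<longlonglongrightarrow> 0"
    using 1 by (simp add: tendsto_norm_zero_iff)
  then have "(\<lambda>n. ?D (X n) - ?D (Y n)) \<longlonglongrightarrow> 0"
    by (rule tendsto_norm_zero_cancel)
  then have "(\<lambda>n. ?D (X n)) \<longlonglongrightarrow> L \<longleftrightarrow> (\<lambda>n. ?D (Y n)) \<longlonglongrightarrow> L" for L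
    by (rule Lim_transform_eq)
  then show ?case
    by (simp add: t2_space_class.Lim_def)
qed

definition has_weak_deriv :: "L2 \<Rightarrow> L2 \<Rightarrow> bool"
  where "has_weak_deriv u v \<longleftrightarrow>
    (\<forall>\<phi>. pairing v (test_to_L2 \<phi>) = - pairing u (test_to_L2 (test_deriv \<phi>)))"

definition weak_deriv :: "L2 \<Rightarrow> L2"
  where "weak_deriv u = (THE v. has_weak_deriv u v)"

definition H1 :: "L2 set"
  where "H1 = {u. \<exists>v. has_weak_deriv u v}"

text \<open>The natural embedding of \<^const>\<open>H1\<close>, compatible with the gradient. It is well-defined:
  \<^const>\<open>grad\<close> is isometric, hence injective, and for test functions \<open>\<phi>\<^sub>n\<close> converging to
  \<open>u\<close> in the Sobolev norm, the class of the sequence \<open>\<phi>\<close> has the gradient \<open>weak_deriv u\<close>.\<close>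

definition H1_to_Hdot1 :: "L2 \<Rightarrow> Hdot1"
  where "H1_to_Hdot1 u = (THE \<xi>. grad \<xi> = weak_deriv u)"

text \<open>The distributional Laplacian of \<open>\<psi>\<close> is square integrable iff \<^term>\<open>grad \<psi> \<in> H1\<close>.\<close>

definition laplacian :: "Hdot1 \<Rightarrow> L2"
  where "laplacian \<psi> = weak_deriv (grad \<psi>)"


section \<open>The damped wave operator\<close>

definition damped_wave :: "(real \<Rightarrow> complex) \<Rightarrow> (Hdot1 \<times> L2 \<rightharpoonup> Hdot1 \<times> L2)"
  where "damped_wave a = (\<lambda>(\<psi>\<^sub>1, \<psi>\<^sub>2).
    if grad \<psi>\<^sub>1 \<in> H1 \<and> \<psi>\<^sub>2 \<in> H1
    then Some (H1_to_Hdot1 \<psi>\<^sub>2, laplacian \<psi>\<^sub>1 - Linf_mult a \<psi>\<^sub>2)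
    else None)"

end

theory Submission
  imports Defs
begin

text \<open>In the coordinates \<open>f = \<nabla>\<psi>\<^sub>1 + \<psi>\<^sub>2\<close> and \<open>g(x) = (\<nabla>\<psi>\<^sub>1 - \<psi>\<^sub>2)(-x)\<close>, the undamped operator is the generator of
  translation on both components. For given incoming data, the velocity \<open>v(t, x)\<close> of the damped wave
  is \<open>v\<^sub>0(t, x) - 1/2 \<integral> a(y) v(t - \<bar>x - y\<bar>, y) dy\<close> with the velocity \<open>v\<^sub>0\<close> of the free wave. For
  functions of \<open>x\<close> with values in the square integrable functions of \<open>t\<close>, this is a fixed point
  equation with the contraction constant \<open>\<parallel>a\<parallel> / 2 < 1\<close>. The wave operator \<open>W\<close> maps the
  incoming data to the data at time \<open>0\<close>. Conversely, the data at time \<open>0\<close> determine \<open>v\<close> at negative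
  times by the advanced equation, with the same constant, so \<open>W\<close> is bijective with a bounded inverse.
  As \<open>W\<close> intertwines the two evolutions, it intertwines their generators including the domains.

  The constant is optimal: for a well of mass slightly larger than \<open>2\<close>, the damped operator has a
  positive eigenvalue, whereas the undamped one has none.\<close>

section \<open>Completeness of the space of square integrable functions\<close>

text \<open>The factor 1/2 in the fixed point equation is the height of the fundamental solution of
  the wave equation on the line, half the indicator of the light cone; its time derivative evaluates
  the source at the retarded time. Functions square integrable in t and bounded in x turn these time
  shifts into isometries, so that only the mass of the damping enters the constant. The delicate
  point is the equality of domains for a damping that is merely bounded and measurable. It is
  settled without constructing the damped evolution: the solution map commutes with time
  translations, so the commutator of W with a translation by r only sees the cutoff to negative
  times, on a slab of width r. Divided by r, it converges on every vector, not just on a domain.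
  Hence the difference quotients of u and of W u converge simultaneously. As a velocity has no value
  at a single time, the limit is computed for elementary waves, whose trace at time 0 is a change of
  variables, and then superposed. In one dimension the gradient is onto, so the energy space is two
  copies of \<open>L2\<close>.\<close>

lemma L2_cases:
  obtains f where "square_integrable f" "u = abs_L2 f"
proof -
  show ?thesis
    using that Quotient3_abs_rep[OF Quotient3_L2] Quotient3_rep_reflp[OF Quotient3_L2]
    by metis
qed

lemma abs_L2_eq_iff:
  assumes "square_integrable f" "square_integrable g"
  shows "abs_L2 f = abs_L2 g \<longleftrightarrow> (AE x in lebesgue. f x = g x)"
  using Quotient3_rel[OF Quotient3_L2, of f g] assms by auto

lemma abs_L2_arith:
  assumes "square_integrable f" "square_integrable g"
  shows "abs_L2 f + abs_L2 g = abs_L2 (\<lambda>x. f x + g x)"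
    and "abs_L2 f - abs_L2 g = abs_L2 (\<lambda>x. f x - g x)"
    and "- abs_L2 f = abs_L2 (\<lambda>x. - f x)"
    and "c *\<^sub>C abs_L2 f = abs_L2 (\<lambda>x. c * f x)"
    and "r *\<^sub>R abs_L2 f = abs_L2 (\<lambda>x. of_real r * f x)"
proof -
  have "square_integrable (\<lambda>x. - g x)"
    using square_integrable_cmult[OF assms(2), of "-1"] by simp
  then show "abs_L2 f - abs_L2 g = abs_L2 (\<lambda>x. f x - g x)"
    using assms by (simp add: minus_L2_def uminus_L2.abs_eq plus_L2.abs_eq)
qed (use assms in \<open>simp_all add: plus_L2.abs_eq scaleC_L2.abs_eq scaleR_L2.abs_eq uminus_L2.abs_eq\<close>)

lemma square_integrable_diff:
  assumes "square_integrable f" "square_integrable g"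
  shows "square_integrable (\<lambda>x. f x - g x)"
  using square_integrable_add[OF assms(1) square_integrable_cmult[OF assms(2), of "-1"]] by simp

lemma square_integrableD:
  assumes "square_integrable f"
  shows "f \<in> borel_measurable lebesgue" "integrable lebesgue (\<lambda>x. (cmod (f x))\<^sup>2)"
  using assms by (auto simp: square_integrable_def)

lemma norm_abs_L2:
  assumes "square_integrable f"
  shows "(norm (abs_L2 f))\<^sup>2 = (LINT x|lebesgue. (cmod (f x))\<^sup>2)"
proof -
  have "(norm (abs_L2 f))\<^sup>2 = abs_L2 f \<bullet> abs_L2 f"
    by (simp add: power2_norm_eq_inner)
  also have "\<dots> = (LINT x|lebesgue. f x \<bullet> f x)"
    using assms by (simp add: inner_L2.abs_eq)
  finally show ?thesis by (simp add: dot_square_norm)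
qed

lemma nn_integral_abs_L2:
  assumes "square_integrable f"
  shows "(\<integral>\<^sup>+x. ennreal ((cmod (f x))\<^sup>2) \<partial>lebesgue) = ennreal ((norm (abs_L2 f))\<^sup>2)"
  using assms unfolding norm_abs_L2[OF assms]
  by (intro nn_integral_eq_integral) (auto simp: square_integrable_def)

lemma square_integrable_indicator_mult:
  assumes "square_integrable f" "A \<in> sets lebesgue"
  shows "square_integrable (\<lambda>x. indicator A x * f x)"
  by (rule square_integrable_mult_bounded[OF _ assms(1)])
    (use assms(2) in \<open>auto simp: in_Linf_def indicator_def intro!: exI[of _ 1]\<close>)

lemma square_integrable_bounded_support:
  assumes "f \<in> borel_measurable lebesgue" "\<And>x. cmod (f x) \<le> C * indicator {a..b} x"
  shows "square_integrable f"
proof -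
  have "integrable lebesgue (\<lambda>x. C\<^sup>2 * indicator {a..b} x :: real)"
    by (intro integrable_mult_right integrable_real_indicator) (auto simp: emeasure_lborel_Icc_eq)
  moreover have "norm ((cmod (f x))\<^sup>2) \<le> norm (C\<^sup>2 * indicator {a..b} x :: real)" for x
    using power_mono[OF assms(2)[of x] norm_ge_zero, of 2]
    by (auto simp: power_mult_distrib indicator_def split: if_splits)
  ultimately have "integrable lebesgue (\<lambda>x. (cmod (f x))\<^sup>2)"
    using measurable_compose[OF assms(1), of "\<lambda>z. (cmod z)\<^sup>2" borel]
    by (elim Bochner_Integration.integrable_bound) (simp, intro AE_I2)
  then show ?thesis
    using assms(1) by (simp add: square_integrable_def)
qed

text \<open>The functions need not be integrable on the whole line, so the argument is local: on
  [-n, n] the Cauchy-Schwarz inequality against the indicator bounds the integrals of their absolute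
  values by their norms, and these intervals exhaust the line.\<close>

lemma AE_summable_of_norm_summable:
  assumes d: "\<And>k. square_integrable (d k)" and sum: "summable (\<lambda>k. norm (abs_L2 (d k)))"
  shows "AE x in lebesgue. summable (\<lambda>k. cmod (d k x))"
proof -
  have "AE x in lebesgue. x \<in> {-real n..real n} \<longrightarrow> summable (\<lambda>k. cmod (d k x))" for n
  proof -
    let ?I = "\<lambda>x. complex_of_real (indicator {-real n..real n} x)"
    have [measurable]: "{-real n..real n} \<in> sets lebesgue" by simp
    have Im: "?I \<in> borel_measurable lebesgue" by measurable
    have I: "square_integrable ?I"
      by (rule square_integrable_bounded_support[where C=1 and a="-real n" and b="real n"])
        (use Im in auto)
    have m[measurable]: "d k \<in> borel_measurable lebesgue" for k
      using d by (auto simp: square_integrable_def)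
    have dn: "square_integrable (\<lambda>x. complex_of_real (cmod (d k x)))" for k
      using d[of k] by (auto simp: square_integrable_def)
    have nn: "norm (abs_L2 (\<lambda>x. complex_of_real (cmod (d k x)))) = norm (abs_L2 (d k))" for k
      by (rule power2_eq_imp_eq) (simp_all add: norm_abs_L2 dn d)
    have int: "(\<integral>\<^sup>+x. ennreal (indicator {-real n..real n} x * cmod (d k x)) \<partial>lebesgue)
        \<le> ennreal (norm (abs_L2 ?I) * norm (abs_L2 (d k)))" for k
    proof -
      have i: "integrable lebesgue (\<lambda>x. ?I x \<bullet> complex_of_real (cmod (d k x)))"
        by (rule integrable_inner_square_integrable[OF I dn])
      have e: "?I x \<bullet> complex_of_real (cmod (d k x)) = indicator {-real n..real n} x * cmod (d k x)" for x
        by (simp add: inner_complex_def)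
      have "(\<integral>\<^sup>+x. ennreal (indicator {-real n..real n} x * cmod (d k x)) \<partial>lebesgue)
        = ennreal (LINT x|lebesgue. ?I x \<bullet> complex_of_real (cmod (d k x)))"
        unfolding e[symmetric] using i by (intro nn_integral_eq_integral) (auto simp: e)
      also have "(LINT x|lebesgue. ?I x \<bullet> complex_of_real (cmod (d k x)))
          = abs_L2 ?I \<bullet> abs_L2 (\<lambda>x. complex_of_real (cmod (d k x)))"
        using I dn by (simp add: inner_L2.abs_eq)
      also have "\<dots> \<le> norm (abs_L2 ?I) * norm (abs_L2 (d k))"
        using norm_cauchy_schwarz nn by metis
      finally show ?thesis by (simp add: ennreal_leI)
    qed
    have "(\<integral>\<^sup>+x. (\<Sum>k. ennreal (indicator {-real n..real n} x * cmod (d k x))) \<partial>lebesgue)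
       = (\<Sum>k. \<integral>\<^sup>+x. ennreal (indicator {-real n..real n} x * cmod (d k x)) \<partial>lebesgue)"
      by (rule nn_integral_suminf) measurable
    also have "\<dots> \<le> (\<Sum>k. ennreal (norm (abs_L2 ?I) * norm (abs_L2 (d k))))"
      by (intro suminf_le int) auto
    also have "\<dots> = ennreal (\<Sum>k. norm (abs_L2 ?I) * norm (abs_L2 (d k)))"
      by (rule suminf_ennreal2) (use sum in \<open>auto intro: summable_mult\<close>)
    also have "\<dots> < \<infinity>" by simp
    finally have "AE x in lebesgue. (\<Sum>k. ennreal (indicator {-real n..real n} x * cmod (d k x))) \<noteq> \<infinity>"
      by (intro nn_integral_noteq_infinite) (auto simp: less_top)
    then show ?thesis
    proof eventually_elim
      case (elim x)
      show ?case
      proof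
        assume "x \<in> {-real n..real n}"
        with elim have "(\<Sum>k. ennreal (cmod (d k x))) \<noteq> top" by simp
        then show "summable (\<lambda>k. cmod (d k x))"
          by (intro summable_suminf_not_top) auto
      qed
    qed
  qed
  then have "AE x in lebesgue. \<forall>n. x \<in> {-real n..real n} \<longrightarrow> summable (\<lambda>k. cmod (d k x))"
    unfolding AE_all_countable by blast
  then show ?thesis
  proof eventually_elim
    case (elim x)
    obtain n where "\<bar>x\<bar> \<le> real n" using real_arch_simple by blast
    then have "x \<in> {-real n..real n}" by auto
    with elim show ?case by blast
  qed
qed

text \<open>The geometric rate makes the increments summable in norm, as the pointwise argument for
  completeness requires.\<close>

lemma subseq_fast_Cauchy:
  fixes X :: "nat \<Rightarrow> 'a::real_normed_vector"
  assumes "Cauchy X"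
  obtains r :: "nat \<Rightarrow> nat" where "strict_mono r" "\<And>k. norm (X (r (Suc k)) - X (r k)) < (1/2)^k"
proof -
  have "\<exists>N. \<forall>m\<ge>N. \<forall>n\<ge>N. norm (X m - X n) < (1/2)^k" for k :: nat
    using CauchyD[OF assms, of "(1/2)^k"] by auto
  then obtain M where M: "\<And>k m n. m \<ge> M k \<Longrightarrow> n \<ge> M k \<Longrightarrow> norm (X m - X n) < (1/2)^k"
    by metis
  define r where "r = rec_nat (M 0) (\<lambda>k p. max (Suc p) (M (Suc k)))"
  have rS: "r (Suc k) = max (Suc (r k)) (M (Suc k))" for k by (simp add: r_def)
  have r0: "r 0 = M 0" by (simp add: r_def)
  have sm: "strict_mono r" by (rule strict_monoI_Suc) (simp add: rS)
  have rM: "r k \<ge> M k" for k by (cases k) (simp_all add: rS r0)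
  show ?thesis
  proof (rule that[OF sm])
    fix k
    have "r (Suc k) \<ge> M k" using rM[of k] rS[of k] by simp
    then show "norm (X (r (Suc k)) - X (r k)) < (1/2)^k"
      by (intro M rM)
  qed
qed

text \<open>Riesz-Fischer: a fast subsequence converges pointwise almost everywhere, and Fatou's
  lemma transfers the Cauchy estimate to the limit function.\<close>

lemma Cauchy_L2_converges:
  fixes X :: "nat \<Rightarrow> L2"
  assumes "Cauchy X"
  shows "convergent X"
proof -
  obtain r where r: "strict_mono r" "\<And>k. norm (X (r (Suc k)) - X (r k)) < (1/2)^k"
    by (rule subseq_fast_Cauchy[OF assms]) blast
  have "\<exists>g. \<forall>n. square_integrable (g n) \<and> X n = abs_L2 (g n)"
    by (rule choice) (metis L2_cases)
  then obtain g where g: "\<And>n. square_integrable (g n)" "\<And>n. X n = abs_L2 (g n)"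
    by blast
  define f where "f k = g (r k)" for k
  have f: "square_integrable (f k)" "X (r k) = abs_L2 (f k)" for k
    by (simp_all add: f_def g)
  have [measurable]: "f k \<in> borel_measurable lebesgue" "g k \<in> borel_measurable lebesgue" for k
    using f(1) g(1) by (auto simp: square_integrable_def)
  have "AE x in lebesgue. summable (\<lambda>k. cmod (f (Suc k) x - f k x))"
  proof (rule AE_summable_of_norm_summable)
    show "square_integrable (\<lambda>x. f (Suc k) x - f k x)" for k
      by (intro square_integrable_diff f)
    show "summable (\<lambda>k. norm (abs_L2 (\<lambda>x. f (Suc k) x - f k x)))"
    proof (rule summable_comparison_test')
      show "summable (\<lambda>k. (1/2::real)^k)" by (rule summable_geometric) simp
      show "norm (norm (abs_L2 (\<lambda>x. f (Suc k) x - f k x))) \<le> (1/2)^k" for k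
        using r(2)[of k] by (simp add: f abs_L2_arith(2) less_imp_le)
    qed
  qed
  then have conv: "AE x in lebesgue. (\<lambda>k. f k x) \<longlonglongrightarrow> lim (\<lambda>k. f k x)"
  proof eventually_elim
    case (elim x)
    then have "summable (\<lambda>k. f (Suc k) x - f k x)" by (rule summable_norm_cancel)
    then have "convergent (\<lambda>n. \<Sum>k<n. f (Suc k) x - f k x)" by (simp add: summable_iff_convergent)
    then have "convergent (\<lambda>n. f n x - f 0 x)"
      using sum_lessThan_telescope[of "\<lambda>k. f k x"] by simp
    then have "convergent (\<lambda>n. (f n x - f 0 x) + f 0 x)" by (intro convergent_add convergent_const)
    then show ?case by (simp add: convergent_LIMSEQ_iff)
  qed
  define F where "F x = lim (\<lambda>k. f k x)" for x
  have [measurable]: "F \<in> borel_measurable lebesgue"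
    unfolding F_def by (rule borel_measurable_lim_metric) measurable
  have bound: "(\<integral>\<^sup>+x. ennreal ((cmod (F x - g n x))\<^sup>2) \<partial>lebesgue) \<le> ennreal (e\<^sup>2)"
    if e: "\<And>k. k \<ge> N \<Longrightarrow> norm (X k - X n) \<le> e" and "e \<ge> 0" for n N e
  proof -
    have "(\<integral>\<^sup>+x. ennreal ((cmod (F x - g n x))\<^sup>2) \<partial>lebesgue)
      = (\<integral>\<^sup>+x. liminf (\<lambda>k. ennreal ((cmod (f k x - g n x))\<^sup>2)) \<partial>lebesgue)"
      using conv
    proof (intro nn_integral_cong_AE, eventually_elim)
      case (elim x)
      then have "(\<lambda>k. ennreal ((cmod (f k x - g n x))\<^sup>2)) \<longlonglongrightarrow> ennreal ((cmod (F x - g n x))\<^sup>2)"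
        unfolding F_def by (intro tendsto_intros)
      then show ?case by (intro lim_imp_Liminf[symmetric]) auto
    qed
    also have "\<dots> \<le> liminf (\<lambda>k. \<integral>\<^sup>+x. ennreal ((cmod (f k x - g n x))\<^sup>2) \<partial>lebesgue)"
      by (rule nn_integral_liminf) measurable
    also have "\<dots> = liminf (\<lambda>k. ennreal ((norm (X (r k) - X n))\<^sup>2))"
      by (simp only: f(2) g(2)[of n] abs_L2_arith(2)[OF f(1) g(1)] nn_integral_abs_L2 square_integrable_diff f(1) g(1))
    also have "\<dots> \<le> ennreal (e\<^sup>2)"
    proof (rule Liminf_le)
      have "\<forall>\<^sub>F k in sequentially. r k \<ge> N"
        using filterlim_subseq[OF r(1)] by (auto simp: filterlim_at_top)
      then show "\<forall>\<^sub>F k in sequentially. ennreal ((norm (X (r k) - X n))\<^sup>2) \<le> ennreal (e\<^sup>2)"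
        by eventually_elim (intro ennreal_leI power_mono e; simp)
    qed simp
    finally show ?thesis .
  qed
  obtain N1 where N1: "\<forall>m\<ge>N1. \<forall>n\<ge>N1. norm (X m - X n) < 1"
    using CauchyD[OF assms, of 1] by auto
  have sq: "square_integrable (\<lambda>x. F x - g n x)" if "n \<ge> N1" for n
  proof -
    have "(\<integral>\<^sup>+x. ennreal ((cmod (F x - g n x))\<^sup>2) \<partial>lebesgue) \<le> ennreal (1\<^sup>2)"
      by (rule bound[where N=N1]) (use N1 that in \<open>auto intro: less_imp_le\<close>)
    then have "(\<integral>\<^sup>+x. ennreal ((cmod (F x - g n x))\<^sup>2) \<partial>lebesgue) < \<infinity>"
      using le_less_trans by fastforce
    then show ?thesis
      unfolding square_integrable_def by (auto intro!: integrableI_bounded)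
  qed
  have FS: "square_integrable F"
    using square_integrable_add[OF sq[OF order_refl] g(1)[of N1]] by simp
  have "X \<longlonglongrightarrow> abs_L2 F"
  proof (rule LIMSEQ_I)
    fix e :: real assume "e > 0"
    then obtain N where N: "\<forall>m\<ge>N. \<forall>n\<ge>N. norm (X m - X n) < e/2"
      using CauchyD[OF assms, of "e/2"] by auto
    show "\<exists>no. \<forall>n\<ge>no. norm (X n - abs_L2 F) < e"
    proof (intro exI allI impI)
      fix n assume "n \<ge> N"
      then have "(\<integral>\<^sup>+x. ennreal ((cmod (F x - g n x))\<^sup>2) \<partial>lebesgue) \<le> ennreal ((e/2)\<^sup>2)"
        using \<open>e > 0\<close> N by (intro bound[where N=N]) (auto intro: less_imp_le)
      then have "(norm (abs_L2 F - X n))\<^sup>2 \<le> (e/2)\<^sup>2"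
        by (simp add: g(2) abs_L2_arith(2) FS g(1) nn_integral_abs_L2 square_integrable_diff)
      then have "norm (abs_L2 F - X n) \<le> e/2"
        using \<open>e > 0\<close> by (simp add: power2_le_iff_abs_le)
      then show "norm (X n - abs_L2 F) < e"
        using \<open>e > 0\<close> by (simp add: norm_minus_commute)
    qed
  qed
  then show ?thesis by (auto simp: convergent_def)
qed

text \<open>Together with second countability below, completeness makes the Bochner integral of
  \<open>L2\<close>-valued functions available; the damping term \<open>damp\<close> is such an
  integral over the position.\<close>

instance L2 :: banach
  by standard (rule Cauchy_L2_converges)

section \<open>Density and separability\<close>

lemma norm_abs_L2_le:
  assumes "f \<in> borel_measurable lebesgue" "\<And>x. cmod (f x) \<le> C * indicator {a..b} x" "a \<le> b" "0 \<le> C"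
  shows "norm (abs_L2 f) \<le> C * sqrt (b - a)"
proof -
  have sq: "square_integrable f" by (rule square_integrable_bounded_support[OF assms(1,2)])
  have le: "(cmod (f x))\<^sup>2 \<le> C\<^sup>2 * indicator {a..b} x" for x
    using power_mono[OF assms(2)[of x] norm_ge_zero, of 2]
    by (cases "x \<in> {a..b}") (simp_all add: power_mult_distrib)
  have "(norm (abs_L2 f))\<^sup>2 \<le> (LINT x|lebesgue. C\<^sup>2 * indicator {a..b} x)"
    unfolding norm_abs_L2[OF sq]
    by (rule integral_mono) (use square_integrableD[OF sq] le in \<open>auto simp: emeasure_lborel_Icc_eq\<close>)
  also have "\<dots> = (C * sqrt (b - a))\<^sup>2"
    using assms(3) by (simp add: power_mult_distrib)
  finally show ?thesis
    using assms(3,4) by (simp add: power2_le_iff_abs_le)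
qed

lemma tendsto_abs_L2_dominated:
  assumes f: "square_integrable f" and g: "square_integrable g"
    and m: "\<And>n. s n \<in> borel_measurable lebesgue"
    and le: "\<And>n x. cmod (s n x) \<le> cmod (g x)"
    and lim: "AE x in lebesgue. (\<lambda>n. s n x) \<longlonglongrightarrow> f x"
  shows "(\<lambda>n. abs_L2 (s n)) \<longlonglongrightarrow> abs_L2 f" "square_integrable (s n)"
proof -
  have sq: "square_integrable (s n)" for n
    unfolding square_integrable_def
  proof
    show "s n \<in> borel_measurable lebesgue" by (rule m)
    show "integrable lebesgue (\<lambda>x. (cmod (s n x))\<^sup>2)"
    proof (rule Bochner_Integration.integrable_bound[OF square_integrableD(2)[OF g]])
      show "(\<lambda>x. (cmod (s n x))\<^sup>2) \<in> borel_measurable lebesgue"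
        using m[of n] by measurable
      show "AE x in lebesgue. norm ((cmod (s n x))\<^sup>2) \<le> norm ((cmod (g x))\<^sup>2)"
        by (intro AE_I2) (simp add: le power_mono)
    qed
  qed
  then show "square_integrable (s n)" .
  have [measurable]: "f \<in> borel_measurable lebesgue" "\<And>n. s n \<in> borel_measurable lebesgue"
    using m f by (auto simp: square_integrable_def)
  have "(\<lambda>n. LINT x|lebesgue. (cmod (s n x - f x))\<^sup>2) \<longlonglongrightarrow> (LINT (x::real)|lebesgue. 0)"
  proof (rule integral_dominated_convergence[where w = "\<lambda>x. 2 * (cmod (g x))\<^sup>2 + 2 * (cmod (f x))\<^sup>2"])
    show "integrable lebesgue (\<lambda>x. 2 * (cmod (g x))\<^sup>2 + 2 * (cmod (f x))\<^sup>2)"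
      using square_integrableD(2)[OF f] square_integrableD(2)[OF g] by auto
    show "AE x in lebesgue. (\<lambda>n. (cmod (s n x - f x))\<^sup>2) \<longlonglongrightarrow> 0"
      using lim
    proof eventually_elim
      case (elim x)
      have "(\<lambda>n. (cmod (s n x - f x))\<^sup>2) \<longlonglongrightarrow> (cmod (f x - f x))\<^sup>2"
        by (intro tendsto_intros elim)
      then show ?case by simp
    qed
    show "AE x in lebesgue. norm ((cmod (s n x - f x))\<^sup>2) \<le> 2 * (cmod (g x))\<^sup>2 + 2 * (cmod (f x))\<^sup>2" for n
    proof (intro AE_I2)
      fix x
      have "(cmod (s n x - f x))\<^sup>2 \<le> (cmod (g x) + cmod (f x))\<^sup>2"
        by (intro power_mono order_trans[OF norm_triangle_ineq4] add_right_mono le) simp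
      also have "\<dots> \<le> 2 * (cmod (g x))\<^sup>2 + 2 * (cmod (f x))\<^sup>2"
        using sum_squares_bound [of "cmod (g x)" "cmod (f x)"] unfolding power2_sum by linarith
      finally show "norm ((cmod (s n x - f x))\<^sup>2) \<le> 2 * (cmod (g x))\<^sup>2 + 2 * (cmod (f x))\<^sup>2"
        by simp
    qed
  qed measurable
  moreover have "(LINT x|lebesgue. (cmod (s n x - f x))\<^sup>2) = (norm (abs_L2 (s n) - abs_L2 f))\<^sup>2" for n
    using sq f by (simp add: abs_L2_arith(2) norm_abs_L2 square_integrable_diff)
  ultimately have "(\<lambda>n. (norm (abs_L2 (s n) - abs_L2 f))\<^sup>2) \<longlonglongrightarrow> 0" by simp
  then have "(\<lambda>n. sqrt ((norm (abs_L2 (s n) - abs_L2 f))\<^sup>2)) \<longlonglongrightarrow> sqrt 0"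
    by (rule tendsto_real_sqrt)
  then show "(\<lambda>n. abs_L2 (s n)) \<longlonglongrightarrow> abs_L2 f"
    by (simp add: LIM_zero_iff tendsto_norm_zero_iff)
qed

lemma borel_measurable_lebesgue_indicator_mult:
  assumes "f \<in> borel_measurable lebesgue"
  shows "(\<lambda>x. indicator {a..b::real} x * f x :: complex) \<in> borel_measurable lebesgue"
proof -
  have [measurable]: "{a..b} \<in> sets lebesgue" by simp
  show ?thesis using assms by measurable
qed

lemma bounded_support_approx:
  assumes "e > 0"
  obtains f n where "f \<in> borel_measurable lebesgue"
    "\<And>x. cmod (f x) \<le> real n * indicator {-real n..real n} x" "norm (u - abs_L2 f) < e" "n > 0"
proof -
  obtain f where f: "square_integrable f" "u = abs_L2 f" by (rule L2_cases)
  have [measurable]: "f \<in> borel_measurable lebesgue" using f by (simp add: square_integrable_def)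
  define s where "s n x = indicator {-real n..real n} x * (if cmod (f x) \<le> real n then f x else 0)" for n :: nat and x
  have m: "s n \<in> borel_measurable lebesgue" for n
    unfolding s_def by (rule borel_measurable_lebesgue_indicator_mult) measurable
  have "(\<lambda>n. abs_L2 (s n)) \<longlonglongrightarrow> abs_L2 f"
  proof (rule tendsto_abs_L2_dominated[OF f(1) f(1) m])
    show "cmod (s n x) \<le> cmod (f x)" for n x by (auto simp: s_def indicator_def)
    show "AE x in lebesgue. (\<lambda>n. s n x) \<longlonglongrightarrow> f x"
    proof (intro AE_I2 tendsto_eventually)
      fix x
      obtain N where "max \<bar>x\<bar> (cmod (f x)) \<le> real N" using real_arch_simple by blast
      then have "s n x = f x" if "n \<ge> N" for n
        using that by (auto simp: s_def indicator_def)
      then show "\<forall>\<^sub>F n in sequentially. s n x = f x"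
        by (rule eventually_sequentiallyI)
    qed
  qed
  then have "\<forall>\<^sub>F n in sequentially. dist (abs_L2 (s n)) (abs_L2 f) < e"
    using assms by (rule tendstoD)
  then have "\<forall>\<^sub>F n in sequentially. dist (abs_L2 (s n)) (abs_L2 f) < e \<and> n > 0"
    using eventually_gt_at_top[of "0::nat"] by eventually_elim auto
  then obtain n where n: "dist (abs_L2 (s n)) (abs_L2 f) < e" "n > 0"
    by (auto dest: eventually_happens)
  show ?thesis
  proof (rule that[OF m[of n]])
    show "cmod (s n x) \<le> real n * indicator {-real n..real n} x" for x
      by (auto simp: s_def indicator_def)
    show "norm (u - abs_L2 (s n)) < e"
      using n f by (simp add: dist_norm norm_minus_commute)
  qed fact
qed

text \<open>Measurability supplies continuous functions converging almost everywhere. Clipping them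
  to the ball of radius C by the nearest point projection keeps them continuous and provides a
  dominating function.\<close>

lemma continuous_support_approx:
  assumes "f \<in> borel_measurable lebesgue" "\<And>x. cmod (f x) \<le> C * indicator {a..b} x" "e > 0" "C > 0"
  obtains g where "continuous_on UNIV g" "norm (abs_L2 f - abs_L2 (\<lambda>x. indicator {a..b} x * g x)) < e"
proof -
  have "f measurable_on UNIV"
    using measurable_on_iff_borel_measurable[of UNIV f] assms(1) by simp
  then obtain N g where N: "negligible N" and g: "\<And>n. continuous_on UNIV (g n)"
    and lim: "\<And>x. x \<notin> N \<Longrightarrow> (\<lambda>n. g n x) \<longlonglongrightarrow> f x"
    unfolding measurable_on_def by auto
  define c where "c = closest_point (cball (0::complex) C)"
  have cc: "continuous_on UNIV c"
    unfolding c_def by (intro continuous_on_closest_point) (use assms in auto)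
  have c_le: "cmod (c z) \<le> C" for z
    using closest_point_in_set[of "cball (0::complex) C" z] assms(4) by (auto simp: c_def)
  have c_id: "c z = z" if "cmod z \<le> C" for z
    unfolding c_def by (intro closest_point_self) (use that in auto)
  have sf: "square_integrable f" by (rule square_integrable_bounded_support[OF assms(1,2)])
  have gm: "continuous_on UNIV (\<lambda>x. c (g n x))" for n
    by (rule continuous_on_compose2[OF cc g]) auto
  have gm2: "(\<lambda>x. c (g n x)) \<in> borel_measurable lebesgue" for n
    by (intro measurable_completion) (simp add: borel_measurable_continuous_onI gm)
  have "(\<lambda>n. abs_L2 (\<lambda>x. indicator {a..b} x * c (g n x))) \<longlonglongrightarrow> abs_L2 f"
  proof (rule tendsto_abs_L2_dominated[OF sf, where g = "\<lambda>x. complex_of_real (C * indicator {a..b} x)"])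
    have "(\<lambda>x. indicator {a..b} x * complex_of_real C) \<in> borel_measurable lebesgue"
      by (rule borel_measurable_lebesgue_indicator_mult) simp
    moreover have "indicator {a..b} x * complex_of_real C = complex_of_real (C * indicator {a..b} x)" for x
      by (simp add: indicator_def)
    ultimately have "(\<lambda>x. complex_of_real (C * indicator {a..b} x)) \<in> borel_measurable lebesgue" by simp
    then show "square_integrable (\<lambda>x. complex_of_real (C * indicator {a..b} x))"
      by (rule square_integrable_bounded_support[where C = C and a = a and b = b])
        (use assms(4) in \<open>auto simp: indicator_def\<close>)
    show "(\<lambda>x. indicator {a..b} x * c (g n x)) \<in> borel_measurable lebesgue" for n
      by (intro borel_measurable_lebesgue_indicator_mult gm2)
    show "cmod (indicator {a..b} x * c (g n x)) \<le> cmod (complex_of_real (C * indicator {a..b} x))" for n x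
      using c_le[of "g n x"] by (auto simp: indicator_def)
    have "AE x in lebesgue. x \<notin> N"
      using N by (intro AE_not_in) (simp add: negligible_iff_null_sets)
    then show "AE x in lebesgue. (\<lambda>n. indicator {a..b} x * c (g n x)) \<longlonglongrightarrow> f x"
    proof eventually_elim
      case (elim x)
      have "cmod (f x) \<le> C" using assms(2)[of x] assms(4) by (cases "x \<in> {a..b}") (auto simp: indicator_def)
      have "(\<lambda>n. c (g n x)) \<longlonglongrightarrow> c (f x)"
        by (rule continuous_on_tendsto_compose[OF cc lim[OF elim]]) auto
      then have "(\<lambda>n. indicator {a..b} x * c (g n x)) \<longlonglongrightarrow> indicator {a..b} x * f x"
        using c_id[OF \<open>cmod (f x) \<le> C\<close>] by (intro tendsto_intros) simp
      moreover have "indicator {a..b} x * f x = f x"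
        using assms(2)[of x] by (cases "x \<in> {a..b}") (auto simp: indicator_def)
      ultimately show ?case by simp
    qed
  qed
  then have "\<forall>\<^sub>F n in sequentially. dist (abs_L2 (\<lambda>x. indicator {a..b} x * c (g n x))) (abs_L2 f) < e"
    using assms by (intro tendstoD)
  then obtain n where "dist (abs_L2 (\<lambda>x. indicator {a..b} x * c (g n x))) (abs_L2 f) < e"
    by (auto dest: eventually_happens)
  then show ?thesis
    by (intro that[OF gm[of n]]) (simp add: dist_norm norm_minus_commute)
qed

lemma borel_measurable_lebesgue_continuous:
  assumes "continuous_on UNIV (g :: real \<Rightarrow> 'a::real_normed_vector)"
  shows "g \<in> borel_measurable lebesgue"
  by (intro measurable_completion) (simp add: borel_measurable_continuous_onI assms)

lemma square_integrable_indicator_continuous: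
  assumes "continuous_on UNIV g"
  shows "square_integrable (\<lambda>x. indicator {a..b} x * g x)"
proof -
  have "compact (g ` {a..b})"
    by (intro compact_continuous_image continuous_on_subset[OF assms]) auto
  then obtain C where C: "\<And>x. x \<in> {a..b} \<Longrightarrow> cmod (g x) \<le> C"
    by (meson bounded_iff compact_imp_bounded imageI)
  show ?thesis
  proof (rule square_integrable_bounded_support)
    show "cmod (indicator {a..b} x * g x) \<le> C * indicator {a..b} x" for x
      using C[of x] by (auto simp: indicator_def)
  qed (intro borel_measurable_lebesgue_indicator_mult borel_measurable_lebesgue_continuous assms)
qed

lemma polynomial_indicator_approx:
  assumes "e > 0"
  obtains p n where "polynomial_function p" "n > 0"
    "norm (u - abs_L2 (\<lambda>x. indicator {-real n..real n} x * p x)) < e"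
proof -
  obtain f n where f: "f \<in> borel_measurable lebesgue"
    "\<And>x. cmod (f x) \<le> real n * indicator {-real n..real n} x" "norm (u - abs_L2 f) < e/3" "n > 0"
    by (rule bounded_support_approx[of "e/3" u]) (use assms in auto)
  obtain g where g: "continuous_on UNIV g"
    "norm (abs_L2 f - abs_L2 (\<lambda>x. indicator {-real n..real n} x * g x)) < e/3"
    by (rule continuous_support_approx[OF f(1,2), of "e/3"]) (use assms f in auto)
  \<comment> \<open>A uniform error d on an interval of length 2 n costs at most d sqrt (2 n) = e/6
    in the norm.\<close>
  define d where "d = e/3 / (2 * sqrt (2 * real n))"
  have d: "d > 0" using assms f(4) by (simp add: d_def)
  obtain p where p: "polynomial_function p" "\<And>x. x \<in> {-real n..real n} \<Longrightarrow> cmod (g x - p x) < d"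
    using Stone_Weierstrass_polynomial_function[of "{-real n..real n}" g d] d
      continuous_on_subset[OF g(1)] by auto
  have pc: "continuous_on UNIV p"
    using p(1) by (rule continuous_on_polymonial_function)
  have eq: "abs_L2 (\<lambda>x. indicator {-real n..real n} x * g x) - abs_L2 (\<lambda>x. indicator {-real n..real n} x * p x)
     = abs_L2 (\<lambda>x. indicator {-real n..real n} x * (g x - p x))"
    by (simp add: abs_L2_arith square_integrable_indicator_continuous g pc right_diff_distrib)
  have "norm (abs_L2 (\<lambda>x. indicator {-real n..real n} x * (g x - p x))) \<le> d * sqrt (real n - - real n)"
  proof (rule norm_abs_L2_le)
    show "(\<lambda>x. indicator {- real n..real n} x * (g x - p x)) \<in> borel_measurable lebesgue"
      by (intro borel_measurable_lebesgue_indicator_mult borel_measurable_lebesgue_continuous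
          continuous_on_diff g pc)
    show "cmod (indicator {- real n..real n} x * (g x - p x)) \<le> d * indicator {- real n..real n} x" for x
      using p(2)[of x] by (auto simp: indicator_def)
  qed (use d in auto)
  also have "\<dots> < e/3" using f(4) assms by (simp add: d_def)
  finally have "norm (abs_L2 (\<lambda>x. indicator {-real n..real n} x * g x) - abs_L2 (\<lambda>x. indicator {-real n..real n} x * p x)) < e/3"
    by (simp only: eq)
  then have "norm (u - abs_L2 (\<lambda>x. indicator {-real n..real n} x * p x)) < e"
    using f(3) g(2) by norm
  then show ?thesis using that p(1) f(4) by blast
qed

text \<open>The combinations with rational coefficients form a countable set whose closure is
  already a real subspace.\<close>

lemma closure_countable_combinations:
  fixes M :: "'a::real_normed_vector set"
  assumes "countable M"
  obtains D where "countable D" "span M \<subseteq> closure D"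
proof -
  define comb where "comb xs = (\<Sum>(q, m)\<leftarrow>xs. of_rat q *\<^sub>R m)" for xs :: "(rat \<times> 'a) list"
  define D where "D = comb ` lists (UNIV \<times> M)"
  have cD: "countable D"
    unfolding D_def by (intro countable_image countable_lists countable_SIGMA assms) auto
  have add: "x + y \<in> D" if "x \<in> D" "y \<in> D" for x y
  proof -
    obtain xs ys where "xs \<in> lists (UNIV \<times> M)" "x = comb xs" "ys \<in> lists (UNIV \<times> M)" "y = comb ys"
      using \<open>x \<in> D\<close> \<open>y \<in> D\<close> unfolding D_def by blast
    then have "x + y = comb (xs @ ys)" "xs @ ys \<in> lists (UNIV \<times> M)" by (auto simp: comb_def)
    then show ?thesis unfolding D_def by (metis imageI)
  qed
  have scale: "of_rat q *\<^sub>R x \<in> D" if xD: "x \<in> D" for q x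
  proof -
    obtain xs where xs: "x = comb xs" "xs \<in> lists (UNIV \<times> M)" using xD unfolding D_def by blast
    have "of_rat q *\<^sub>R comb xs = comb (map (\<lambda>(p, m). (q * p, m)) xs)"
      unfolding comb_def by (induction xs) (simp_all add: case_prod_beta scaleR_add_right of_rat_mult)
    moreover have "map (\<lambda>(p, m). (q * p, m)) xs \<in> lists (UNIV \<times> M)" using xs(2) by auto
    ultimately show ?thesis using xs unfolding D_def by (metis imageI)
  qed
  have addc: "x + y \<in> closure D" if xy: "x \<in> closure D" "y \<in> closure D" for x y
  proof -
    obtain f g where "\<And>n. f n \<in> D" "f \<longlonglongrightarrow> x" "\<And>n. g n \<in> D" "g \<longlonglongrightarrow> y"
      using xy unfolding closure_sequential by auto
    then show ?thesis
      unfolding closure_sequential by (intro exI[of _ "\<lambda>n. f n + g n"]) (auto intro: add tendsto_add)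
  qed
  have scalec: "r *\<^sub>R x \<in> closure D" if xD: "x \<in> closure D" for r x
  proof -
    obtain f where f: "\<And>n. f n \<in> D" "f \<longlonglongrightarrow> x"
      using xD unfolding closure_sequential by auto
    have "\<exists>q. \<bar>of_rat q - r\<bar> < 1 / real (Suc n)" for n
    proof -
      obtain q where "r - 1 / real (Suc n) < of_rat q" "of_rat q < r"
        using of_rat_dense[of "r - 1 / real (Suc n)" r] by auto
      then show ?thesis by (intro exI[of _ q]) auto
    qed
    then obtain q where q: "\<And>n. \<bar>of_rat (q n) - r\<bar> < 1 / real (Suc n)" by metis
    have "(\<lambda>n. real_of_rat (q n)) \<longlonglongrightarrow> r"
    proof (rule LIM_zero_cancel, rule Lim_null_comparison)
      show "\<forall>\<^sub>F n in sequentially. norm (of_rat (q n) - r) \<le> 1 / real (Suc n)"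
        using q by (intro always_eventually allI less_imp_le) (simp only: real_norm_def)
      show "(\<lambda>n. 1 / real (Suc n)) \<longlonglongrightarrow> 0"
        by (rule LIMSEQ_Suc[OF lim_1_over_n])
    qed
    then have "(\<lambda>n. real_of_rat (q n) *\<^sub>R f n) \<longlonglongrightarrow> r *\<^sub>R x" using f by (intro tendsto_scaleR)
    then show ?thesis
      unfolding closure_sequential by (intro exI[of _ "\<lambda>n. real_of_rat (q n) *\<^sub>R f n"] conjI allI scale f(1))
  qed
  have base: "m \<in> closure D" if "m \<in> M" for m
  proof -
    have "m = comb [(1, m)]" by (simp add: comb_def)
    then have "m \<in> D" using that unfolding D_def by (intro image_eqI) auto
    then show ?thesis using closure_subset by blast
  qed
  have "0 \<in> closure D"
  proof -
    have "0 = comb []" by (simp add: comb_def)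
    then have "0 \<in> D" unfolding D_def by (intro image_eqI) auto
    then show ?thesis using closure_subset by blast
  qed
  then have "subspace (closure D)" using addc scalec by (auto simp: subspace_def)
  then have "span M \<subseteq> closure D" using base by (intro span_minimal) auto
  then show ?thesis using cD that by blast
qed

lemma complex_polynomial_function_sum:
  assumes "polynomial_function (p :: real \<Rightarrow> complex)"
  obtains a n where "p = (\<lambda>x. \<Sum>i\<le>n. a i * complex_of_real (x ^ i))"
proof -
  have "real_polynomial_function (Re \<circ> p)" "real_polynomial_function (Im \<circ> p)"
    using assms bounded_linear_Re bounded_linear_Im by (auto simp: polynomial_function_def)
  then obtain a n b m where a: "Re \<circ> p = (\<lambda>x. \<Sum>i\<le>n. a i * x^i)" and b: "Im \<circ> p = (\<lambda>x. \<Sum>i\<le>m. b i * x^i)"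
    unfolding real_polynomial_function_iff_sum by blast
  define c where "c i = Complex (if i \<le> n then a i else 0) (if i \<le> m then b i else 0)" for i
  have "p x = (\<Sum>i\<le>max n m. c i * complex_of_real (x ^ i))" for x
  proof (rule complex_eqI)
    have "Re (\<Sum>i\<le>max n m. c i * complex_of_real (x ^ i)) = (\<Sum>i\<le>max n m. (if i \<le> n then a i else 0) * x ^ i)"
      by (simp add: c_def)
    also have "\<dots> = (\<Sum>i\<le>n. a i * x^i)"
      by (rule sum.mono_neutral_cong_right) auto
    finally show "Re (p x) = Re (\<Sum>i\<le>max n m. c i * complex_of_real (x ^ i))"
      using fun_cong[OF a, of x] by simp
    have "Im (\<Sum>i\<le>max n m. c i * complex_of_real (x ^ i)) = (\<Sum>i\<le>max n m. (if i \<le> m then b i else 0) * x ^ i)"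
      by (simp add: c_def)
    also have "\<dots> = (\<Sum>i\<le>m. b i * x^i)"
      by (rule sum.mono_neutral_cong_right) auto
    finally show "Im (p x) = Im (\<Sum>i\<le>max n m. c i * complex_of_real (x ^ i))"
      using fun_cong[OF b, of x] by simp
  qed
  then show ?thesis using that by blast
qed

lemma separable_L2: "\<exists>D :: L2 set. countable D \<and> closure D = UNIV"
proof -
  define mon where "mon n i c = abs_L2 (\<lambda>x. indicator {-real n..real n} x * (c * complex_of_real (x ^ i)))"
    for n i :: nat and c
  have sq: "square_integrable (\<lambda>x. indicator {-real n..real n} x * (c * complex_of_real (x ^ i)))" for n i c
    by (intro square_integrable_indicator_continuous continuous_intros)
  \<comment> \<open>\<open>span\<close> is the real span, so each monomial enters with the factors 1
    and the imaginary unit.\<close>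
  define M where "M = (\<lambda>(n, i, c). mon n i c) ` (UNIV \<times> UNIV \<times> {1, \<i>})"
  have "countable M" unfolding M_def by (intro countable_image countable_SIGMA) auto
  then obtain D where D: "countable D" "span M \<subseteq> closure D" by (rule closure_countable_combinations)
  have mon: "mon n i c \<in> span M" for n i c
  proof -
    have "mon n i d \<in> M" if "d \<in> {1, \<i>}" for d
      unfolding M_def using that by (intro image_eqI[of _ _ "(n, i, d)"]) auto
    then have "mon n i 1 \<in> M" "mon n i \<i> \<in> M" by blast+
    moreover have "mon n i c = Re c *\<^sub>R mon n i 1 + Im c *\<^sub>R mon n i \<i>"
    proof -
      have "z * (c * w) = complex_of_real (Re c) * (z * w) + complex_of_real (Im c) * (z * (\<i> * w))" for z w
        by (subst complex_eq[of c]) (simp only: distrib_left distrib_right mult.assoc mult.left_commute)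
      then show ?thesis
        unfolding mon_def using sq[of n 1 i] sq[of n "\<i>" i]
        by (simp only: abs_L2_arith square_integrable_cmult mult_1_left)
    qed
    ultimately show ?thesis by (metis span_add span_scale span_base)
  qed
  have "u \<in> closure D" for u
  proof -
    have "u \<in> closure (span M)"
      unfolding closure_approachable
    proof (intro allI impI)
      fix e :: real assume "e > 0"
      then obtain p n where p: "polynomial_function p"
        "norm (u - abs_L2 (\<lambda>x. indicator {-real n..real n} x * p x)) < e"
        by (rule polynomial_indicator_approx)
      obtain a m where a: "p = (\<lambda>x. \<Sum>i\<le>m. a i * complex_of_real (x ^ i))"
        using p(1) by (rule complex_polynomial_function_sum)
      have "abs_L2 (\<lambda>x. indicator {-real n..real n} x * (\<Sum>i\<le>k. a i * complex_of_real (x ^ i))) \<in> span M" for k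
      proof (induction k)
        case 0
        then show ?case using mon[of n 0 "a 0"] by (simp add: mon_def)
      next
        case (Suc k)
        have "abs_L2 (\<lambda>x. indicator {-real n..real n} x * (\<Sum>i\<le>Suc k. a i * complex_of_real (x ^ i)))
          = abs_L2 (\<lambda>x. indicator {-real n..real n} x * (\<Sum>i\<le>k. a i * complex_of_real (x ^ i))) + mon n (Suc k) (a (Suc k))"
          unfolding mon_def
          by (subst abs_L2_arith(1)) (intro square_integrable_indicator_continuous continuous_intros | simp add: algebra_simps)+
        then show ?case using Suc mon by (auto intro: span_add)
      qed
      then show "\<exists>y\<in>span M. dist y u < e"
        using p(2) by (auto simp: a dist_norm norm_minus_commute)
    qed
    also have "closure (span M) \<subseteq> closure D" using D(2) by (simp add: closure_minimal)
    finally show ?thesis .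
  qed
  then show ?thesis using D(1) by blast
qed

instance L2 :: second_countable_topology
proof
  obtain D :: "L2 set" where D: "countable D" "closure D = UNIV" using separable_L2 by blast
  let ?B = "(\<lambda>(x, n). ball x (1 / real (Suc n))) ` (D \<times> UNIV)"
  have "topological_basis ?B"
  proof (rule topological_basisI)
    show "open b" if "b \<in> ?B" for b using that by auto
    fix U :: "L2 set" and x assume U: "open U" "x \<in> U"
    then obtain e where e: "e > 0" "ball x e \<subseteq> U" by (auto simp: open_contains_ball)
    obtain n where n: "1 / real (Suc n) < e / 2"
      using e(1) nat_approx_posE[of "e/2"] by auto
    have "x \<in> closure D" using D by simp
    then obtain y where y: "y \<in> D" "dist y x < 1 / real (Suc n)"
      unfolding closure_approachable by (metis divide_pos_pos of_nat_0_less_iff zero_less_Suc zero_less_one)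
    have "ball y (1 / real (Suc n)) \<subseteq> ball x e"
    proof
      fix z assume "z \<in> ball y (1 / real (Suc n))"
      then have "dist x z < e"
        using y(2) n dist_triangle[of x z y] by (simp add: dist_commute)
      then show "z \<in> ball x e" by simp
    qed
    then show "\<exists>b\<in>?B. x \<in> b \<and> b \<subseteq> U" using y e by (intro bexI[of _ "ball y (1 / real (Suc n))"]) auto
  qed
  moreover have "countable ?B" using D by (intro countable_image countable_SIGMA) auto
  ultimately show "\<exists>B :: L2 set set. countable B \<and> open = generate_topology B"
    using topological_basis_imp_subbasis by blast
qed

section \<open>Smooth bumps and density of test functions\<close>

text \<open>\<open>smooth\<close> asks for the whole sequence of derivatives at once; iterating a
  choice of derivative within a class closed under differentiation produces it.\<close>

lemma smooth_coinduct:
  assumes "P f" and step: "\<And>f. P f \<Longrightarrow> \<exists>f'. P f' \<and> (\<forall>x. (f has_vector_derivative f' x) (at x))"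
  shows "smooth f"
proof -
  have "\<forall>f. \<exists>f'. P f \<longrightarrow> P f' \<and> (\<forall>x. (f has_vector_derivative f' x) (at x))"
    using step by blast
  then obtain d where d: "\<And>f. P f \<Longrightarrow> P (d f) \<and> (\<forall>x. (f has_vector_derivative d f x) (at x))"
    by metis
  have "P ((d ^^ n) f)" for n
    by (induction n) (use assms(1) d in auto)
  then have "((d ^^ n) f has_vector_derivative (d ^^ Suc n) f x) (at x)" for n x
    using d by simp
  then show ?thesis
    by (intro smoothI[where F = "\<lambda>n. (d ^^ n) f"]) auto
qed

text \<open>For q = 1 this is the classical smooth function that vanishes to infinite order at 0.
  The polynomial factor in 1 / x is there because differentiation reproduces this shape.\<close>

definition flat :: "(real \<Rightarrow> real) \<Rightarrow> real \<Rightarrow> real"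
  where "flat q x = (if x \<le> 0 then 0 else q (1 / x) * exp (- (1 / x)))"

lemma real_polynomial_div_exp_tendsto_0:
  assumes "real_polynomial_function (q :: real \<Rightarrow> real)"
  shows "((\<lambda>y. q y * exp (- y)) \<longlongrightarrow> 0) at_top"
proof -
  obtain a n where "q = (\<lambda>x. \<Sum>i\<le>n. a i * x ^ i)"
    using assms real_polynomial_function_iff_sum by blast
  then have "(\<lambda>y. q y * exp (- y)) = (\<lambda>y. \<Sum>i\<le>n. a i * (y ^ i / exp y))"
    by (simp add: sum_distrib_right exp_minus divide_inverse mult.assoc)
  then show ?thesis
    by (simp del: times_divide_eq_right add: tendsto_null_sum tendsto_mult_right_zero tendsto_power_div_exp_0)
qed

lemma flat_has_derivative:
  assumes q: "real_polynomial_function q"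
  shows "\<exists>q2. real_polynomial_function q2 \<and> (\<forall>x. (flat q has_real_derivative flat q2 x) (at x))"
proof -
  obtain q' where q': "real_polynomial_function q'" "\<And>x. (q has_real_derivative q' x) (at x)"
    using has_real_derivative_polynomial_function[OF q] by blast
  \<comment> \<open>With y = 1 / x, the chain rule gives the factor - y^2 on both q and exp (-
    y).\<close>
  define q2 where "q2 y = y\<^sup>2 * (q y - q' y)" for y :: real
  have id: "real_polynomial_function (\<lambda>y :: real. y)"
    by (rule real_polynomial_function.intros(1)[OF bounded_linear_ident])
  have "real_polynomial_function q2"
    unfolding q2_def using q q' id
    by (intro real_polynomial_function.intros(4) real_polynomial_function_diff real_polynomial_function_power) auto
  moreover have "(flat q has_real_derivative flat q2 x) (at x)" for x
  proof -
    consider "x < 0" | "x > 0" | "x = 0" by linarith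
    then show ?thesis
    proof cases
      case 1
      have "((\<lambda>_. 0) has_real_derivative flat q2 x) (at x)" using 1 by (simp add: flat_def)
      then show ?thesis
        by (rule has_field_derivative_transform_within_open[where S = "{..<0}"]) (use 1 in \<open>auto simp: flat_def\<close>)
    next
      case 2
      have c: "((\<lambda>x. q (1 / x)) has_real_derivative q' (1 / x) * (- (1 / x\<^sup>2))) (at x)"
        by (rule DERIV_chain2[OF q'(2)]) (use 2 in \<open>auto intro!: derivative_eq_intros simp: power2_eq_square\<close>)
      have "((\<lambda>x. q (1 / x) * exp (- (1 / x))) has_real_derivative flat q2 x) (at x)"
        by (rule derivative_eq_intros c refl | use 2 in \<open>simp add: flat_def q2_def field_simps power2_eq_square\<close>)+
      then show ?thesis
        by (rule has_field_derivative_transform_within_open[where S = "{0<..}"]) (use 2 in \<open>auto simp: flat_def\<close>)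
    next
      case 3
      have "((\<lambda>y. (y * q y) * exp (- y)) \<longlongrightarrow> 0) at_top"
        by (intro real_polynomial_div_exp_tendsto_0 real_polynomial_function.intros(4) id q)
      then have "((\<lambda>h. (inverse h * q (inverse h)) * exp (- inverse h)) \<longlongrightarrow> 0) (at_right 0)"
        using filterlim_inverse_at_top_right by (rule filterlim_compose)
      then have r: "((\<lambda>h. (flat q (0 + h) - flat q 0) / h) \<longlongrightarrow> 0) (at_right 0)"
        by (rule Lim_transform_eventually)
          (auto simp: flat_def eventually_at_right_field field_simps intro: exI[of _ 1])
      have l: "((\<lambda>h. (flat q (0 + h) - flat q 0) / h) \<longlongrightarrow> 0) (at_left 0)"
        by (rule tendsto_eventually) (auto simp: flat_def eventually_at_left_field intro: exI[of _ "-1"])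
      have "((\<lambda>h. (flat q (0 + h) - flat q 0) / h) \<longlongrightarrow> 0) (at 0)"
        by (rule filterlim_split_at[OF l r])
      then show ?thesis using 3 by (simp add: DERIV_def flat_def)
    qed
  qed
  ultimately show ?thesis by blast
qed

text \<open>The products alone are not closed under differentiation, since the product rule yields
  two terms; their sums are.\<close>

inductive flat_sum :: "(real \<Rightarrow> real) \<Rightarrow> (real \<Rightarrow> complex) \<Rightarrow> bool" for r
  where base: "real_polynomial_function q \<Longrightarrow> polynomial_function p \<Longrightarrow> flat_sum r (\<lambda>x. flat q (r x) *\<^sub>R p x)"
  | add: "flat_sum r f \<Longrightarrow> flat_sum r g \<Longrightarrow> flat_sum r (\<lambda>x. f x + g x)"

lemma flat_sum_has_derivative:
  assumes "flat_sum r f" and r: "real_polynomial_function r"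
  shows "\<exists>f'. flat_sum r f' \<and> (\<forall>x. (f has_vector_derivative f' x) (at x))"
  using assms(1)
proof induction
  case (base q p)
  obtain q2 where q2: "real_polynomial_function q2" "\<And>x. (flat q has_real_derivative flat q2 x) (at x)"
    using flat_has_derivative[OF base(1)] by blast
  obtain p' where p': "polynomial_function p'" "\<And>x. (p has_vector_derivative p' x) (at x)"
    using has_vector_derivative_polynomial_function[OF base(2)] by blast
  obtain r' where r': "real_polynomial_function r'" "\<And>x. (r has_real_derivative r' x) (at x)"
    using has_real_derivative_polynomial_function[OF r] by blast
  have "((\<lambda>x. flat q (r x)) has_real_derivative flat q2 (r x) * r' x) (at x)" for x
    by (rule DERIV_chain2[OF q2(2) r'(2)])
  then have "((\<lambda>x. flat q (r x) *\<^sub>R p x) has_vector_derivative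
      flat q (r x) *\<^sub>R p' x + (flat q2 (r x) * r' x) *\<^sub>R p x) (at x)" for x
    by (intro has_vector_derivative_scaleR p'(2))
  moreover have "flat_sum r (\<lambda>x. flat q (r x) *\<^sub>R p' x + flat q2 (r x) *\<^sub>R (r' x *\<^sub>R p x))"
    using base p' q2 r'
    by (intro flat_sum.intros polynomial_function_mult) (auto simp: real_polynomial_function_eq)
  ultimately show ?case by (intro exI conjI) (auto simp: scaleR_scaleR)
next
  case (add f g)
  then obtain f' g' where "flat_sum r f'" "\<And>x. (f has_vector_derivative f' x) (at x)"
    "flat_sum r g'" "\<And>x. (g has_vector_derivative g' x) (at x)" by blast
  then show ?case
    by (intro exI[of _ "\<lambda>x. f' x + g' x"]) (auto intro: flat_sum.add has_vector_derivative_add)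
qed

lemma smooth_flat:
  assumes "polynomial_function p" "real_polynomial_function r"
  shows "smooth (\<lambda>x. flat (\<lambda>_. 1) (r x) *\<^sub>R p x)"
proof (rule smooth_coinduct[where P = "flat_sum r"])
  show "flat_sum r (\<lambda>x. flat (\<lambda>_. 1) (r x) *\<^sub>R p x)"
    by (intro flat_sum.base assms real_polynomial_function.intros(2))
qed (use flat_sum_has_derivative assms(2) in blast)

text \<open>A smooth function supported in \<open>[-R, R]\<close> that increases to the indicator of \<open>(-R, R)\<close>
  as \<open>k \<rightarrow> \<infinity>\<close>.\<close>

definition bump :: "real \<Rightarrow> real \<Rightarrow> real \<Rightarrow> real"
  where "bump k R x = flat (\<lambda>_. 1) (k * (R\<^sup>2 - x\<^sup>2))"

lemma bump_bounds: "0 \<le> bump k R x" "bump k R x \<le> 1"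
  by (auto simp: bump_def flat_def)

lemma bump_support:
  assumes "k > 0" "R > 0" "x \<notin> {-R..R}"
  shows "bump k R x = 0"
proof -
  have "R\<^sup>2 \<le> x\<^sup>2" using assms by (intro abs_le_square_iff[THEN iffD1]) auto
  then show ?thesis using assms by (auto simp: bump_def flat_def mult_le_0_iff)
qed

lemma smooth_bump:
  assumes "polynomial_function p"
  shows "smooth (\<lambda>x. complex_of_real (bump k R x) * p x)"
proof -
  have "real_polynomial_function (\<lambda>x :: real. k * (R\<^sup>2 - x\<^sup>2))"
    by (intro real_polynomial_function.intros real_polynomial_function_diff real_polynomial_function_power) (auto intro: bounded_linear_ident)
  from smooth_flat[OF assms this] show ?thesis
    by (simp add: bump_def scaleR_conv_of_real)
qed

lemma bump_tendsto_1:
  assumes "\<bar>x\<bar> < R"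
  shows "(\<lambda>n. bump (real n) R x) \<longlonglongrightarrow> 1"
proof -
  have c: "R\<^sup>2 - x\<^sup>2 > 0" using assms abs_square_less_1 power_strict_mono[of "\<bar>x\<bar>" R 2] by auto
  have "(\<lambda>n. exp (- ((1 / real n) / (R\<^sup>2 - x\<^sup>2)))) \<longlonglongrightarrow> exp (- (0 / (R\<^sup>2 - x\<^sup>2)))"
    using c by (intro tendsto_intros lim_1_over_n) auto
  then have l: "(\<lambda>n. exp (- ((1 / real n) / (R\<^sup>2 - x\<^sup>2)))) \<longlonglongrightarrow> 1" by simp
  show ?thesis
    by (rule Lim_transform_eventually[OF l eventually_sequentiallyI[of 1]])
      (use c in \<open>auto simp: bump_def flat_def mult_le_0_iff\<close>)
qed

abbreviation is_test :: "(real \<Rightarrow> complex) \<Rightarrow> bool"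
  where "is_test f \<equiv> smooth f \<and> compact (closure {x. f x \<noteq> 0})"

lemma is_testI:
  assumes "smooth f" "\<And>x. x \<notin> {a..b} \<Longrightarrow> f x = 0"
  shows "is_test f"
proof -
  have "{x. f x \<noteq> 0} \<subseteq> {a..b}" using assms(2) by blast
  then have "bounded {x. f x \<noteq> 0}" by (rule bounded_subset[rotated]) simp
  then show ?thesis using assms(1) by simp
qed

lemma is_test_support:
  assumes "is_test f"
  obtains R where "R > 0" "\<And>x. x \<notin> {-R..R} \<Longrightarrow> f x = 0"
proof -
  have "bounded {x. f x \<noteq> 0}" using assms by simp
  then obtain R where "R > 0" "\<And>x. f x \<noteq> 0 \<Longrightarrow> norm x \<le> R" unfolding bounded_pos by blast
  then show ?thesis by (intro that[of R]) force+
qed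

lemma test_cases:
  obtains f where "is_test f" "\<phi> = Abs_test_function f"
  using Abs_test_function_cases[of \<phi>] by auto

lemma test_to_L2_Abs: "is_test f \<Longrightarrow> test_to_L2 (Abs_test_function f) = abs_L2 f"
  by (simp add: test_to_L2_def Abs_test_function_inverse)

lemma is_test_deriv:
  assumes "is_test f"
  shows "is_test (\<lambda>x. vector_derivative f (at x))"
  using test_deriv.rsp assms by (auto simp: eq_onp_def rel_fun_def)

lemma test_deriv_Abs:
  assumes "is_test f"
  shows "test_deriv (Abs_test_function f) = Abs_test_function (\<lambda>x. vector_derivative f (at x))"
  by (rule Rep_test_function_inject[THEN iffD1])
    (use assms is_test_deriv[OF assms] in \<open>simp only: test_deriv.rep_eq Abs_test_function_inverse mem_Collect_eq\<close>)

text \<open>A polynomial restricted to [-n, n] is approximated by its products with bumps that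
  increase to the indicator; the restricted polynomial itself dominates them.\<close>

lemma test_dense:
  assumes "e > 0"
  obtains \<phi> where "norm (u - test_to_L2 \<phi>) < e"
proof -
  obtain p n where p: "polynomial_function p" "n > 0"
    "norm (u - abs_L2 (\<lambda>x. indicator {-real n..real n} x * p x)) < e/2"
    by (rule polynomial_indicator_approx[of "e/2" u]) (use assms in auto)
  have pc: "continuous_on UNIV p"
    using p(1) by (rule continuous_on_polymonial_function)
  define b where "b k x = complex_of_real (bump (real (Suc k)) (real n) x) * p x" for k x
  have sb: "smooth (b k)" for k unfolding b_def by (intro smooth_bump p)
  have b0: "x \<notin> {-real n..real n} \<Longrightarrow> b k x = 0" for k x
    using bump_support[of "real (Suc k)" "real n" x] p(2) by (simp add: b_def)
  have tb: "is_test (b k)" for k by (rule is_testI[OF sb b0])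
  let ?g = "\<lambda>x. indicator {-real n..real n} x * p x"
  have "(\<lambda>k. abs_L2 (b k)) \<longlonglongrightarrow> abs_L2 ?g"
  proof (rule tendsto_abs_L2_dominated)
    show "square_integrable ?g" by (intro square_integrable_indicator_continuous pc)
    then show "square_integrable ?g" .
    show "b k \<in> borel_measurable lebesgue" for k
      by (intro borel_measurable_lebesgue_continuous smooth_continuous sb)
    show "cmod (b k x) \<le> cmod (?g x)" for k x
      using bump_bounds[of "real (Suc k)" "real n" x] b0[of x k]
      by (cases "x \<in> {-real n..real n}") (auto simp: b_def norm_mult mult_left_le_one_le simp del: of_nat_Suc)
    \<comment> \<open>The bumps tend to 0 at the two end points, where the target need not
      vanish.\<close>
    have "AE x in lebesgue. x \<notin> {- real n, real n}"
      by (intro AE_not_in) (simp add: finite_imp_null_set_lborel null_sets_completionI)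
    then show "AE x in lebesgue. (\<lambda>k. b k x) \<longlonglongrightarrow> ?g x"
    proof eventually_elim
      case (elim x)
      show ?case
      proof (cases "\<bar>x\<bar> < real n")
        case True
        then have "(\<lambda>k. bump (real (Suc k)) (real n) x) \<longlonglongrightarrow> 1"
          by (intro LIMSEQ_Suc[OF bump_tendsto_1])
        then have "(\<lambda>k. b k x) \<longlonglongrightarrow> complex_of_real 1 * p x"
          unfolding b_def by (intro tendsto_intros)
        moreover have "x \<in> {-real n..real n}" using True by auto
        ultimately show ?thesis by simp
      next
        case False
        then have "x \<notin> {-real n..real n}" using elim by auto
        then show ?thesis by (simp add: b0)
      qed
    qed
  qed
  then have "\<forall>\<^sub>F k in sequentially. dist (abs_L2 (b k)) (abs_L2 ?g) < e/2"
    using assms by (intro tendstoD) auto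
  then obtain k where k: "dist (abs_L2 (b k)) (abs_L2 ?g) < e/2" by (auto dest: eventually_happens)
  have "norm (u - test_to_L2 (Abs_test_function (b k))) < e"
    using p(3) k unfolding test_to_L2_Abs[OF tb] dist_norm by norm
  then show ?thesis by (rule that)
qed

section \<open>Operators on square integrable functions\<close>

lemma square_integrable_affine:
  assumes "square_integrable f" "c \<noteq> 0"
  shows "square_integrable (\<lambda>x. f (t + c * x))"
  using borel_measurable_affine[OF square_integrableD(1)[OF assms(1)] assms(2), of t]
    lebesgue_integrable_real_affine[OF square_integrableD(2)[OF assms(1)] assms(2), of t]
  by (simp add: square_integrable_def)

lemma norm_abs_L2_affine:
  assumes "square_integrable f" "\<bar>c\<bar> = 1"
  shows "norm (abs_L2 (\<lambda>x. f (t + c * x))) = norm (abs_L2 f)"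
proof (rule power2_eq_imp_eq)
  show "(norm (abs_L2 (\<lambda>x. f (t + c * x))))\<^sup>2 = (norm (abs_L2 f))\<^sup>2"
    using assms lebesgue_integral_real_affine[of c "\<lambda>x. (cmod (f x))\<^sup>2" t]
    by (subst norm_abs_L2 norm_abs_L2[OF assms(1)], intro square_integrable_affine) (auto simp: norm_abs_L2)
qed auto

text \<open>The null set is transported through the norm: the difference has norm zero, and the norm
  is invariant under the substitution.\<close>

lemma AE_affine_eq:
  assumes "square_integrable f" "square_integrable g" "AE x in lebesgue. f x = g x" "\<bar>c\<bar> = 1"
  shows "AE x in lebesgue. f (t + c * x) = g (t + c * x)"
proof -
  have c: "c \<noteq> 0" using assms(4) by auto
  have "abs_L2 (\<lambda>x. f x - g x) = 0"
    using assms(1-3) abs_L2_eq_iff[OF assms(1,2)] abs_L2_arith(2)[OF assms(1,2)] by simp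
  then have "abs_L2 (\<lambda>x. f (t + c * x) - g (t + c * x)) = 0"
    using norm_abs_L2_affine[OF square_integrable_diff[OF assms(1,2)] assms(4), of t] by simp
  then have "abs_L2 (\<lambda>x. f (t + c * x)) = abs_L2 (\<lambda>x. g (t + c * x))"
    using abs_L2_arith(2)[OF square_integrable_affine[OF assms(1) c, of t] square_integrable_affine[OF assms(2) c, of t]] by simp
  then show ?thesis
    using abs_L2_eq_iff[OF square_integrable_affine[OF assms(1) c, of t] square_integrable_affine[OF assms(2) c, of t]] by simp
qed

lift_definition translate :: "real \<Rightarrow> L2 \<Rightarrow> L2" is "\<lambda>r f x. f (x + r)"
proof goal_cases
  case (1 r f g)
  then show ?case
    using square_integrable_affine[of f 1 r] square_integrable_affine[of g 1 r] AE_affine_eq[of f g 1 r]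
    by (simp add: add.commute)
qed

lift_definition reflect :: "L2 \<Rightarrow> L2" is "\<lambda>f x. f (- x)"
proof goal_cases
  case (1 f g)
  then show ?case
    using square_integrable_affine[of f "-1" 0] square_integrable_affine[of g "-1" 0] AE_affine_eq[of f g "-1" 0]
    by simp
qed

lemma square_integrable_cnj: "square_integrable f \<Longrightarrow> square_integrable (\<lambda>x. cnj (f x))"
  using measurable_compose[of f lebesgue borel cnj borel]
  by (auto simp: square_integrable_def borel_measurable_continuous_onI continuous_on_cnj)

lift_definition conjugate :: "L2 \<Rightarrow> L2" is "\<lambda>f x. cnj (f x)"
  by (auto intro: square_integrable_cnj elim: eventually_mono)

lemma square_integrable_translate:
  "square_integrable f \<Longrightarrow> square_integrable (\<lambda>x. f (x + r))"
  using square_integrable_affine[of f 1 r] by (simp add: add.commute)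

lemma square_integrable_reflect:
  "square_integrable f \<Longrightarrow> square_integrable (\<lambda>x. f (- x))"
  using square_integrable_affine[of f "-1" 0] by simp

lemma translate_abs: "square_integrable f \<Longrightarrow> translate r (abs_L2 f) = abs_L2 (\<lambda>x. f (x + r))"
  by (simp add: translate.abs_eq)

lemma reflect_abs: "square_integrable f \<Longrightarrow> reflect (abs_L2 f) = abs_L2 (\<lambda>x. f (- x))"
  by (simp add: reflect.abs_eq)

lemma conjugate_abs: "square_integrable f \<Longrightarrow> conjugate (abs_L2 f) = abs_L2 (\<lambda>x. cnj (f x))"
  by (simp add: conjugate.abs_eq)

lemma Linf_mult_abs:
  "square_integrable f \<Longrightarrow> in_Linf a \<Longrightarrow> Linf_mult a (abs_L2 f) = abs_L2 (\<lambda>x. a x * f x)"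
  by (simp add: Linf_mult.abs_eq)

lemma pairing_abs:
  "square_integrable f \<Longrightarrow> square_integrable g \<Longrightarrow> pairing (abs_L2 f) (abs_L2 g) = (LINT x|lebesgue. f x * g x)"
  by (simp add: pairing.abs_eq)

lemma norm_translate [simp]: "norm (translate r u) = norm u"
proof -
  obtain f where f: "square_integrable f" "u = abs_L2 f" by (rule L2_cases)
  then show ?thesis using norm_abs_L2_affine[OF f(1), of 1 r] by (simp add: translate_abs add.commute)
qed

lemma norm_reflect [simp]: "norm (reflect u) = norm u"
proof -
  obtain f where f: "square_integrable f" "u = abs_L2 f" by (rule L2_cases)
  then show ?thesis using norm_abs_L2_affine[OF f(1), of "-1" 0] by (simp add: reflect_abs)
qed

lemma norm_conjugate [simp]: "norm (conjugate u) = norm u"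
proof -
  obtain f where f: "square_integrable f" "u = abs_L2 f" by (rule L2_cases)
  have "(norm (conjugate u))\<^sup>2 = (norm u)\<^sup>2"
    using f by (simp add: conjugate_abs norm_abs_L2 square_integrable_cnj)
  then show ?thesis by (rule power2_eq_imp_eq) simp_all
qed

lemma translate_add [simp]: "translate r (u + v) = translate r u + translate r v"
proof -
  obtain f g where "square_integrable f" "u = abs_L2 f" "square_integrable g" "v = abs_L2 g"
    by (metis L2_cases)
  then show ?thesis by (simp add: translate_abs abs_L2_arith square_integrable_translate square_integrable_add)
qed

lemma translate_scaleC [simp]: "translate r (c *\<^sub>C u) = c *\<^sub>C translate r u"
proof -
  obtain f where "square_integrable f" "u = abs_L2 f" by (rule L2_cases)
  then show ?thesis by (simp add: translate_abs abs_L2_arith square_integrable_translate square_integrable_cmult)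
qed

lemma translate_translate [simp]: "translate r (translate s u) = translate (r + s) u"
proof -
  obtain f where "square_integrable f" "u = abs_L2 f" by (rule L2_cases)
  then show ?thesis by (simp add: translate_abs square_integrable_translate add.assoc)
qed

lemma translate_0 [simp]: "translate 0 u = u"
proof -
  obtain f where "square_integrable f" "u = abs_L2 f" by (rule L2_cases)
  then show ?thesis by (simp add: translate_abs)
qed

lemma reflect_add [simp]: "reflect (u + v) = reflect u + reflect v"
proof -
  obtain f g where "square_integrable f" "u = abs_L2 f" "square_integrable g" "v = abs_L2 g"
    by (metis L2_cases)
  then show ?thesis by (simp add: reflect_abs abs_L2_arith square_integrable_reflect square_integrable_add)
qed

lemma reflect_scaleC [simp]: "reflect (c *\<^sub>C u) = c *\<^sub>C reflect u"
proof -
  obtain f where "square_integrable f" "u = abs_L2 f" by (rule L2_cases)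
  then show ?thesis by (simp add: reflect_abs abs_L2_arith square_integrable_reflect square_integrable_cmult)
qed

lemma reflect_reflect [simp]: "reflect (reflect u) = u"
proof -
  obtain f where "square_integrable f" "u = abs_L2 f" by (rule L2_cases)
  then show ?thesis by (simp add: reflect_abs square_integrable_reflect)
qed

lemma reflect_translate: "reflect (translate r u) = translate (- r) (reflect u)"
proof -
  obtain f where "square_integrable f" "u = abs_L2 f" by (rule L2_cases)
  then show ?thesis
    by (simp add: reflect_abs translate_abs square_integrable_reflect square_integrable_translate)
qed

lemma Linf_mult_add: "Linf_mult a (u + v) = Linf_mult a u + Linf_mult a v"
proof -
  obtain f g where "square_integrable f" "u = abs_L2 f" "square_integrable g" "v = abs_L2 g"
    by (metis L2_cases)
  then show ?thesis
    by (cases "in_Linf a")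
      (simp_all add: Linf_mult.abs_eq abs_L2_arith square_integrable_mult_bounded square_integrable_add
        distrib_left square_integrable_zero)
qed

lemma Linf_mult_scaleC: "Linf_mult a (c *\<^sub>C u) = c *\<^sub>C Linf_mult a u"
proof -
  obtain f where "square_integrable f" "u = abs_L2 f" by (rule L2_cases)
  then show ?thesis
    by (cases "in_Linf a")
      (simp_all add: Linf_mult.abs_eq abs_L2_arith square_integrable_mult_bounded square_integrable_cmult
        mult.left_commute square_integrable_zero)
qed

lemma norm_Linf_mult_le:
  assumes a: "in_Linf a" "AE x in lebesgue. cmod (a x) \<le> C" and C: "0 \<le> C"
  shows "norm (Linf_mult a u) \<le> C * norm u"
proof -
  obtain f where f: "square_integrable f" "u = abs_L2 f" by (rule L2_cases)
  have "(norm (Linf_mult a u))\<^sup>2 \<le> (LINT x|lebesgue. C\<^sup>2 * (cmod (f x))\<^sup>2)"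
    unfolding f(2) Linf_mult_abs[OF f(1) a(1)] norm_abs_L2[OF square_integrable_mult_bounded[OF a(1) f(1)]]
  proof (rule integral_mono_AE)
    show "AE x in lebesgue. (cmod (a x * f x))\<^sup>2 \<le> C\<^sup>2 * (cmod (f x))\<^sup>2"
      using a(2) by eventually_elim (auto simp: norm_mult power_mult_distrib intro!: mult_right_mono power_mono)
  qed (use f(1) square_integrableD square_integrable_mult_bounded[OF a(1) f(1)] in auto)
  also have "\<dots> = (C * norm u)\<^sup>2"
    using f by (simp add: norm_abs_L2 power_mult_distrib)
  finally show ?thesis using C by (simp add: power2_le_iff_abs_le)
qed

lemma in_Linf_indicator: "A \<in> sets lebesgue \<Longrightarrow> in_Linf (indicator A)"
  by (auto simp: in_Linf_def indicator_def intro!: exI[of _ 1])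

lemma bounded_clinearI:
  fixes f :: "'a::complex_normed_vector \<Rightarrow> 'b::complex_normed_vector"
  assumes "\<And>x y. f (x + y) = f x + f y" "\<And>c x. f (c *\<^sub>C x) = c *\<^sub>C f x" "\<And>x. norm (f x) \<le> norm x * K"
  shows "bounded_clinear f"
  unfolding bounded_clinear_def
proof (intro conjI allI bounded_linear_intro[where K = K] assms)
  show "f (r *\<^sub>R x) = r *\<^sub>R f x" for r x
    using assms(2)[of "of_real r" x] by (simp only: scaleC_of_real)
qed

lemma bounded_clinear_imp: "bounded_clinear f \<Longrightarrow> bounded_linear f"
  by (simp add: bounded_clinear_def)

lemma bounded_clinear_translate: "bounded_clinear (translate r)"
  by (rule bounded_clinearI[where K = 1]) simp_all

lemma bounded_clinear_reflect: "bounded_clinear reflect"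
  by (rule bounded_clinearI[where K = 1]) simp_all

lemma bounded_clinear_Linf_mult:
  assumes "in_Linf a"
  shows "bounded_clinear (Linf_mult a)"
proof -
  obtain C where "AE x in lebesgue. cmod (a x) \<le> C" using assms by (auto simp: in_Linf_def)
  then have "AE x in lebesgue. cmod (a x) \<le> max C 0" by eventually_elim auto
  then have "norm (Linf_mult a x) \<le> norm x * max C 0" for x
    using norm_Linf_mult_le[OF assms, of "max C 0" x] by (simp only: max.cobounded2 mult.commute)
  then show ?thesis
    by (intro bounded_clinearI[where K = "max C 0"])
      (simp_all only: Linf_mult_add Linf_mult_scaleC)
qed

lemmas bounded_linear_translate = bounded_clinear_imp[OF bounded_clinear_translate]
  and bounded_linear_reflect = bounded_clinear_imp[OF bounded_clinear_reflect]
  and bounded_linear_Linf_mult = bounded_clinear_imp[OF bounded_clinear_Linf_mult]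

lemmas translate_simps = linear_simps[OF bounded_linear_translate]
  and reflect_simps = linear_simps[OF bounded_linear_reflect]

lemma integrable_times:
  assumes "square_integrable f" "square_integrable g"
  shows "integrable lebesgue (\<lambda>x. f x * g x)"
proof (rule integrable_mult_square_integrable[OF assms])
  have [measurable]: "f \<in> borel_measurable lebesgue" "g \<in> borel_measurable lebesgue"
    using assms by (auto simp: square_integrable_def)
  show "(\<lambda>x. f x * g x) \<in> borel_measurable lebesgue" by measurable
qed (simp add: norm_mult)

lemma pairing_add_left: "pairing (u + v) w = pairing u w + pairing v w"
proof -
  obtain f g h where "square_integrable f" "u = abs_L2 f" "square_integrable g" "v = abs_L2 g"
    "square_integrable h" "w = abs_L2 h"
    by (metis L2_cases)
  then show ?thesis
    by (simp add: pairing_abs abs_L2_arith square_integrable_add distrib_right integrable_times)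
qed

lemma pairing_commute: "pairing u v = pairing v u"
proof -
  obtain f g where "square_integrable f" "u = abs_L2 f" "square_integrable g" "v = abs_L2 g"
    by (metis L2_cases)
  then show ?thesis by (simp add: pairing_abs mult.commute)
qed

lemma pairing_scaleC_left: "pairing (c *\<^sub>C u) v = c * pairing u v"
proof -
  obtain f g where "square_integrable f" "u = abs_L2 f" "square_integrable g" "v = abs_L2 g"
    by (metis L2_cases)
  then show ?thesis by (simp add: pairing_abs abs_L2_arith square_integrable_cmult mult.assoc)
qed

lemma Re_pairing: "Re (pairing u v) = u \<bullet> conjugate v"
proof -
  obtain f g where "square_integrable f" "u = abs_L2 f" "square_integrable g" "v = abs_L2 g"
    by (metis L2_cases)
  then show ?thesis
    by (simp add: pairing_abs conjugate_abs square_integrable_cnj inner_L2.abs_eq inner_complex_def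
        integrable_times flip: integral_Re)
qed

text \<open>Multiplying u by a number c of modulus 1 makes the pairing real and nonnegative, so the
  Cauchy-Schwarz inequality of the real inner product applies.\<close>

lemma norm_pairing_le: "cmod (pairing u v) \<le> norm u * norm v"
proof -
  obtain c where c: "cmod c = 1" "c * pairing u v = of_real (cmod (pairing u v))"
  proof (cases "pairing u v = 0")
    case True then show ?thesis by (intro that[of 1]) auto
  next
    case False then show ?thesis
      by (intro that[of "of_real (cmod (pairing u v)) / pairing u v"]) (auto simp: norm_divide)
  qed
  have "cmod (pairing u v) = Re (pairing (c *\<^sub>C u) v)"
    using c(2) by (simp add: pairing_scaleC_left)
  also have "\<dots> \<le> norm (c *\<^sub>C u) * norm (conjugate v)"
    unfolding Re_pairing by (rule norm_cauchy_schwarz)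
  finally show ?thesis using c(1) by (simp add: norm_scaleC)
qed

lemma bounded_bilinear_pairing: "bounded_bilinear pairing"
proof
  show "pairing (u + v) w = pairing u w + pairing v w" for u v w by (rule pairing_add_left)
  show "pairing u (v + w) = pairing u v + pairing u w" for u v w
    by (metis pairing_commute pairing_add_left)
  have s: "pairing (r *\<^sub>R u) v = r *\<^sub>R pairing u v" for r u v
    by (simp add: pairing_scaleC_left scaleR_conv_of_real flip: scaleC_of_real)
  then show "pairing (r *\<^sub>R u) v = r *\<^sub>R pairing u v" for r u v .
  show "pairing u (r *\<^sub>R v) = r *\<^sub>R pairing u v" for r u v
    by (metis pairing_commute s)
  show "\<exists>K. \<forall>u v. norm (pairing u v) \<le> norm u * norm v * K"
    using norm_pairing_le by (intro exI[of _ 1]) simp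
qed

lemma pairing_translate: "pairing (translate r u) v = pairing u (translate (- r) v)"
proof -
  obtain f g where fg: "square_integrable f" "u = abs_L2 f" "square_integrable g" "v = abs_L2 g"
    by (metis L2_cases)
  have "(LINT x|lebesgue. f x * g (x - r)) = (LINT x|lebesgue. f (x + r) * g x)"
    using lebesgue_integral_real_affine[of 1 "\<lambda>x. f x * g (x - r)" r] by (simp add: add.commute)
  then show ?thesis
    using square_integrable_translate[OF fg(3), of "-r"] square_integrable_translate[OF fg(1), of r] fg
    by (simp add: pairing_abs translate_abs)
qed

text \<open>Paired with its own conjugate, the difference w gives its squared norm; approximating
  that conjugate by test functions shows that this is zero.\<close>

lemma pairing_test_eqI:
  assumes "\<And>\<phi>. pairing u (test_to_L2 \<phi>) = pairing v (test_to_L2 \<phi>)"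
  shows "u = v"
proof -
  interpret pairing: bounded_bilinear pairing by (rule bounded_bilinear_pairing)
  define w where "w = u - v"
  have w: "pairing w (test_to_L2 \<phi>) = 0" for \<phi>
    using assms[of \<phi>] by (simp add: w_def pairing.diff_left)
  have "pairing w (conjugate w) = 0"
  proof (rule ccontr)
    assume n: "pairing w (conjugate w) \<noteq> 0"
    then have "w \<noteq> 0" by (auto simp: pairing.zero_left)
    then have "norm w > 0" by simp
    define e where "e = cmod (pairing w (conjugate w)) / norm w"
    have "e > 0" using n \<open>norm w > 0\<close> by (simp add: e_def)
    then obtain \<phi> where \<phi>: "norm (conjugate w - test_to_L2 \<phi>) < e" by (rule test_dense)
    have "cmod (pairing w (conjugate w)) = cmod (pairing w (conjugate w - test_to_L2 \<phi>))"
      by (simp add: pairing.diff_right w)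
    also have "\<dots> \<le> norm w * norm (conjugate w - test_to_L2 \<phi>)" by (rule norm_pairing_le)
    also have "\<dots> < norm w * e" using \<phi> \<open>norm w > 0\<close> by simp
    finally show False using \<open>norm w > 0\<close> by (simp add: e_def)
  qed
  moreover have "Re (pairing w (conjugate w)) = (norm w)\<^sup>2"
  proof -
    obtain f where f: "square_integrable f" "w = abs_L2 f" by (rule L2_cases)
    then have "conjugate (conjugate w) = w" by (simp add: conjugate_abs square_integrable_cnj)
    then show ?thesis by (simp add: Re_pairing power2_norm_eq_inner)
  qed
  ultimately show ?thesis by (simp add: w_def)
qed

section \<open>The translation group and weak derivatives\<close>

lemma is_test_translate:
  assumes "is_test f"
  shows "is_test (\<lambda>x. f (x + r))"
proof -
  obtain R where R: "\<And>x. x \<notin> {-R..R} \<Longrightarrow> f x = 0" by (rule is_test_support[OF assms]) blast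
  obtain F where "F 0 = f \<and> (\<forall>n x. (F n has_vector_derivative F (Suc n) x) (at x))"
    using assms unfolding smooth_def by blast
  then have F: "F 0 = f" "\<And>n x. (F n has_vector_derivative F (Suc n) x) (at x)" by simp_all
  have "((\<lambda>x. F n (x + r)) has_vector_derivative F (Suc n) (x + r)) (at x)" for n x
    using vector_diff_chain_at[of "\<lambda>x. x + r" 1 x "F n" "F (Suc n) (x + r)"] F(2)[of n "x + r"]
    by (simp add: o_def has_vector_derivative_add_const)
  then have "smooth (\<lambda>x. f (x + r))"
    by (intro smoothI[where F = "\<lambda>n x. F n (x + r)"]) (simp_all add: F(1))
  then show ?thesis
    by (rule is_testI[where a = "-R - r" and b = "R - r"]) (rule R, auto)
qed

lemma test_translate:
  obtains \<psi> where "test_to_L2 \<psi> = translate r (test_to_L2 \<phi>)"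
    "test_to_L2 (test_deriv \<psi>) = translate r (test_to_L2 (test_deriv \<phi>))"
proof -
  obtain f where f: "is_test f" "\<phi> = Abs_test_function f" by (rule test_cases)
  let ?g = "\<lambda>x. f (x + r)"
  have g: "is_test ?g" by (rule is_test_translate[OF f(1)])
  have "(?g has_vector_derivative vector_derivative f (at (x + r))) (at x)" for x
    using vector_diff_chain_at[of "\<lambda>x. x + r" 1 x f] smooth_has_derivative[of f "x + r"] f(1)
    by (simp add: o_def has_vector_derivative_add_const)
  then have "vector_derivative ?g (at x) = vector_derivative f (at (x + r))" for x
    by (rule vector_derivative_at)
  then show ?thesis
    using f g is_test_deriv[OF f(1)] is_test_deriv[OF g]
    by (intro that[of "Abs_test_function ?g"])
      (simp_all only: test_deriv_Abs test_to_L2_Abs translate_abs test_square_integrable)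
qed

text \<open>The derivative of a test function is Lipschitz, which bounds the Taylor remainder by a
  multiple of r^2 at every point. For shifts up to 1 the remainder lives on one fixed interval, so
  the same order holds in the norm.\<close>

lemma translate_test_bound:
  obtains M where "M \<ge> 0" "\<And>r. \<bar>r\<bar> \<le> 1 \<Longrightarrow>
    norm (translate r (test_to_L2 \<phi>) - test_to_L2 \<phi> - r *\<^sub>R test_to_L2 (test_deriv \<phi>)) \<le> M * r\<^sup>2"
proof -
  obtain f where f: "is_test f" "\<phi> = Abs_test_function f" by (rule test_cases)
  define f1 where "f1 x = vector_derivative f (at x)" for x
  define f2 where "f2 x = vector_derivative f1 (at x)" for x
  have t1: "is_test f1" unfolding f1_def by (rule is_test_deriv[OF f(1)])
  have t2: "is_test f2" unfolding f2_def by (rule is_test_deriv[OF t1])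
  have d0: "(f has_vector_derivative f1 x) (at x within S)" for x S
    using smooth_has_derivative[of f x] f(1) unfolding f1_def by (auto intro: has_vector_derivative_at_within)
  have d1: "(f1 has_vector_derivative f2 x) (at x within S)" for x S
    using smooth_has_derivative[of f1 x] t1 unfolding f2_def by (auto intro: has_vector_derivative_at_within)
  obtain R where R: "R > 0" "\<And>x. x \<notin> {-R..R} \<Longrightarrow> f x = 0" by (rule is_test_support[OF f(1)]) blast
  obtain R1 where R1: "R1 > 0" "\<And>x. x \<notin> {-R1..R1} \<Longrightarrow> f1 x = 0" by (rule is_test_support[OF t1]) blast
  obtain R2 where R2: "R2 > 0" "\<And>x. x \<notin> {-R2..R2} \<Longrightarrow> f2 x = 0" by (rule is_test_support[OF t2]) blast
  have "compact (f2 ` {-R2..R2})"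
    using t2 by (intro compact_continuous_image continuous_on_subset[OF smooth_continuous]) auto
  then obtain B where "\<forall>y\<in>f2 ` {-R2..R2}. cmod y \<le> B" using compact_imp_bounded bounded_iff by metis
  then have B': "cmod (f2 x) \<le> max B 0" for x
    using R2(2)[of x] by (cases "x \<in> {-R2..R2}") (auto simp: le_max_iff_disj)
  define C where "C = max B 0"
  have C: "C \<ge> 0" "\<And>x. cmod (f2 x) \<le> C" using B' by (auto simp: C_def)
  have f1_lip: "cmod (f1 y - f1 x) \<le> C * \<bar>y - x\<bar>" for x y
  proof -
    have "norm (f1 y - f1 x) \<le> C * norm (y - x)"
    proof (rule differentiable_bound[where S = UNIV and f' = "\<lambda>x h. h *\<^sub>R f2 x"])
      show "(f1 has_derivative (\<lambda>h. h *\<^sub>R f2 z)) (at z within UNIV)" for z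
        using d1[of z UNIV] by (simp add: has_vector_derivative_def)
      show "onorm (\<lambda>h. h *\<^sub>R f2 z) \<le> C" for z
        by (intro onorm_le) (use mult_left_mono[OF C(2)[of z] abs_ge_zero] in \<open>simp add: mult.commute\<close>)
    qed auto
    then show ?thesis by (simp add: mult.commute)
  qed
  have taylor: "cmod (f (x + r) - f x - r *\<^sub>R f1 x) \<le> C * r\<^sup>2" for x r
  proof -
    have "norm (f (x + r) - f x - (x + r - x) *\<^sub>R f1 x) \<le> norm (x + r - x) * (C * \<bar>r\<bar>)"
    proof (rule vector_differentiable_bound_linearization[where S = "closed_segment x (x + r)"])
      fix y assume "y \<in> closed_segment x (x + r)"
      then have "\<bar>y - x\<bar> \<le> \<bar>r\<bar>" by (auto simp: closed_segment_eq_real_ivl split: if_splits)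
      then show "norm (f1 y - f1 x) \<le> C * \<bar>r\<bar>"
        using f1_lip[of y x] mult_left_mono[of "\<bar>y - x\<bar>" "\<bar>r\<bar>" C] C(1) by linarith
    qed (auto intro: d0)
    then show ?thesis by (simp add: power2_eq_square mult_ac abs_mult_self_eq)
  qed
  define Q where "Q = max R R1 + 1"
  show ?thesis
  proof (rule that[of "C * sqrt (Q - - Q)"])
    have Q: "Q > 0" using R(1) by (simp add: Q_def)
    then show "C * sqrt (Q - - Q) \<ge> 0" using C(1) by simp
    fix r :: real assume r: "\<bar>r\<bar> \<le> 1"
    let ?h = "\<lambda>x. f (x + r) - f x - of_real r * f1 x"
    have sq: "square_integrable f" "square_integrable f1"
      using f(1) t1 by (auto intro!: test_square_integrable)
    have "translate r (test_to_L2 \<phi>) - test_to_L2 \<phi> - r *\<^sub>R test_to_L2 (test_deriv \<phi>) = abs_L2 ?h"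
      using f t1 sq by (simp add: test_deriv_Abs f1_def[symmetric] test_to_L2_Abs translate_abs abs_L2_arith
        square_integrable_translate square_integrable_cmult square_integrable_diff)
    moreover have "norm (abs_L2 ?h) \<le> (C * r\<^sup>2) * sqrt (Q - - Q)"
    proof (rule norm_abs_L2_le)
      show "?h \<in> borel_measurable lebesgue"
        by (rule square_integrableD) (intro square_integrable_diff square_integrable_cmult square_integrable_translate sq)
      fix x
      show "cmod (?h x) \<le> C * r\<^sup>2 * indicator {-Q..Q} x"
      proof (cases "x \<in> {-Q..Q}")
        case True
        then show ?thesis using taylor[of x r] by (simp add: scaleR_conv_of_real)
      next
        case False
        then have "x + r \<notin> {-R..R}" "x \<notin> {-R..R}" "x \<notin> {-R1..R1}" using r by (auto simp: Q_def)
        then show ?thesis using False by (simp add: R R1)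
      qed
    qed (use Q C in auto)
    ultimately show "norm (translate r (test_to_L2 \<phi>) - test_to_L2 \<phi> - r *\<^sub>R test_to_L2 (test_deriv \<phi>))
      \<le> C * sqrt (Q - - Q) * r\<^sup>2" by (simp add: mult_ac)
  qed
qed

lemma translate_test_deriv:
  "((\<lambda>r. (translate r (test_to_L2 \<phi>) - test_to_L2 \<phi>) /\<^sub>R r) \<longlongrightarrow> test_to_L2 (test_deriv \<phi>)) (at 0)"
proof -
  obtain M where M: "M \<ge> 0" "\<And>r. \<bar>r\<bar> \<le> 1 \<Longrightarrow>
    norm (translate r (test_to_L2 \<phi>) - test_to_L2 \<phi> - r *\<^sub>R test_to_L2 (test_deriv \<phi>)) \<le> M * r\<^sup>2"
    by (rule translate_test_bound) blast
  have "\<forall>\<^sub>F r in at 0. norm ((translate r (test_to_L2 \<phi>) - test_to_L2 \<phi>) /\<^sub>R r - test_to_L2 (test_deriv \<phi>)) \<le> M * \<bar>r\<bar>"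
    unfolding eventually_at
  proof (intro exI[of _ 1] conjI ballI impI)
    fix r :: real assume "r \<noteq> 0 \<and> dist r 0 < 1"
    then have r: "r \<noteq> 0" "\<bar>r\<bar> \<le> 1" by auto
    have "(translate r (test_to_L2 \<phi>) - test_to_L2 \<phi>) /\<^sub>R r - test_to_L2 (test_deriv \<phi>)
      = (translate r (test_to_L2 \<phi>) - test_to_L2 \<phi> - r *\<^sub>R test_to_L2 (test_deriv \<phi>)) /\<^sub>R r"
      using r by (simp add: scaleR_diff_right)
    also have "norm \<dots> \<le> (M * r\<^sup>2) / \<bar>r\<bar>"
      using M(2)[OF r(2)] r(1) by (simp add: divide_inverse mult.commute mult_right_mono)
    also have "\<dots> = M * \<bar>r\<bar>" using r(1) by (simp add: power2_eq_square abs_mult_self_eq field_simps)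
    finally show "norm ((translate r (test_to_L2 \<phi>) - test_to_L2 \<phi>) /\<^sub>R r - test_to_L2 (test_deriv \<phi>)) \<le> M * \<bar>r\<bar>" .
  qed auto
  moreover have "((\<lambda>r. M * \<bar>r\<bar>) \<longlongrightarrow> 0) (at (0::real))"
    by (rule tendsto_eq_intros refl | simp)+
  ultimately show ?thesis
    by (rule LIM_zero_cancel[OF Lim_null_comparison])
qed

text \<open>Differentiability settles test functions; the general case follows by density because
  translations are isometries.\<close>

lemma translate_tendsto_0: "((\<lambda>r. translate r u) \<longlongrightarrow> u) (at 0)"
proof (rule tendstoI)
  fix e :: real assume "e > 0"
  then obtain \<phi> where \<phi>: "norm (u - test_to_L2 \<phi>) < e / 3" using test_dense[of "e/3" u] by auto
  let ?p = "test_to_L2 \<phi>"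
  have "((\<lambda>r. r *\<^sub>R ((translate r ?p - ?p) /\<^sub>R r)) \<longlongrightarrow> 0 *\<^sub>R test_to_L2 (test_deriv \<phi>)) (at 0)"
    by (intro tendsto_scaleR translate_test_deriv tendsto_ident_at)
  then have "((\<lambda>r. r *\<^sub>R ((translate r ?p - ?p) /\<^sub>R r)) \<longlongrightarrow> 0) (at 0)" by simp
  then have "((\<lambda>r. translate r ?p - ?p) \<longlongrightarrow> 0) (at 0)"
    by (rule Lim_transform_eventually) (auto simp: eventually_at intro!: exI[of _ 1])
  then have "\<forall>\<^sub>F r in at 0. norm (translate r ?p - ?p) < e / 3"
    using tendstoD[of "\<lambda>r. translate r ?p - ?p" 0 "at 0" "e/3"] \<open>e > 0\<close> by simp
  then show "\<forall>\<^sub>F r in at 0. dist (translate r u) u < e"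
  proof eventually_elim
    case (elim r)
    have "norm (translate r u - translate r ?p) < e / 3"
      using \<phi> by (simp flip: translate_simps(2))
    then show ?case using elim \<phi> unfolding dist_norm by norm
  qed
qed

lemma tendsto_translate:
  assumes "(f \<longlongrightarrow> r) F" "(g \<longlongrightarrow> u) F"
  shows "((\<lambda>x. translate (f x) (g x)) \<longlongrightarrow> translate r u) F"
proof -
  have "((\<lambda>r. translate r u) \<longlongrightarrow> translate 0 u) (nhds 0)"
    using tendsto_at_iff_tendsto_nhds[of "\<lambda>r. translate r u" 0] translate_tendsto_0[of u] by simp
  moreover have "((\<lambda>x. f x - r) \<longlongrightarrow> 0) F" using assms(1) by (rule LIM_zero)
  ultimately have "((\<lambda>x. translate (f x - r) u) \<longlongrightarrow> translate 0 u) F"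
    by (rule filterlim_compose)
  then have "((\<lambda>x. translate (f x - r) u) \<longlongrightarrow> u) F" by simp
  then have "((\<lambda>x. translate r (translate (f x - r) u)) \<longlongrightarrow> translate r u) F"
    by (rule bounded_linear.tendsto[OF bounded_linear_translate])
  then have 1: "((\<lambda>x. translate (f x) u) \<longlongrightarrow> translate r u) F" by simp
  have "((\<lambda>x. translate (f x) (g x - u)) \<longlongrightarrow> 0) F"
    using LIM_zero[OF assms(2)] by (subst tendsto_norm_zero_iff[symmetric]) (simp add: tendsto_norm_zero_iff)
  from tendsto_add[OF 1 this] show ?thesis by (simp add: translate_simps)
qed

lemma continuous_on_translate [continuous_intros]:
  assumes "continuous_on S f" "continuous_on S g"
  shows "continuous_on S (\<lambda>x. translate (f x) (g x))"
  using assms unfolding continuous_on_def by (intro ballI tendsto_translate) auto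

text \<open>The integrand may depend on the length r of the interval, as it does in the Duhamel
  integral below.\<close>

lemma average_tendsto:
  fixes k :: "real \<Rightarrow> real \<Rightarrow> 'a::{banach, second_countable_topology}"
  assumes int: "\<And>r. set_integrable lborel {0..r} (k r)"
    and lim: "\<And>e. e > 0 \<Longrightarrow> \<exists>d>0. \<forall>r s. 0 \<le> s \<and> s \<le> r \<and> r < d \<longrightarrow> norm (k r s - c) \<le> e"
  shows "((\<lambda>r. (LINT s:{0..r}|lborel. k r s) /\<^sub>R r) \<longlongrightarrow> c) (at_right 0)"
proof (rule tendstoI)
  fix e :: real assume "e > 0"
  then obtain d where d: "d > 0" "\<And>r s. 0 \<le> s \<Longrightarrow> s \<le> r \<Longrightarrow> r < d \<Longrightarrow> norm (k r s - c) \<le> e/2"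
    using lim[of "e/2"] by (metis half_gt_zero)
  have "dist ((LINT s:{0..r}|lborel. k r s) /\<^sub>R r) c < e" if r: "0 < r" "r < d" for r
  proof -
    have ic: "set_integrable lborel {0..r} (\<lambda>_. c)" "(LINT s:{0..r}|lborel. c) = r *\<^sub>R c"
      using r by (auto simp: set_integrable_def set_integral_const)
    have ic2: "set_integrable lborel {0..r} (\<lambda>_. e/2)" "(LINT s:{0..r}|lborel. e/2) = r * (e/2)"
      using r by (auto simp: set_integrable_def set_integral_const)
    have "norm (LINT s:{0..r}|lborel. (k r s - c)) \<le> (LINT s:{0..r}|lborel. norm (k r s - c))"
      by (rule set_integral_norm_bound) (intro set_integral_diff int ic)
    also have "\<dots> \<le> (LINT s:{0..r}|lborel. e/2)"
      using r by (intro set_integral_mono set_integrable_norm set_integral_diff int ic ic2 d) auto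
    finally have "norm ((LINT s:{0..r}|lborel. k r s) - r *\<^sub>R c) \<le> r * (e/2)"
      using ic ic2 by (simp add: set_integral_diff int)
    moreover have "(LINT s:{0..r}|lborel. k r s) /\<^sub>R r - c = ((LINT s:{0..r}|lborel. k r s) - r *\<^sub>R c) /\<^sub>R r"
      using r by (simp add: scaleR_diff_right)
    ultimately have "norm ((LINT s:{0..r}|lborel. k r s) /\<^sub>R r - c) \<le> inverse r * (r * (e/2))"
      using r by (simp only: norm_scaleR) (intro mult_mono; simp)
    also have "\<dots> = e/2" using r by simp
    finally have "norm ((LINT s:{0..r}|lborel. k r s) /\<^sub>R r - c) \<le> e/2" .
    then show ?thesis using \<open>e > 0\<close> by (auto simp only: dist_norm)
  qed
  then show "\<forall>\<^sub>F r in at_right 0. dist ((LINT s:{0..r}|lborel. k r s) /\<^sub>R r) c < e"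
    unfolding eventually_at_right_field using d(1) by blast
qed

lemma set_integrable_continuous:
  fixes f :: "real \<Rightarrow> 'a::{banach, second_countable_topology}"
  assumes "continuous_on {a..b} f"
  shows "set_integrable lborel {a..b} f"
  unfolding set_integrable_def by (rule borel_integrable_compact) (use assms in auto)

lemma has_vector_derivative_difference_quotient:
  assumes "((\<lambda>h. (f (x + h) - f x) /\<^sub>R h) \<longlongrightarrow> D) (at 0)"
  shows "(f has_vector_derivative D) (at x)"
proof -
  have "((\<lambda>h. norm ((f (x + h) - f x) /\<^sub>R h - D)) \<longlongrightarrow> 0) (at 0)"
    using tendsto_norm[OF LIM_zero[OF assms]] by simp
  then have "((\<lambda>h. norm (f (x + h) - f x - h *\<^sub>R D) / norm h) \<longlongrightarrow> 0) (at 0)"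
  proof (rule Lim_transform_eventually)
    have "norm ((f (x + h) - f x) /\<^sub>R h - D) = norm (f (x + h) - f x - h *\<^sub>R D) / norm h" if "h \<noteq> 0" for h
    proof -
      have "(f (x + h) - f x) /\<^sub>R h - D = (f (x + h) - f x - h *\<^sub>R D) /\<^sub>R h"
        using that by (simp add: scaleR_diff_right)
      then show ?thesis by (simp add: divide_inverse mult.commute)
    qed
    then show "\<forall>\<^sub>F h in at 0. norm ((f (x + h) - f x) /\<^sub>R h - D) = norm (f (x + h) - f x - h *\<^sub>R D) / norm h"
      by (auto simp: eventually_at intro!: exI[of _ 1])
  qed
  then show ?thesis
    by (simp add: has_vector_derivative_def has_derivative_at bounded_linear_scaleR_left)
qed

lemma filterlim_uminus_at_0: "filterlim uminus (at (0::real)) (at 0 within S)"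
  by (rule filterlim_atI, rule tendsto_eq_intros, rule tendsto_ident_at)
    (auto simp: eventually_at intro: exI[of _ 1])

text \<open>Identifies \<open>H1\<close> with the domain of the generator of the translation group,
  so that domains can be compared through difference quotients. The direction from weak derivatives
  to limits goes through the formula that translate r u - u is the integral of translate s v over
  [0, r]; tested against a test function, it is the fundamental theorem of calculus for a scalar
  function.\<close>

lemma has_weak_deriv_iff_tendsto:
  "has_weak_deriv u v \<longleftrightarrow> ((\<lambda>r. (translate r u - u) /\<^sub>R r) \<longlongrightarrow> v) (at_right 0)"
proof
  interpret pairing: bounded_bilinear pairing by (rule bounded_bilinear_pairing)
  assume lim: "((\<lambda>r. (translate r u - u) /\<^sub>R r) \<longlongrightarrow> v) (at_right 0)"
  show "has_weak_deriv u v"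
    unfolding has_weak_deriv_def
  proof
    fix \<phi>
    let ?p = "test_to_L2 \<phi>" and ?q = "test_to_L2 (test_deriv \<phi>)"
    have "((\<lambda>r. pairing ((translate r u - u) /\<^sub>R r) ?p) \<longlongrightarrow> pairing v ?p) (at_right 0)"
      by (intro pairing.tendsto lim tendsto_const)
    moreover have "((\<lambda>r. pairing ((translate r u - u) /\<^sub>R r) ?p) \<longlongrightarrow> - pairing u ?q) (at_right 0)"
    proof -
      have "filterlim uminus (at (0::real)) (at_right 0)"
        by (rule filterlim_uminus_at_0)
      then have "((\<lambda>r. (translate (- r) ?p - ?p) /\<^sub>R (- r)) \<longlongrightarrow> ?q) (at_right 0)"
        by (rule filterlim_compose[OF translate_test_deriv])
      then have "((\<lambda>r. - pairing u ((translate (- r) ?p - ?p) /\<^sub>R (- r))) \<longlongrightarrow> - pairing u ?q) (at_right 0)"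
        by (intro tendsto_minus pairing.tendsto tendsto_const)
      moreover have "- pairing u ((translate (- r) ?p - ?p) /\<^sub>R (- r)) = pairing ((translate r u - u) /\<^sub>R r) ?p" for r
        by (simp add: pairing.diff_left pairing.diff_right pairing.scaleR_left pairing.scaleR_right
            pairing.minus_right pairing_translate)
      ultimately show ?thesis by simp
    qed
    ultimately show "pairing v ?p = - pairing u ?q"
      by (intro tendsto_unique) auto
  qed
next
  interpret pairing: bounded_bilinear pairing by (rule bounded_bilinear_pairing)
  assume w: "has_weak_deriv u v"
  have cont: "continuous_on S (\<lambda>s. translate s v)" for S :: "real set" by (intro continuous_intros)
  have eq: "translate r u - u = (LINT s:{0..r}|lborel. translate s v)" if "r > 0" for r
  proof (rule pairing_test_eqI)
    fix \<phi>
    let ?p = "test_to_L2 \<phi>" and ?q = "test_to_L2 (test_deriv \<phi>)"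
    have vs: "pairing (translate s v) ?p = - pairing (translate s u) ?q" for s
    proof -
      obtain \<psi> where \<psi>: "test_to_L2 \<psi> = translate (-s) ?p" "test_to_L2 (test_deriv \<psi>) = translate (-s) ?q"
        by (rule test_translate)
      then show ?thesis using w unfolding has_weak_deriv_def by (metis pairing_translate)
    qed
    \<comment> \<open>The difference quotient is moved to the test function, where its convergence
      in norm is known.\<close>
    have deriv: "((\<lambda>s. pairing (translate s u) ?p) has_vector_derivative pairing (translate s v) ?p) (at s within T)" for s T
    proof (rule has_vector_derivative_at_within)
      have "((\<lambda>h. - pairing (translate s u) ((translate (- h) ?p - ?p) /\<^sub>R (- h))) \<longlongrightarrow> - pairing (translate s u) ?q) (at 0)"
      proof (intro tendsto_minus pairing.tendsto tendsto_const)
        have "filterlim uminus (at (0::real)) (at 0)"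
          by (rule filterlim_uminus_at_0)
        then show "((\<lambda>r. (translate (- r) ?p - ?p) /\<^sub>R (- r)) \<longlongrightarrow> ?q) (at 0)"
          by (rule filterlim_compose[OF translate_test_deriv])
      qed
      moreover have "- pairing (translate s u) ((translate (- h) ?p - ?p) /\<^sub>R (- h))
          = (pairing (translate (s + h) u) ?p - pairing (translate s u) ?p) /\<^sub>R h" for h
        using pairing_translate[of h "translate s u" ?p]
        by (simp add: pairing.diff_right pairing.scaleR_right pairing.minus_right add.commute)
      ultimately show "((\<lambda>s. pairing (translate s u) ?p) has_vector_derivative pairing (translate s v) ?p) (at s)"
        by (intro has_vector_derivative_difference_quotient) (simp add: vs)
    qed
    have "pairing (LINT s:{0..r}|lborel. translate s v) ?p = (LINT s:{0..r}|lborel. pairing (translate s v) ?p)"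
      unfolding set_lebesgue_integral_def
      using integral_bounded_linear[OF pairing.bounded_linear_left[of ?p] set_integrable_continuous[OF cont, unfolded set_integrable_def]]
      by (simp add: pairing.scaleR_left)
    also have "\<dots> = pairing (translate r u) ?p - pairing (translate 0 u) ?p"
      unfolding set_lebesgue_integral_def
      using that by (intro integral_FTC_Icc deriv) (auto intro!: pairing.continuous_on cont continuous_on_const)
    finally show "pairing (translate r u - u) ?p = pairing (LINT s:{0..r}|lborel. translate s v) ?p"
      by (simp add: pairing.diff_left)
  qed
  have "((\<lambda>r. (LINT s:{0..r}|lborel. translate s v) /\<^sub>R r) \<longlongrightarrow> v) (at_right 0)"
  proof (rule average_tendsto[OF set_integrable_continuous[OF cont]])
    fix e :: real assume "e > 0"
    have "((\<lambda>s. translate s v) \<longlongrightarrow> translate 0 v) (nhds 0)"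
      by (intro tendsto_translate tendsto_const filterlim_ident)
    then have "\<forall>\<^sub>F s in nhds 0. dist (translate s v) v < e" using \<open>e > 0\<close> by (auto dest: tendstoD)
    then obtain d where "d > 0" "\<And>s. dist s 0 < d \<Longrightarrow> dist (translate s v) v < e"
      unfolding eventually_nhds_metric by blast
    then show "\<exists>d>0. \<forall>r s. 0 \<le> s \<and> s \<le> r \<and> r < d \<longrightarrow> norm (translate s v - v) \<le> e"
      by (intro exI[of _ d]) (auto simp: dist_norm intro: less_imp_le)
  qed
  then show "((\<lambda>r. (translate r u - u) /\<^sub>R r) \<longlongrightarrow> v) (at_right 0)"
    by (rule Lim_transform_eventually) (auto simp: eventually_at_right_field eq intro!: exI[of _ 1])
qed

lemma has_weak_deriv_unique: "has_weak_deriv u v \<Longrightarrow> has_weak_deriv u w \<Longrightarrow> v = w"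
  unfolding has_weak_deriv_iff_tendsto by (rule tendsto_unique) auto

lemma weak_deriv_eq: "has_weak_deriv u v \<Longrightarrow> weak_deriv u = v"
  unfolding weak_deriv_def by (rule the_equality) (auto intro: has_weak_deriv_unique)

section \<open>The wave operator\<close>

lemma bounded_bilinear_scaleC: "bounded_bilinear (\<lambda>c (x :: 'a::complex_normed_vector). c *\<^sub>C x)"
proof
  fix c d :: complex and x y :: 'a and r :: real
  show "(c + d) *\<^sub>C x = c *\<^sub>C x + d *\<^sub>C x" by (rule scaleC_add_left)
  show "c *\<^sub>C (x + y) = c *\<^sub>C x + c *\<^sub>C y" by (rule scaleC_add_right)
  show "(r *\<^sub>R c) *\<^sub>C x = r *\<^sub>R c *\<^sub>C x"
    by (simp only: scaleR_conv_of_real scaleC_scaleC flip: scaleC_of_real)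
  show "c *\<^sub>C r *\<^sub>R x = r *\<^sub>R c *\<^sub>C x"
    by (simp only: scaleC_scaleC mult.commute flip: scaleC_of_real)
  show "\<exists>K. \<forall>(c :: complex) (x :: 'a). norm (c *\<^sub>C x) \<le> norm c * norm x * K"
    by (intro exI[of _ 1]) (simp add: norm_scaleC)
qed

lemma scaleC_scaleR_commute:
  fixes x :: "'a::complex_normed_vector"
  shows "c *\<^sub>C (r *\<^sub>R x) = r *\<^sub>R (c *\<^sub>C x)"
  using bounded_bilinear.scaleR_right[OF bounded_bilinear_scaleC] .

text \<open>From here on, elements of \<open>L2\<close> also stand for functions of time; this is
  the cutoff to negative times.\<close>

definition chi :: "L2 \<Rightarrow> L2"
  where "chi = Linf_mult (indicator {..<0})"

lemma bounded_clinear_chi: "bounded_clinear chi"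
  unfolding chi_def by (intro bounded_clinear_Linf_mult in_Linf_indicator) simp

lemmas bounded_linear_chi = bounded_clinear_imp[OF bounded_clinear_chi]
  and chi_simps = linear_simps[OF bounded_clinear_imp[OF bounded_clinear_chi]]

lemma norm_chi_le: "norm (chi u) \<le> norm u"
  using norm_Linf_mult_le[of "indicator {..<0}" 1 u]
  by (simp add: chi_def in_Linf_indicator indicator_def)

lemma chi_abs: "square_integrable f \<Longrightarrow> chi (abs_L2 f) = abs_L2 (\<lambda>x. indicator {..<0} x * f x)"
  by (simp add: chi_def Linf_mult_abs in_Linf_indicator)

text \<open>Causality: after a shift into the past, the values at negative times come from negative
  times. Shifts into the future lack this property, which is why the advanced equation below carries
  a cutoff in its kernel.\<close>

lemma chi_translate:
  assumes "r \<le> 0"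
  shows "chi (translate r (chi u)) = chi (translate r u)"
proof -
  obtain f where f: "square_integrable f" "u = abs_L2 f" by (rule L2_cases)
  have "(\<lambda>x. indicator {..<0} x * (indicator {..<0} (x + r) * f (x + r))) = (\<lambda>x. indicator {..<0} x * f (x + r))"
    using assms by (auto simp: indicator_def fun_eq_iff)
  then show ?thesis
    using f by (simp add: chi_abs translate_abs square_integrable_translate square_integrable_indicator_mult
      square_integrable_translate[OF square_integrable_indicator_mult])
qed

text \<open>Applied to functions of the position with values in the square integrable functions of
  time; boundedness in the position is dual to the integrability of the damping.\<close>

definition bounded_continuous :: "(real \<Rightarrow> 'a::real_normed_vector) \<Rightarrow> bool"
  where "bounded_continuous w \<longleftrightarrow> continuous_on UNIV w \<and> (\<exists>B. \<forall>x. norm (w x) \<le> B)"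

lemma bounded_continuousI: "continuous_on UNIV w \<Longrightarrow> (\<And>x. norm (w x) \<le> B) \<Longrightarrow> bounded_continuous w"
  by (auto simp: bounded_continuous_def)

lemma bounded_continuousD: "bounded_continuous w \<Longrightarrow> continuous_on UNIV w"
  by (simp add: bounded_continuous_def)

lemma bounded_continuous_add:
  assumes "bounded_continuous v" "bounded_continuous w"
  shows "bounded_continuous (\<lambda>x. v x + w x)"
proof -
  obtain B C where B: "\<And>x. norm (v x) \<le> B" and C: "\<And>x. norm (w x) \<le> C"
    using assms unfolding bounded_continuous_def by blast
  show ?thesis
  proof (rule bounded_continuousI[where B = "B + C"])
    show "continuous_on UNIV (\<lambda>x. v x + w x)"
      by (rule continuous_on_add[OF assms[THEN bounded_continuousD]])
    show "norm (v x + w x) \<le> B + C" for x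
      by (rule norm_triangle_mono[OF B C])
  qed
qed

lemma bounded_continuous_linear:
  assumes "bounded_continuous w" "bounded_linear f"
  shows "bounded_continuous (\<lambda>x. f (w x))"
proof -
  obtain B where B: "\<And>x. norm (w x) \<le> B"
    using assms unfolding bounded_continuous_def by blast
  obtain K where K: "K \<ge> 0" "\<And>x. norm (f x) \<le> norm x * K"
    using bounded_linear.nonneg_bounded[OF assms(2)] by blast
  show ?thesis
  proof (rule bounded_continuousI[where B = "B * K"])
    show "continuous_on UNIV (\<lambda>x. f (w x))"
      by (intro bounded_linear.continuous_on[OF assms(2)] bounded_continuousD assms)
    show "norm (f (w x)) \<le> B * K" for x
      using K(2)[of "w x"] mult_right_mono[OF B[of x] K(1)] by linarith
  qed
qed

lemma bounded_continuous_diff: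
  assumes "bounded_continuous v" "bounded_continuous w"
  shows "bounded_continuous (\<lambda>x. v x - w x)"
  using bounded_continuous_add[OF assms(1) bounded_continuous_linear[OF assms(2) bounded_linear_minus[OF bounded_linear_ident]]]
  by simp

lemma bounded_continuous_translate:
  assumes "bounded_continuous w" "continuous_on UNIV f"
  shows "bounded_continuous (\<lambda>x. translate (f x) (w x))"
  using assms unfolding bounded_continuous_def by (simp add: continuous_on_translate)

lemma bounded_continuous_const: "bounded_continuous (\<lambda>_. u)"
  by (auto simp: bounded_continuous_def)

text \<open>Covers the retarded and the advanced shift, with and without cutoff, so that existence,
  uniqueness and bounds are proved once. Continuity is demanded along curves only, since
  translations are strongly continuous but not continuous in operator norm.\<close>

definition contraction_kernel :: "(real \<Rightarrow> real \<Rightarrow> L2 \<Rightarrow> L2) \<Rightarrow> bool"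
  where "contraction_kernel P \<longleftrightarrow> (\<forall>x y. bounded_clinear (P x y)) \<and> (\<forall>x y u. norm (P x y u) \<le> norm u) \<and>
    (\<forall>f g w. continuous_on (UNIV :: real set) f \<longrightarrow> continuous_on UNIV g \<longrightarrow> continuous_on UNIV w \<longrightarrow>
      continuous_on UNIV (\<lambda>z. P (f z) (g z) (w z)))"

lemma contraction_kernel_translate:
  assumes "continuous_on UNIV (\<lambda>p. \<rho> (fst p) (snd p))"
  shows "contraction_kernel (\<lambda>x y. translate (\<rho> x y))"
  unfolding contraction_kernel_def
proof (intro conjI allI impI)
  fix f g :: "real \<Rightarrow> real" and w :: "real \<Rightarrow> L2"
  assume "continuous_on UNIV f" "continuous_on UNIV g" "continuous_on UNIV w"
  then show "continuous_on UNIV (\<lambda>z. translate (\<rho> (f z) (g z)) (w z))"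
    using continuous_on_compose2[OF assms, of UNIV "\<lambda>z. (f z, g z)"]
    by (intro continuous_on_translate) (auto intro: continuous_on_Pair)
qed (simp_all add: bounded_clinear_translate)

lemma bounded_clinear_compose:
  assumes "bounded_clinear f" "bounded_clinear g"
  shows "bounded_clinear (\<lambda>x. f (g x))"
  using assms bounded_linear_compose[of f g] by (auto simp: bounded_clinear_def)

lemma contraction_kernel_chi:
  assumes "contraction_kernel P"
  shows "contraction_kernel (\<lambda>x y u. chi (P x y u))"
  using assms unfolding contraction_kernel_def
  by (auto intro: bounded_clinear_compose[OF bounded_clinear_chi] order_trans[OF norm_chi_le]
      bounded_linear.continuous_on[OF bounded_linear_chi])

lemma bounded_continuous_kernel:
  assumes "contraction_kernel P" "bounded_continuous w"
  shows "bounded_continuous (\<lambda>y. P x y (w y))"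
proof -
  obtain B where B: "\<And>x. norm (w x) \<le> B"
    using assms unfolding bounded_continuous_def by blast
  show ?thesis
  proof (rule bounded_continuousI[where B = B])
    show "continuous_on UNIV (\<lambda>y. P x y (w y))"
      using assms by (simp add: contraction_kernel_def bounded_continuousD)
    show "norm (P x y (w y)) \<le> B" for y
      using assms(1) B[of y] unfolding contraction_kernel_def by (metis order_trans)
  qed
qed

text \<open>A Borel function bounded at every point is assumed because the arguments below work with
  products of \<open>lborel\<close>; an essentially bounded damping is reduced to this case at the
  end.\<close>

locale damping =
  fixes a :: "real \<Rightarrow> complex" and C :: real
  assumes a_measurable [measurable]: "a \<in> borel_measurable borel"
    and a_integrable: "integrable lborel a"
    and a_bounded: "cmod (a x) \<le> C"
    and a_norm: "(LINT x|lborel. cmod (a x)) < 2"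
begin

definition L1 :: real where "L1 = (LINT x|lborel. cmod (a x))"

lemma L1_bounds: "0 \<le> L1" "L1 < 2"
  using a_norm by (auto simp: L1_def intro: integral_nonneg_AE)

definition damp :: "(real \<Rightarrow> L2) \<Rightarrow> L2"
  where "damp h = (LINT y|lborel. a y *\<^sub>C h y)"

lemma damp_integrable:
  fixes h :: "real \<Rightarrow> L2"
  assumes "bounded_continuous h"
  shows "integrable lborel (\<lambda>y. a y *\<^sub>C h y)"
proof -
  obtain B where B: "\<And>x. norm (h x) \<le> B"
    using assms unfolding bounded_continuous_def by blast
  have [measurable]: "h \<in> borel_measurable borel"
    by (intro borel_measurable_continuous_onI bounded_continuousD assms)
  have cont: "continuous_on UNIV (\<lambda>p. fst p *\<^sub>C (snd p :: L2))"
    by (rule bounded_bilinear.continuous_on[OF bounded_bilinear_scaleC]) (simp_all add: continuous_on_fst continuous_on_snd)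
  have "a \<in> borel_measurable lborel" "h \<in> borel_measurable lborel" by measurable
  note m = borel_measurable_continuous_Pair[OF this cont]
  show ?thesis
  proof (rule Bochner_Integration.integrable_bound[OF integrable_mult_right[OF a_integrable, of "complex_of_real B"] m])
    show "AE y in lborel. norm (a y *\<^sub>C h y) \<le> norm (complex_of_real B * a y)"
    proof (rule AE_I2)
      fix y
      have "norm (a y *\<^sub>C h y) \<le> cmod (a y) * B"
        unfolding norm_scaleC by (rule mult_left_mono[OF B norm_ge_zero])
      also have "\<dots> \<le> norm (complex_of_real B * a y)"
        by (simp add: norm_mult mult.commute mult_right_mono)
      finally show "norm (a y *\<^sub>C h y) \<le> norm (complex_of_real B * a y)" .
    qed
  qed
qed

lemma norm_damp_le:
  assumes "bounded_continuous h" "\<And>x. norm (h x) \<le> B"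
  shows "norm (damp h) \<le> L1 * B"
proof -
  have "norm (damp h) \<le> (LINT y|lborel. cmod (a y) * B)"
    unfolding damp_def
  proof (rule Bochner_Integration.integral_norm_bound_integral[OF damp_integrable[OF assms(1)]])
    show "integrable lborel (\<lambda>y. cmod (a y) * B)"
      by (intro integrable_mult_left integrable_norm a_integrable)
  qed (simp add: norm_scaleC mult_left_mono assms(2))
  then show ?thesis by (simp add: L1_def)
qed

lemma damp_add:
  assumes "bounded_continuous g" "bounded_continuous h"
  shows "damp (\<lambda>y. g y + h y) = damp g + damp h"
  unfolding damp_def scaleC_add_right by (intro Bochner_Integration.integral_add damp_integrable assms)

lemma damp_diff:
  assumes "bounded_continuous g" "bounded_continuous h"
  shows "damp (\<lambda>y. g y - h y) = damp g - damp h"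
  unfolding damp_def scaleC_diff_right by (intro Bochner_Integration.integral_diff damp_integrable assms)

lemma damp_clinear:
  assumes "bounded_clinear f" "bounded_continuous h"
  shows "damp (\<lambda>y. f (h y)) = f (damp h)"
proof -
  have "f (damp h) = (LINT y|lborel. f (a y *\<^sub>C h y))"
    unfolding damp_def using integral_bounded_linear[OF bounded_clinear_imp[OF assms(1)] damp_integrable[OF assms(2)]] by simp
  then show ?thesis
    using assms(1) by (simp add: damp_def bounded_clinear_def)
qed

lemma bounded_clinear_scaleC: "bounded_clinear (\<lambda>x :: L2. c *\<^sub>C x)"
  by (rule bounded_clinearI[where K = "cmod c"])
    (simp_all add: scaleC_add_right scaleC_scaleC mult.commute norm_scaleC)

lemma damp_scaleC: "bounded_continuous h \<Longrightarrow> damp (\<lambda>y. c *\<^sub>C h y) = c *\<^sub>C damp h"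
  by (rule damp_clinear[OF bounded_clinear_scaleC])

text \<open>Continuity in each variable separately suffices, by dominated convergence along
  sequences of x.\<close>

lemma bounded_continuous_damp:
  assumes 1: "\<And>y. continuous_on UNIV (\<lambda>x. h x y)" and 2: "\<And>x. continuous_on UNIV (h x)"
    and B: "\<And>x y. norm (h x y) \<le> B"
  shows "bounded_continuous (\<lambda>x. damp (h x))"
proof -
  have bc: "bounded_continuous (h x)" for x by (rule bounded_continuousI[OF 2 B])
  note m = borel_measurable_integrable[OF damp_integrable[OF bc]]
  show ?thesis
  proof (rule bounded_continuousI[where B = "L1 * B"])
    show "norm (damp (h x)) \<le> L1 * B" for x
      by (rule norm_damp_le[OF bc B])
    show "continuous_on UNIV (\<lambda>x. damp (h x))"
      unfolding continuous_on_sequentially o_def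
    proof (intro allI ballI impI)
      fix X :: "nat \<Rightarrow> real" and x assume "(\<forall>n. X n \<in> UNIV) \<and> X \<longlonglongrightarrow> x"
      then have X: "X \<longlonglongrightarrow> x" by simp
      show "(\<lambda>n. damp (h (X n))) \<longlonglongrightarrow> damp (h x)"
        unfolding damp_def
      proof (rule integral_dominated_convergence[where w = "\<lambda>y. cmod (a y) * B"])
        show "integrable lborel (\<lambda>y. cmod (a y) * B)"
          by (intro integrable_mult_left integrable_norm a_integrable)
        show "AE y in lborel. norm (a y *\<^sub>C h (X n) y) \<le> cmod (a y) * B" for n
          by (intro AE_I2) (simp add: norm_scaleC mult_left_mono B)
        show "AE y in lborel. (\<lambda>n. a y *\<^sub>C h (X n) y) \<longlonglongrightarrow> a y *\<^sub>C h x y"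
        proof (intro AE_I2 bounded_linear.tendsto[OF bounded_linear_scaleC])
          fix y show "(\<lambda>n. h (X n) y) \<longlonglongrightarrow> h x y"
            by (rule continuous_on_tendsto_compose[OF 1 X]) auto
        qed
      qed (use m in auto)
    qed
  qed
qed

lemma bounded_continuous_damp_kernel:
  assumes P: "contraction_kernel P" and w: "bounded_continuous w"
  shows "bounded_continuous (\<lambda>x. damp (\<lambda>y. P x y (w y)))"
proof -
  obtain B where B: "\<And>x. norm (w x) \<le> B"
    using w unfolding bounded_continuous_def by blast
  show ?thesis
  proof (rule bounded_continuous_damp[where B = B])
    show "continuous_on UNIV (\<lambda>x. P x y (w y))" for y
      using P unfolding contraction_kernel_def by (simp add: continuous_on_id continuous_on_const)
    show "continuous_on UNIV (\<lambda>y. P x y (w y))" for x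
      using bounded_continuous_kernel[OF P w] by (rule bounded_continuousD)
    show "norm (P x y (w y)) \<le> B" for x y
      using P B[of y] unfolding contraction_kernel_def by (metis order_trans)
  qed
qed

text \<open>The supremum S of the norms of w is finite and satisfies S <= G + (L1 / 2) S, so the
  last term can be absorbed.\<close>

lemma kernel_equation_bound:
  assumes P: "contraction_kernel P" and w: "bounded_continuous w" and c: "\<bar>c\<bar> = 1/2"
    and eq: "\<And>x. w x = g x + c *\<^sub>R damp (\<lambda>y. P x y (w y))" and g: "\<And>x. norm (g x) \<le> G"
  shows "norm (w x) \<le> G / (1 - L1 / 2)"
proof -
  obtain B where B: "\<And>x. norm (w x) \<le> B"
    using w unfolding bounded_continuous_def by blast
  define S where "S = (SUP x. norm (w x))"
  have S: "norm (w x) \<le> S" for x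
    unfolding S_def using B by (intro cSUP_upper) (auto intro!: bdd_aboveI)
  have "S \<le> G + L1 / 2 * S"
    unfolding S_def[of]
  proof (rule cSUP_least)
    fix x
    have Pn: "norm (P x y (w y)) \<le> S" for y
      using P S[of y] unfolding contraction_kernel_def by (metis order_trans)
    have "norm (damp (\<lambda>y. P x y (w y))) \<le> L1 * S"
      by (rule norm_damp_le[OF bounded_continuous_kernel[OF P w] Pn])
    then have "norm (c *\<^sub>R damp (\<lambda>y. P x y (w y))) \<le> L1 / 2 * S"
      unfolding norm_scaleR real_norm_def c by simp
    then show "norm (w x) \<le> G + L1 / 2 * (SUP x. norm (w x))"
      using g[of x] unfolding S_def[symmetric] by (subst eq) (rule norm_triangle_mono)
  qed simp
  then have "S * (1 - L1 / 2) \<le> G" by (simp add: algebra_simps)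
  then have "S \<le> G / (1 - L1 / 2)" using L1_bounds by (simp add: pos_le_divide_eq)
  then show ?thesis using S[of x] by linarith
qed

lemma kernel_equation_unique:
  assumes P: "contraction_kernel P" and v: "bounded_continuous v" and w: "bounded_continuous w" and c: "\<bar>c\<bar> = 1/2"
    and eq: "\<And>x. v x = g x + c *\<^sub>R damp (\<lambda>y. P x y (v y))" "\<And>x. w x = g x + c *\<^sub>R damp (\<lambda>y. P x y (w y))"
  shows "v x = w x"
proof -
  have lin: "P x y (v y - w y) = P x y (v y) - P x y (w y)" for x y
    using P by (auto simp: contraction_kernel_def bounded_clinear_def linear_simps(2))
  have "norm (v x - w x) \<le> 0 / (1 - L1 / 2)"
  proof (rule kernel_equation_bound[OF P bounded_continuous_diff[OF v w] c, where g = "\<lambda>_. 0"])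
    show "v x - w x = 0 + c *\<^sub>R damp (\<lambda>y. P x y (v y - w y))" for x
      unfolding lin damp_diff[OF bounded_continuous_kernel[OF P v] bounded_continuous_kernel[OF P w]]
      by (subst eq(1), subst eq(2)) (simp add: scaleR_diff_right)
  qed simp
  then show ?thesis by simp
qed

lemma kernel_equation_exists:
  assumes P: "contraction_kernel P" and g: "bounded_continuous g" and c: "\<bar>c\<bar> = 1/2"
  shows "\<exists>w. bounded_continuous w \<and> (\<forall>x. w x = g x + c *\<^sub>R damp (\<lambda>y. P x y (w y)))"
proof -
  define f where "f w = Bcontfun (\<lambda>x. g x + c *\<^sub>R damp (\<lambda>y. P x y (apply_bcontfun w y)))" for w :: "real \<Rightarrow>\<^sub>C L2"
  have bc: "bounded_continuous (apply_bcontfun w)" for w :: "real \<Rightarrow>\<^sub>C L2"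
    by (rule bounded_continuousI[where B = "norm w"]) (simp_all add: norm_bounded)
  have mem: "(\<lambda>x. g x + c *\<^sub>R damp (\<lambda>y. P x y (apply_bcontfun w y))) \<in> bcontfun" for w
  proof -
    have "bounded_continuous (\<lambda>x. g x + c *\<^sub>R damp (\<lambda>y. P x y (apply_bcontfun w y)))"
      by (rule bounded_continuous_add[OF g bounded_continuous_linear[OF bounded_continuous_damp_kernel[OF P bc]
            bounded_linear_scaleR_right]])
    then show ?thesis unfolding bounded_continuous_def by (blast intro: bcontfun_normI)
  qed
  have app: "apply_bcontfun (f w) x = g x + c *\<^sub>R damp (\<lambda>y. P x y (apply_bcontfun w y))" for w x
    unfolding f_def using mem[of w] by (simp add: Bcontfun_inverse)
  have "\<exists>!w. f w = w"
  proof (rule banach_fix_type)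
    show "0 \<le> L1 / 2" "L1 / 2 < 1" using L1_bounds by auto
    show "\<forall>v w. dist (f v) (f w) \<le> L1 / 2 * dist v w"
    proof (intro allI dist_bound)
      fix v w x
      have lin: "P x y (apply_bcontfun v y) - P x y (apply_bcontfun w y) = P x y (apply_bcontfun v y - apply_bcontfun w y)" for y
        using P by (auto simp: contraction_kernel_def bounded_clinear_def linear_simps(2))
      have le: "norm (P x y (apply_bcontfun v y - apply_bcontfun w y)) \<le> dist v w" for y
        using P dist_bounded[of v y w] unfolding contraction_kernel_def dist_norm by (metis order_trans)
      have "apply_bcontfun (f v) x - apply_bcontfun (f w) x
          = c *\<^sub>R damp (\<lambda>y. P x y (apply_bcontfun v y - apply_bcontfun w y))"
        unfolding app lin[symmetric] damp_diff[OF bounded_continuous_kernel[OF P bc] bounded_continuous_kernel[OF P bc]]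
        by (simp add: scaleR_diff_right)
      moreover have "norm (damp (\<lambda>y. P x y (apply_bcontfun v y - apply_bcontfun w y))) \<le> L1 * dist v w"
        by (rule norm_damp_le[OF bounded_continuous_kernel[OF P bounded_continuous_diff[OF bc bc]] le])
      ultimately show "dist (apply_bcontfun (f v) x) (apply_bcontfun (f w) x) \<le> L1 / 2 * dist v w"
        unfolding dist_norm[of "apply_bcontfun (f v) x"] by (simp add: c)
    qed
  qed
  then obtain w where "f w = w" by blast
  then have "apply_bcontfun w x = g x + c *\<^sub>R damp (\<lambda>y. P x y (apply_bcontfun w y))" for x
    using app[of w x] by simp
  then show ?thesis using bc by blast
qed

end

text \<open>D'Alembert's formula: the free velocity at the time t and the position x is half of f (t
  + x) - g (t - x), read as a function of t for fixed x. The two terms travel to the left and to the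
  right.\<close>

definition incoming :: "L2 \<times> L2 \<Rightarrow> real \<Rightarrow> L2"
  where "incoming u x = (1/2) *\<^sub>R (translate x (fst u) - translate (- x) (snd u))"

lemma bounded_continuous_incoming: "bounded_continuous (incoming u)"
  unfolding incoming_def[abs_def]
  by (intro bounded_continuous_linear[OF bounded_continuous_diff[OF bounded_continuous_translate[OF bounded_continuous_const]
      bounded_continuous_translate[OF bounded_continuous_const]] bounded_linear_scaleR_right] continuous_intros)

lemma norm_incoming_le: "norm (incoming u x) \<le> norm u"
proof -
  have "norm (translate x (fst u) - translate (- x) (snd u)) \<le> norm (fst u) + norm (snd u)"
    by (rule order_trans[OF norm_triangle_ineq4]) simp
  also have "\<dots> \<le> 2 * norm u"
    using norm_fst_le[of "fst u" "snd u"] norm_snd_le[of "snd u" "fst u"] by simp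
  finally show ?thesis by (simp add: incoming_def)
qed

lemma incoming_add: "incoming (u + v) x = incoming u x + incoming v x"
  by (simp add: incoming_def algebra_simps)

lemma incoming_scaleC: "incoming (c *\<^sub>C u) x = c *\<^sub>C incoming u x"
  by (simp add: incoming_def scaleC_prod_def scaleC_scaleR_commute scaleC_diff_right)

lemma bounded_clinear_inv:
  fixes W :: "'a::complex_normed_vector \<Rightarrow> 'b::complex_normed_vector"
  assumes W: "bounded_clinear W" "bij W" and bound: "\<And>x. norm x \<le> norm (W x) * K"
  shows "bounded_clinear (inv W)"
proof (rule bounded_clinearI)
  have inv: "W (inv W y) = y" for y using W(2) by (simp add: bij_is_surj surj_f_inv_f)
  have inj: "W x = W y \<Longrightarrow> x = y" for x y using W(2) by (simp add: bij_is_inj inj_eq)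
  show "inv W (x + y) = inv W x + inv W y" for x y
    by (rule inj) (simp add: inv linear_simps[OF bounded_clinear_imp[OF W(1)]])
  show "inv W (c *\<^sub>C x) = c *\<^sub>C inv W x" for c x
    using W(1) by (intro inj) (simp add: inv bounded_clinear_def)
  show "norm (inv W x) \<le> norm x * K" for x
    using bound[of "inv W x"] by (simp add: inv)
qed

section \<open>Retarded solutions, and the wave operator with its inverse\<close>

context damping
begin

abbreviation (input) "retarded \<equiv> \<lambda>x y :: real. translate (- \<bar>x - y\<bar>)"
abbreviation (input) "advanced \<equiv> \<lambda>x y :: real. translate \<bar>x - y\<bar>"

lemma kernel_retarded: "contraction_kernel retarded"
  and kernel_advanced: "contraction_kernel advanced"
  by (intro contraction_kernel_translate continuous_intros)+

lemma solution_exists: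
  "\<exists>v. bounded_continuous v \<and> (\<forall>x. v x = incoming u x + (- 1/2) *\<^sub>R damp (\<lambda>y. retarded x y (v y)))"
  by (rule kernel_equation_exists[OF kernel_retarded bounded_continuous_incoming]) simp

text \<open>Any fixed point can be chosen since there is only one; uniqueness also gives linearity
  in u and the compatibility with time translations.\<close>

definition solution :: "L2 \<times> L2 \<Rightarrow> real \<Rightarrow> L2"
  where "solution u = (SOME v. bounded_continuous v \<and>
    (\<forall>x. v x = incoming u x + (- 1/2) *\<^sub>R damp (\<lambda>y. retarded x y (v y))))"

lemma solution_bounded_continuous: "bounded_continuous (solution u)"
  and solution_eq: "solution u x = incoming u x + (- 1/2) *\<^sub>R damp (\<lambda>y. retarded x y (solution u y))"
  using someI_ex[OF solution_exists[of u]] unfolding solution_def by blast+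

lemma solution_unique:
  assumes "bounded_continuous v" "\<And>x. v x = incoming u x + (- 1/2) *\<^sub>R damp (\<lambda>y. retarded x y (v y))"
  shows "v x = solution u x"
  by (rule kernel_equation_unique[OF kernel_retarded assms(1) solution_bounded_continuous _ assms(2) solution_eq]) simp

lemma norm_solution_le: "norm (solution u x) \<le> norm u / (1 - L1 / 2)"
  by (rule kernel_equation_bound[OF kernel_retarded solution_bounded_continuous _ solution_eq norm_incoming_le]) simp

lemma solution_add: "solution (u + v) x = solution u x + solution v x"
proof (rule solution_unique[symmetric])
  show "bounded_continuous (\<lambda>x. solution u x + solution v x)"
    by (rule bounded_continuous_add[OF solution_bounded_continuous solution_bounded_continuous])
  fix x
  have "damp (\<lambda>y. retarded x y (solution u y + solution v y))
    = damp (\<lambda>y. retarded x y (solution u y)) + damp (\<lambda>y. retarded x y (solution v y))"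
    unfolding translate_add
    by (rule damp_add[OF bounded_continuous_kernel[OF kernel_retarded solution_bounded_continuous]
          bounded_continuous_kernel[OF kernel_retarded solution_bounded_continuous]])
  then show "solution u x + solution v x = incoming (u + v) x + (- 1/2) *\<^sub>R damp (\<lambda>y. retarded x y (solution u y + solution v y))"
    using solution_eq[of u x] solution_eq[of v x] by (simp add: incoming_add scaleR_add_right)
qed

lemma solution_scaleC: "solution (c *\<^sub>C u) x = c *\<^sub>C solution u x"
proof (rule solution_unique[symmetric])
  show "bounded_continuous (\<lambda>x. c *\<^sub>C solution u x)"
    by (rule bounded_continuous_linear[OF solution_bounded_continuous bounded_linear_scaleC])
  fix x
  have "damp (\<lambda>y. retarded x y (c *\<^sub>C solution u y)) = c *\<^sub>C damp (\<lambda>y. retarded x y (solution u y))"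
    unfolding translate_scaleC
    by (rule damp_scaleC[OF bounded_continuous_kernel[OF kernel_retarded solution_bounded_continuous]])
  then show "c *\<^sub>C solution u x = incoming (c *\<^sub>C u) x + (- 1/2) *\<^sub>R damp (\<lambda>y. retarded x y (c *\<^sub>C solution u y))"
    using arg_cong[OF solution_eq[of u x], of "\<lambda>z. c *\<^sub>C z"]
    by (simp add: incoming_scaleC scaleC_diff_right scaleC_scaleR_commute)
qed

text \<open>Integrating the equations of the two travelling parts along their characteristics, x + t
  or x - t constant, with the velocity w as the source of the damping term gives these two
  superpositions. The opposite sign reflects that g contains the velocity with a minus sign.\<close>

definition scatter :: "(real \<Rightarrow> L2) \<Rightarrow> L2 \<times> L2"
  where "scatter w = (damp (\<lambda>y. translate (- y) (w y)), - damp (\<lambda>y. translate y (w y)))"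

text \<open>Up to time 0, only the velocity at negative times has acted, hence the cutoff before
  scattering.\<close>

definition wave_op :: "L2 \<times> L2 \<Rightarrow> L2 \<times> L2"
  where "wave_op u = u - scatter (\<lambda>y. chi (solution u y))"

lemma bounded_continuous_translates:
  assumes "bounded_continuous w"
  shows "bounded_continuous (\<lambda>y. translate (- y) (w y))" "bounded_continuous (\<lambda>y. translate y (w y))"
  by (rule bounded_continuous_translate[OF assms], intro continuous_intros)+

lemma norm_scatter_le:
  assumes w: "bounded_continuous w" "\<And>x. norm (w x) \<le> B"
  shows "norm (scatter w) \<le> 2 * L1 * B"
proof -
  have "norm (damp (\<lambda>y. translate (- y) (w y))) \<le> L1 * B" "norm (damp (\<lambda>y. translate y (w y))) \<le> L1 * B"
    by (rule norm_damp_le[OF bounded_continuous_translates(1)[OF w(1)]], simp add: w)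
      (rule norm_damp_le[OF bounded_continuous_translates(2)[OF w(1)]], simp add: w)
  then show ?thesis
    using norm_Pair_le[of "damp (\<lambda>y. translate (- y) (w y))" "- damp (\<lambda>y. translate y (w y))"]
    by (simp add: scatter_def)
qed

lemma bounded_continuous_chi_solution: "bounded_continuous (\<lambda>y. chi (solution u y))"
  by (rule bounded_continuous_linear[OF solution_bounded_continuous bounded_linear_chi])

lemma bounded_clinear_wave_op: "bounded_clinear wave_op"
proof (rule bounded_clinearI)
  fix u v :: "L2 \<times> L2" and c
  show "wave_op (u + v) = wave_op u + wave_op v"
    by (simp add: wave_op_def scatter_def solution_add chi_simps damp_add bounded_continuous_translates bounded_continuous_chi_solution prod_eq_iff)
  have "chi (solution (c *\<^sub>C u) y) = c *\<^sub>C chi (solution u y)" for y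
    using bounded_clinear_chi by (simp only: solution_scaleC bounded_clinear_def)
  then have "scatter (\<lambda>y. chi (solution (c *\<^sub>C u) y)) = c *\<^sub>C scatter (\<lambda>y. chi (solution u y))"
    by (simp add: scatter_def damp_scaleC bounded_continuous_translates bounded_continuous_chi_solution scaleC_prod_def
        linear_simps(4)[OF bounded_linear_scaleC])
  then show "wave_op (c *\<^sub>C u) = c *\<^sub>C wave_op u"
    by (simp only: wave_op_def scaleC_diff_right)
  have "norm (chi (solution u y)) \<le> norm u / (1 - L1 / 2)" for y
    using norm_chi_le norm_solution_le by (rule order_trans)
  then have "norm (scatter (\<lambda>y. chi (solution u y))) \<le> 2 * L1 * (norm u / (1 - L1 / 2))"
    by (rule norm_scatter_le[OF bounded_continuous_chi_solution])
  then have "norm (wave_op u) \<le> norm u + 2 * L1 * (norm u / (1 - L1 / 2))"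
    unfolding wave_op_def using norm_triangle_ineq4[of u "scatter (\<lambda>y. chi (solution u y))"] by linarith
  then show "norm (wave_op u) \<le> norm u * (1 + 2 * L1 / (1 - L1 / 2))"
    by (simp add: algebra_simps)
qed

text \<open>Of the two arguments \<open>x - y\<close> and \<open>y - x\<close>, one is \<open>\<bar>x - y\<bar>\<close> and the other one is
  \<open>- \<bar>x - y\<bar>\<close>. This turns the retarded equation for the incoming data into the advanced
  equation for the data at time 0.\<close>

lemma incoming_scatter:
  assumes w: "bounded_continuous w"
  shows "incoming (scatter w) x =
    (1/2) *\<^sub>R damp (\<lambda>y. advanced x y (w y)) + (1/2) *\<^sub>R damp (\<lambda>y. retarded x y (w y))"
proof -
  have bc: "bounded_continuous (\<lambda>y. translate (x - y) (w y))" "bounded_continuous (\<lambda>y. translate (y - x) (w y))"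
    by (rule bounded_continuous_translate[OF w], intro continuous_intros)+
  have "translate x (damp (\<lambda>y. translate (- y) (w y))) = damp (\<lambda>y. translate (x - y) (w y))"
    using damp_clinear[OF bounded_clinear_translate bounded_continuous_translates(1)[OF w], of x] by simp
  moreover have "translate (- x) (damp (\<lambda>y. translate y (w y))) = damp (\<lambda>y. translate (y - x) (w y))"
    using damp_clinear[OF bounded_clinear_translate bounded_continuous_translates(2)[OF w], of "-x"] by simp
  ultimately have "incoming (scatter w) x = (1/2) *\<^sub>R damp (\<lambda>y. translate (x - y) (w y) + translate (y - x) (w y))"
    by (simp add: incoming_def scatter_def translate_simps damp_add bc)
  also have "(\<lambda>y. translate (x - y) (w y) + translate (y - x) (w y)) = (\<lambda>y. advanced x y (w y) + retarded x y (w y))"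
    by (auto simp: fun_eq_iff abs_if)
  also have "(1/2) *\<^sub>R damp \<dots> = (1/2) *\<^sub>R damp (\<lambda>y. advanced x y (w y)) + (1/2) *\<^sub>R damp (\<lambda>y. retarded x y (w y))"
    unfolding damp_add[OF bounded_continuous_kernel[OF kernel_advanced w] bounded_continuous_kernel[OF kernel_retarded w]]
    by (rule scaleR_add_right)
  finally show ?thesis .
qed

lemma chi_damp: "bounded_continuous h \<Longrightarrow> chi (damp h) = damp (\<lambda>y. chi (h y))"
  by (rule damp_clinear[OF bounded_clinear_chi, symmetric])

lemma chi_incoming_scatter:
  assumes w: "bounded_continuous w"
  shows "chi (incoming (scatter w) x) = (1/2) *\<^sub>R damp (\<lambda>y. chi (advanced x y (w y)))
    + (1/2) *\<^sub>R damp (\<lambda>y. chi (retarded x y (w y)))"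
  unfolding incoming_scatter[OF w]
  by (simp add: chi_simps chi_damp bounded_continuous_kernel[OF kernel_advanced w] bounded_continuous_kernel[OF kernel_retarded w])

text \<open>By causality (\<open>chi_translate\<close>), the retarded equation closes on negative
  times.\<close>

lemma chi_solution_retarded:
  "chi (solution u x) = chi (incoming u x) + (- 1/2) *\<^sub>R damp (\<lambda>y. chi (retarded x y (chi (solution u y))))"
proof -
  have "chi (solution u x) = chi (incoming u x) + (- 1/2) *\<^sub>R chi (damp (\<lambda>y. retarded x y (solution u y)))"
    by (subst solution_eq) (simp add: chi_simps)
  also have "chi (damp (\<lambda>y. retarded x y (solution u y))) = damp (\<lambda>y. chi (retarded x y (solution u y)))"
    by (rule chi_damp[OF bounded_continuous_kernel[OF kernel_retarded solution_bounded_continuous]])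
  finally show ?thesis by (simp add: chi_translate)
qed

lemma incoming_diff: "incoming (u - v) x = incoming u x - incoming v x"
  by (simp add: incoming_def translate_simps algebra_simps)

text \<open>Replacing u by \<open>wave_op u\<close> in the free term cancels the retarded integral
  and leaves the advanced one with the opposite sign: the past velocity is recovered from the data
  at time 0.\<close>

lemma chi_solution_advanced:
  "chi (solution u x) = chi (incoming (wave_op u) x) + (1/2) *\<^sub>R damp (\<lambda>y. chi (advanced x y (chi (solution u y))))"
proof -
  let ?w = "\<lambda>y. chi (solution u y)"
  have "chi (incoming (wave_op u) x) = chi (incoming u x) - chi (incoming (scatter ?w) x)"
    by (simp add: wave_op_def incoming_diff chi_simps)
  then show ?thesis
    using chi_solution_retarded[of u x] chi_incoming_scatter[OF bounded_continuous_chi_solution, of u x] by simp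
qed

text \<open>The advanced equation bounds the past velocity by the data at time 0, and u is these
  data plus the scattered part.\<close>

lemma norm_wave_op_ge: "norm u \<le> norm (wave_op u) * (1 + 2 * L1 / (1 - L1 / 2))"
proof -
  let ?w = "\<lambda>y. chi (solution u y)"
  have "norm (?w x) \<le> norm (wave_op u) / (1 - L1 / 2)" for x
    by (rule kernel_equation_bound[OF contraction_kernel_chi[OF kernel_advanced] bounded_continuous_chi_solution _ chi_solution_advanced])
      (auto intro: order_trans[OF norm_chi_le norm_incoming_le])
  then have "norm (scatter ?w) \<le> 2 * L1 * (norm (wave_op u) / (1 - L1 / 2))"
    by (rule norm_scatter_le[OF bounded_continuous_chi_solution])
  moreover have "u = wave_op u + scatter ?w" by (simp add: wave_op_def)
  ultimately have "norm u \<le> norm (wave_op u) + 2 * L1 * (norm (wave_op u) / (1 - L1 / 2))"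
    using norm_triangle_ineq[of "wave_op u" "scatter ?w"] by simp
  then show ?thesis by (simp add: algebra_simps)
qed

lemma surj_wave_op: "surj wave_op"
proof (unfold surj_def, rule allI)
  fix p
  have "bounded_continuous (\<lambda>x. chi (incoming p x))"
    by (rule bounded_continuous_linear[OF bounded_continuous_incoming bounded_linear_chi])
  from kernel_equation_exists[OF contraction_kernel_chi[OF kernel_advanced] this, of "1/2"]
  obtain w where w: "bounded_continuous w"
    and eq: "\<And>x. w x = chi (incoming p x) + (1/2) *\<^sub>R damp (\<lambda>y. chi (advanced x y (w y)))"
    by auto
  \<comment> \<open>The preimage restores what scattering would subtract. For these incoming data w
    solves the retarded equation on negative times, and uniqueness identifies it with the cut off
    solution.\<close>
  let ?u = "p + scatter w"
  have eq2: "w x = chi (incoming ?u x) + (- 1/2) *\<^sub>R damp (\<lambda>y. chi (retarded x y (w y)))" for x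
    by (subst eq) (simp add: incoming_add chi_simps chi_incoming_scatter[OF w])
  have "\<bar>- 1/2 :: real\<bar> = 1/2" by simp
  note kernel_equation_unique[OF contraction_kernel_chi[OF kernel_retarded] w bounded_continuous_chi_solution this eq2 chi_solution_retarded]
  then have "(\<lambda>x. chi (solution ?u x)) = w" by auto
  then have "p = wave_op ?u" by (simp add: wave_op_def)
  then show "\<exists>u. p = wave_op u" by blast
qed

lemma bij_wave_op: "bij wave_op"
proof (rule bijI[OF _ surj_wave_op])
  show "inj wave_op"
  proof (rule injI)
    fix u v assume "wave_op u = wave_op v"
    then have "wave_op (u - v) = 0"
      by (simp add: linear_simps[OF bounded_clinear_imp[OF bounded_clinear_wave_op]])
    then show "u = v" using norm_wave_op_ge[of "u - v"] by simp
  qed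
qed

lemma bounded_clinear_inv_wave_op: "bounded_clinear (inv wave_op)"
  by (rule bounded_clinear_inv[OF bounded_clinear_wave_op bij_wave_op norm_wave_op_ge])

end

section \<open>The Duhamel formula for single waves\<close>

lemma Linf_mult_cong_AE:
  assumes "in_Linf a" "in_Linf b" "AE x in lebesgue. a x = b x"
  shows "Linf_mult a u = Linf_mult b u"
proof -
  obtain f where f: "square_integrable f" "u = abs_L2 f" by (rule L2_cases)
  have "AE x in lebesgue. a x * f x = b x * f x" using assms(3) by eventually_elim simp
  then show ?thesis
    using abs_L2_eq_iff[OF square_integrable_mult_bounded[OF assms(1) f(1)] square_integrable_mult_bounded[OF assms(2) f(1)]]
    by (simp add: f Linf_mult_abs assms)
qed

lemma AE_lebesgue_neq: "AE x in lebesgue. x \<noteq> (c :: real)"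
proof -
  have "AE x in lebesgue. x \<notin> {c}"
    by (intro AE_not_in) (simp add: finite_imp_null_set_lborel null_sets_completionI)
  then show ?thesis by simp
qed

text \<open>Cuts off to the times that a shift by r moves across time 0; it measures how far
  \<open>chi\<close> is from commuting with this shift.\<close>

definition slab :: "real \<Rightarrow> L2 \<Rightarrow> L2"
  where "slab r = Linf_mult (indicator {-r..0})"

lemma bounded_clinear_slab: "bounded_clinear (slab r)"
  unfolding slab_def by (rule bounded_clinear_Linf_mult[OF in_Linf_indicator]) simp

lemmas bounded_linear_slab = bounded_clinear_imp[OF bounded_clinear_slab]

lemma norm_slab_le: "norm (slab r u) \<le> norm u"
  using norm_Linf_mult_le[of "indicator {-r..0}" 1 u]
  by (simp add: slab_def in_Linf_indicator indicator_def)

lemma slab_abs: "square_integrable f \<Longrightarrow> slab r (abs_L2 f) = abs_L2 (\<lambda>x. indicator {-r..0} x * f x)"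
  by (simp add: slab_def Linf_mult_abs in_Linf_indicator)

lemma chi_translate_commutator:
  assumes "r \<ge> 0"
  shows "chi (translate r u) - translate r (chi u) = slab r (translate r u)"
proof -
  obtain f where f: "square_integrable f" "u = abs_L2 f" by (rule L2_cases)
  have sq: "square_integrable (\<lambda>x. indicator {..<0} x * f (x + r))"
    "square_integrable (\<lambda>x. indicator {..<0} (x + r) * f (x + r))"
    "square_integrable (\<lambda>x. indicator {-r..0} x * f (x + r))"
    using square_integrable_indicator_mult[OF square_integrable_translate[OF f(1), of r]]
      square_integrable_translate[OF square_integrable_indicator_mult[OF f(1)], of "{..<0}" r] by auto
  \<comment> \<open>Time 0 belongs to the slab but not to the cutoff, so the identity holds almost
    everywhere only.\<close>
  have "AE x in lebesgue. indicator {..<0} x * f (x + r) - indicator {..<0} (x + r) * f (x + r)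
      = indicator {-r..0} x * f (x + r)"
    using AE_lebesgue_neq[of 0] by eventually_elim (use assms in \<open>auto simp: indicator_def\<close>)
  then have "abs_L2 (\<lambda>x. indicator {..<0} x * f (x + r)) - abs_L2 (\<lambda>x. indicator {..<0} (x + r) * f (x + r))
      = abs_L2 (\<lambda>x. indicator {-r..0} x * f (x + r))"
    unfolding abs_L2_arith(2)[OF sq(1,2)] by (subst abs_L2_eq_iff[OF square_integrable_diff[OF sq(1,2)] sq(3)])
  then show ?thesis
    by (simp add: f chi_abs slab_abs translate_abs square_integrable_translate square_integrable_indicator_mult)
qed

lemma bounded_linear_eq_on_test:
  fixes f g :: "L2 \<Rightarrow> 'a::real_normed_vector"
  assumes "bounded_linear f" "bounded_linear g" "\<And>\<phi>. f (test_to_L2 \<phi>) = g (test_to_L2 \<phi>)"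
  shows "f u = g u"
proof (rule ccontr)
  assume n: "f u \<noteq> g u"
  interpret d: bounded_linear "\<lambda>u. f u - g u"
    by (rule bounded_linear_sub[OF assms(1,2)])
  obtain K where K: "K > 0" "\<And>u. norm (f u - g u) \<le> norm u * K"
    using d.pos_bounded by blast
  have "norm (f u - g u) / K > 0" using n K(1) by simp
  then obtain \<phi> where \<phi>: "norm (u - test_to_L2 \<phi>) < norm (f u - g u) / K" by (rule test_dense)
  have "f u - g u = f (u - test_to_L2 \<phi>) - g (u - test_to_L2 \<phi>)"
    using d.diff[of u "test_to_L2 \<phi>"] assms(3)[of \<phi>] by simp
  then have "norm (f u - g u) \<le> norm (u - test_to_L2 \<phi>) * K" using K(2) by metis
  also have "\<dots> < norm (f u - g u)" using \<phi> K(1) by (simp add: pos_less_divide_eq)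
  finally show False by simp
qed

lemma integrable_pair_bound:
  fixes F :: "real \<times> real \<Rightarrow> 'b::{banach, second_countable_topology}"
  assumes F: "F \<in> borel_measurable (lborel \<Otimes>\<^sub>M lborel)"
    and p: "integrable lborel p" and q: "integrable lborel q"
    and bound: "\<And>x y. norm (F (x, y)) \<le> norm (p x :: real) * norm (q y :: real)"
  shows "integrable (lborel \<Otimes>\<^sub>M lborel) F"
proof (rule integrableI_bounded[OF F])
  have [measurable]: "p \<in> borel_measurable borel" "q \<in> borel_measurable borel"
    using p q by auto
  have "(\<integral>\<^sup>+z. norm (F z) \<partial>(lborel \<Otimes>\<^sub>M lborel)) \<le> (\<integral>\<^sup>+z. ennreal (norm (p (fst z))) * ennreal (norm (q (snd z))) \<partial>(lborel \<Otimes>\<^sub>M lborel))"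
  proof (rule nn_integral_mono)
    fix z :: "real \<times> real"
    have "norm (F z) \<le> norm (p (fst z)) * norm (q (snd z))" using bound[of "fst z" "snd z"] by simp
    then show "ennreal (norm (F z)) \<le> ennreal (norm (p (fst z))) * ennreal (norm (q (snd z)))"
      by (simp add: ennreal_mult'[symmetric] ennreal_leI)
  qed
  also have "\<dots> = (\<integral>\<^sup>+x. \<integral>\<^sup>+y. ennreal (norm (p x)) * ennreal (norm (q y)) \<partial>lborel \<partial>lborel)"
    using lborel.nn_integral_fst[of "\<lambda>z. ennreal (norm (p (fst z))) * ennreal (norm (q (snd z)))" lborel] by simp
  also have "\<dots> = (\<integral>\<^sup>+x. ennreal (norm (p x)) \<partial>lborel) * (\<integral>\<^sup>+y. ennreal (norm (q y)) \<partial>lborel)"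
    by (simp add: nn_integral_cmult nn_integral_multc)
  also have "\<dots> < \<infinity>"
    using p q by (simp add: integrable_iff_bounded ennreal_mult_less_top)
  finally show "(\<integral>\<^sup>+z. norm (F z) \<partial>(lborel \<Otimes>\<^sub>M lborel)) < \<infinity>" .
qed

lemma integral_lebesgue_lborel:
  fixes f :: "real \<Rightarrow> 'b::{banach, second_countable_topology}"
  assumes "f \<in> borel_measurable borel"
  shows "(LINT x|lebesgue. f x) = (LINT x|lborel. f x)"
  using assms by (simp add: integral_completion)

text \<open>In an elementary wave, the function of time at the position y is translate (rho y) u;
  its trace at time 0 is then x -> u (rho x). As u is only a class of functions, E is the bounded
  extension of this composition from test functions. The bound 2 leaves room for maps rho that cover
  a half-line twice.\<close>

definition composes :: "(L2 \<Rightarrow> L2) \<Rightarrow> (real \<Rightarrow> real) \<Rightarrow> bool"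
  where "composes E \<rho> \<longleftrightarrow> bounded_linear E \<and> (\<forall>u. norm (E u) \<le> 2 * norm u) \<and> continuous_on UNIV \<rho> \<and>
    (\<forall>f. is_test f \<longrightarrow> square_integrable (\<lambda>x. f (\<rho> x)) \<and> E (abs_L2 f) = abs_L2 (\<lambda>x. f (\<rho> x)))"

lemma composes_id: "composes (\<lambda>u. u) (\<lambda>x. x)"
  by (simp add: composes_def test_square_integrable bounded_linear_ident)

lemma composes_reflect: "composes reflect uminus"
  by (auto simp: composes_def test_square_integrable bounded_linear_reflect reflect_abs square_integrable_reflect
      intro: continuous_intros)

text \<open>Trace at time 0 of the retarded wave emitted at z, that is, composition with x -> - |x -
  z|. The branch x < z is a translation and the branch x > z a reflected one, each of the values at
  negative times.\<close>

definition retarded_trace :: "real \<Rightarrow> L2 \<Rightarrow> L2"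
  where "retarded_trace z u = translate (- z) (chi u) + reflect (translate z (chi u))"

lemma bounded_clinear_add:
  assumes "bounded_clinear f" "bounded_clinear g"
  shows "bounded_clinear (\<lambda>x. f x + g x)"
  using assms by (auto simp: bounded_clinear_def scaleC_add_right intro: bounded_linear_add)

lemma bounded_clinear_retarded_trace: "bounded_clinear (retarded_trace z)"
  unfolding retarded_trace_def[abs_def]
  by (rule bounded_clinear_add[OF bounded_clinear_compose[OF bounded_clinear_translate bounded_clinear_chi]
        bounded_clinear_compose[OF bounded_clinear_reflect bounded_clinear_compose[OF bounded_clinear_translate bounded_clinear_chi]]])

lemma norm_retarded_trace_le: "norm (retarded_trace z u) \<le> 2 * norm u"
  unfolding retarded_trace_def
  using norm_triangle_ineq[of "translate (- z) (chi u)" "reflect (translate z (chi u))"] norm_chi_le[of u] by simp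

lemma composes_retarded_trace: "composes (retarded_trace z) (\<lambda>x. - \<bar>x - z\<bar>)"
  unfolding composes_def
proof (intro conjI allI impI)
  show "bounded_linear (retarded_trace z)" by (rule bounded_clinear_imp[OF bounded_clinear_retarded_trace])
  show "norm (retarded_trace z u) \<le> 2 * norm u" for u by (rule norm_retarded_trace_le)
  show "continuous_on UNIV (\<lambda>x. - \<bar>x - z\<bar>)" by (intro continuous_intros)
  fix f assume f: "is_test f"
  have sf: "square_integrable f" using f by (rule test_square_integrable)
  let ?g = "\<lambda>x. indicator {..<0} (x - z) * f (x - z)" and ?h = "\<lambda>x. indicator {..<0} (- x + z) * f (- x + z)"
  have sg: "square_integrable ?g" "square_integrable ?h"
    using square_integrable_translate[OF square_integrable_indicator_mult[OF sf], of "{..<0}" "-z"]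
      square_integrable_reflect[OF square_integrable_translate[OF square_integrable_indicator_mult[OF sf], of "{..<0}" "z"]]
    by simp_all
  \<comment> \<open>Exactly one of the two branches is active except at x = z.\<close>
  have eq: "AE x in lebesgue. ?g x + ?h x = f (- \<bar>x - z\<bar>)"
    using AE_lebesgue_neq[of z] by eventually_elim (auto simp: indicator_def abs_if)
  have "continuous_on UNIV (\<lambda>x. f (- \<bar>x - z\<bar>))"
    by (rule continuous_on_compose2[of UNIV f, OF _ continuous_on_minus[OF continuous_on_rabs[OF continuous_on_diff[OF continuous_on_id continuous_on_const]]]])
      (use f smooth_continuous in auto)
  then have m: "(\<lambda>x. f (- \<bar>x - z\<bar>)) \<in> borel_measurable lebesgue" by (rule borel_measurable_lebesgue_continuous)
  have sgh: "square_integrable (\<lambda>x. ?g x + ?h x)" by (rule square_integrable_add[OF sg])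
  show s: "square_integrable (\<lambda>x. f (- \<bar>x - z\<bar>))"
    unfolding square_integrable_def
  proof (rule conjI[OF m integrable_cong_AE_imp[OF square_integrableD(2)[OF sgh]]])
    show "(\<lambda>x. (cmod (f (- \<bar>x - z\<bar>)))\<^sup>2) \<in> borel_measurable lebesgue" using m by measurable
    show "AE x in lebesgue. (cmod (?g x + ?h x))\<^sup>2 = (cmod (f (- \<bar>x - z\<bar>)))\<^sup>2"
      using eq by eventually_elim simp
  qed
  have "retarded_trace z (abs_L2 f) = abs_L2 ?g + abs_L2 ?h"
    using sf by (simp add: retarded_trace_def chi_abs translate_abs reflect_abs square_integrable_indicator_mult
      square_integrable_translate[OF square_integrable_indicator_mult])
  also have "\<dots> = abs_L2 (\<lambda>x. f (- \<bar>x - z\<bar>))"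
    unfolding abs_L2_arith(1)[OF sg] using abs_L2_eq_iff[OF sgh s] eq by blast
  finally show "retarded_trace z (abs_L2 f) = abs_L2 (\<lambda>x. f (- \<bar>x - z\<bar>))" .
qed

context damping
begin

lemma a_Linf: "in_Linf a"
  using a_bounded measurable_completion[of a lborel borel] by (auto simp: in_Linf_def)

lemma norm_mult_a_le: "norm (Linf_mult a u) \<le> C * norm u"
  by (rule norm_Linf_mult_le[OF a_Linf]) (use a_bounded order_trans[OF norm_ge_zero a_bounded] in auto)

lemma C_nonneg: "0 \<le> C"
  by (rule order_trans[OF norm_ge_zero a_bounded])

text \<open>First component of \<open>scatter\<close> applied to the slab of the shifted function h.
  The second component is obtained from it by reflecting the line.\<close>

definition slab_sum :: "real \<Rightarrow> (real \<Rightarrow> L2) \<Rightarrow> L2"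
  where "slab_sum r h = damp (\<lambda>y. translate (- y) (slab r (translate r (h y))))"

lemma bounded_continuous_slab:
  assumes "bounded_continuous h"
  shows "bounded_continuous (\<lambda>y. translate (- y) (slab r (translate r (h y))))"
  by (rule bounded_continuous_translates(1)[OF bounded_continuous_linear[OF bounded_continuous_translate[OF assms continuous_on_const] bounded_linear_slab]])

lemma norm_slab_term_le: "norm (translate (- y) (slab r (translate r u))) \<le> norm u"
  using norm_slab_le[of r "translate r u"] by simp

lemma bounded_linear_slab_sum:
  assumes "continuous_on UNIV \<rho>"
  shows "bounded_linear (\<lambda>u. slab_sum r (\<lambda>y. translate (\<rho> y) u))"
proof (rule bounded_linear_intro)
  have bc: "bounded_continuous (\<lambda>y. translate (- y) (slab r (translate r (translate (\<rho> y) u))))" for u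
    by (rule bounded_continuous_slab[OF bounded_continuous_translate[OF bounded_continuous_const assms]])
  show "slab_sum r (\<lambda>y. translate (\<rho> y) (u + v)) = slab_sum r (\<lambda>y. translate (\<rho> y) u) + slab_sum r (\<lambda>y. translate (\<rho> y) v)" for u v
    unfolding slab_sum_def damp_add[OF bc bc, symmetric] by (simp add: linear_simps[OF bounded_linear_slab])
  show "slab_sum r (\<lambda>y. translate (\<rho> y) (c *\<^sub>R u)) = c *\<^sub>R slab_sum r (\<lambda>y. translate (\<rho> y) u)" for c u
    using damp_scaleC[OF bc, of "of_real c" u]
    by (simp add: slab_sum_def scaleC_of_real translate_simps linear_simps[OF bounded_linear_slab])
  show "norm (slab_sum r (\<lambda>y. translate (\<rho> y) u)) \<le> norm u * L1" for u
    unfolding slab_sum_def mult.commute[of _ L1]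
    by (rule norm_damp_le[OF bc]) (rule order_trans[OF norm_slab_term_le], simp)
qed

text \<open>The integrand of Duhamel's formula: a free shift by s, the damping applied to the trace
  at time 0, and a free shift by the remaining r - s.\<close>

definition duhamel :: "(L2 \<Rightarrow> L2) \<Rightarrow> real \<Rightarrow> real \<Rightarrow> L2 \<Rightarrow> L2"
  where "duhamel E r s u = translate (r - s) (Linf_mult a (E (translate s u)))"

lemma bounded_linear_duhamel:
  assumes "composes E \<rho>"
  shows "bounded_linear (duhamel E r s)"
  unfolding duhamel_def[abs_def] using assms
  by (auto simp: composes_def intro!: bounded_linear_compose[OF bounded_linear_translate]
      bounded_linear_compose[OF bounded_linear_Linf_mult[OF a_Linf]] bounded_linear_compose[of E] bounded_linear_translate)

lemma norm_duhamel_le: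
  assumes "composes E \<rho>"
  shows "norm (duhamel E r s u) \<le> 2 * C * norm u"
proof -
  have "norm (duhamel E r s u) \<le> C * norm (E (translate s u))"
    by (simp add: duhamel_def norm_mult_a_le)
  also have "norm (E (translate s u)) \<le> 2 * norm u"
    using assms unfolding composes_def by (metis norm_translate)
  then have "C * norm (E (translate s u)) \<le> C * (2 * norm u)"
    using C_nonneg by (rule mult_left_mono)
  finally show ?thesis by simp
qed

lemma duhamel_continuous:
  assumes "composes E \<rho>"
  shows "continuous_on UNIV (\<lambda>p. duhamel E (fst p) (snd p) u)"
  unfolding duhamel_def
proof (rule continuous_on_translate)
  show "continuous_on UNIV (\<lambda>p. Linf_mult a (E (translate (snd p) u)))"
    using assms by (intro bounded_linear.continuous_on[OF bounded_linear_Linf_mult[OF a_Linf]] bounded_linear.continuous_on[of E]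
        continuous_on_translate continuous_intros) (auto simp: composes_def)
qed (intro continuous_intros)

lemma duhamel_set_integrable:
  assumes "composes E \<rho>"
  shows "set_integrable lborel {0..r} (\<lambda>s. duhamel E r s u)"
proof (rule set_integrable_continuous)
  show "continuous_on {0..r} (\<lambda>s. duhamel E r s u)"
    using continuous_on_compose2[OF duhamel_continuous[OF assms, of u] continuous_on_Pair[OF continuous_on_const[of _ r] continuous_on_id], of "{0..r}"]
    by simp
qed

lemma norm_duhamel_integral_le:
  assumes "composes E \<rho>" "r \<ge> 0"
  shows "norm (LINT s:{0..r}|lborel. duhamel E r s u) \<le> norm u * (2 * C * r)"
proof -
  have "norm (LINT s:{0..r}|lborel. duhamel E r s u) \<le> (LINT s:{0..r}|lborel. norm (duhamel E r s u))"
    by (rule set_integral_norm_bound[OF duhamel_set_integrable[OF assms(1)]])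
  also have "\<dots> \<le> (LINT s:{0..r}|lborel. 2 * C * norm u)"
  proof (rule set_integral_mono)
    show "set_integrable lborel {0..r} (\<lambda>s. norm (duhamel E r s u))"
      by (rule set_integrable_norm[OF duhamel_set_integrable[OF assms(1)]])
    show "set_integrable lborel {0..r} (\<lambda>s. 2 * C * norm u)"
      by (simp add: set_integrable_def emeasure_lborel_Icc_eq)
  qed (rule norm_duhamel_le[OF assms(1)])
  also have "\<dots> = norm u * (2 * C * r)" using assms(2) by (simp add: set_integral_const)
  finally show ?thesis .
qed

lemma bounded_linear_duhamel_integral:
  assumes E: "composes E \<rho>" and "r \<ge> 0"
  shows "bounded_linear (\<lambda>u. LINT s:{0..r}|lborel. duhamel E r s u)"
proof (rule bounded_linear_intro)
  note lin = linear_simps[OF bounded_linear_duhamel[OF E]]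
  show "(LINT s:{0..r}|lborel. duhamel E r s (u + v)) = (LINT s:{0..r}|lborel. duhamel E r s u) + (LINT s:{0..r}|lborel. duhamel E r s v)" for u v
    unfolding lin(1) by (rule set_integral_add(2)[OF duhamel_set_integrable[OF E] duhamel_set_integrable[OF E]])
  show "(LINT s:{0..r}|lborel. duhamel E r s (c *\<^sub>R u)) = c *\<^sub>R (LINT s:{0..r}|lborel. duhamel E r s u)" for c u
    unfolding lin(5) by (rule set_integral_scaleR_right)
  show "norm (LINT s:{0..r}|lborel. duhamel E r s u) \<le> norm u * (2 * C * r)" for u
    by (rule norm_duhamel_integral_le[OF assms])
qed

text \<open>Paired with a test function g, both sides become double integrals of a (y) f (s + rho y)
  g (s + y - r): the substitution x = s + y - r turns the slab into 0 <= s <= r, and Fubini's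
  theorem exchanges the order.\<close>

lemma slab_sum_test:
  assumes E: "composes E \<rho>" and r: "r > 0" and f: "is_test f"
  shows "slab_sum r (\<lambda>y. translate (\<rho> y) (abs_L2 f)) = (LINT s:{0..r}|lborel. duhamel E r s (abs_L2 f))"
proof (rule pairing_test_eqI)
  interpret pairing: bounded_bilinear pairing by (rule bounded_bilinear_pairing)
  fix \<phi>
  obtain g where g: "is_test g" "\<phi> = Abs_test_function g" by (rule test_cases)
  have \<phi>: "test_to_L2 \<phi> = abs_L2 g" using g by (simp only: test_to_L2_Abs)
  have sf: "square_integrable f" and sg: "square_integrable g"
    by (rule test_square_integrable[OF f], rule test_square_integrable[OF g(1)])
  have cf: "continuous_on UNIV f" and cg: "continuous_on UNIV g"
    using f g smooth_continuous by auto
  have c\<rho>: "continuous_on UNIV \<rho>" using E by (simp add: composes_def)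
  have [measurable]: "f \<in> borel_measurable borel" "g \<in> borel_measurable borel" "\<rho> \<in> borel_measurable borel"
    by (intro borel_measurable_continuous_onI cf cg c\<rho>)+
  have bounded: "\<exists>M\<ge>0. \<forall>x. cmod (h x) \<le> M" if h: "is_test h" for h
  proof -
    obtain R where R: "\<And>x. x \<notin> {-R..R} \<Longrightarrow> h x = 0" by (rule is_test_support[OF h]) blast
    have "compact (h ` {-R..R})"
      using h by (intro compact_continuous_image continuous_on_subset[OF smooth_continuous]) auto
    then obtain B where "\<forall>y\<in>h ` {-R..R}. cmod y \<le> B" using compact_imp_bounded bounded_iff by metis
    then have "cmod (h x) \<le> max B 0" for x
      using R[of x] by (cases "x \<in> {-R..R}") (auto simp: le_max_iff_disj)
    then show ?thesis by (intro exI[of _ "max B 0"]) auto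
  qed
  obtain M where M: "M \<ge> 0" "\<And>x. cmod (f x) \<le> M" using bounded[OF f] by blast
  obtain N where N: "N \<ge> 0" "\<And>x. cmod (g x) \<le> N" using bounded[OF g(1)] by blast
  let ?F = "\<lambda>s y. indicator {0..r} s * (a y * (f (s + \<rho> y) * g (s + y - r)))"
  have L: "pairing (translate (- y) (slab r (translate r (translate (\<rho> y) (abs_L2 f))))) (abs_L2 g)
      = (LINT s|lborel. indicator {0..r} s * (f (s + \<rho> y) * g (s + y - r)))" for y
  proof -
    have sq: "square_integrable (\<lambda>x. indicator {-r..0} x * f (x + (r + \<rho> y)))"
      by (rule square_integrable_indicator_mult[OF square_integrable_translate[OF sf]]) simp
    have "pairing (translate (- y) (slab r (translate r (translate (\<rho> y) (abs_L2 f))))) (abs_L2 g)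
      = (LINT x|lebesgue. indicator {-r..0} (x - y) * f (x - y + (r + \<rho> y)) * g x)"
      using square_integrable_translate[OF sq, of "-y"]
      unfolding translate_translate
      by (simp only: translate_abs[OF sf] slab_abs[OF square_integrable_translate[OF sf]]
          translate_abs[OF sq] pairing_abs[OF square_integrable_translate[OF sq] sg] diff_conv_add_uminus)
    also have "\<dots> = (LINT s|lebesgue. indicator {-r..0} (s - r) * f (s + \<rho> y) * g (s + y - r))"
      by (subst lebesgue_integral_real_affine[of 1 _ "y - r"]) (simp_all add: algebra_simps)
    also have "\<dots> = (LINT s|lborel. indicator {-r..0} (s - r) * f (s + \<rho> y) * g (s + y - r))"
      by (rule integral_lebesgue_lborel) measurable
    also have "\<dots> = (LINT s|lborel. indicator {0..r} s * (f (s + \<rho> y) * g (s + y - r)))"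
      by (rule Bochner_Integration.integral_cong) (auto simp: indicator_def)
    finally show ?thesis .
  qed
  have R: "pairing (duhamel E r s (abs_L2 f)) (abs_L2 g) = (LINT y|lborel. a y * (f (s + \<rho> y) * g (s + y - r)))" for s
  proof -
    have t: "is_test (\<lambda>x. f (x + s))" by (rule is_test_translate[OF f])
    have sq: "square_integrable (\<lambda>x. f (\<rho> x + s))" and Eeq: "E (abs_L2 (\<lambda>x. f (x + s))) = abs_L2 (\<lambda>x. f (\<rho> x + s))"
      using E t unfolding composes_def by blast+
    have sq2: "square_integrable (\<lambda>x. a x * f (\<rho> x + s))" by (rule square_integrable_mult_bounded[OF a_Linf sq])
    have "pairing (duhamel E r s (abs_L2 f)) (abs_L2 g)
       = (LINT x|lebesgue. a (x + (r - s)) * f (\<rho> (x + (r - s)) + s) * g x)"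
      by (simp add: duhamel_def translate_abs[OF sf] Eeq Linf_mult_abs[OF sq a_Linf] translate_abs[OF sq2]
        pairing_abs[OF square_integrable_translate[OF sq2] sg])
    also have "\<dots> = (LINT y|lebesgue. a y * (f (s + \<rho> y) * g (s + y - r)))"
      by (subst lebesgue_integral_real_affine[of 1 _ "s - r"]) (simp_all add: algebra_simps)
    also have "\<dots> = (LINT y|lborel. a y * (f (s + \<rho> y) * g (s + y - r)))"
      by (rule integral_lebesgue_lborel) measurable
    finally show ?thesis .
  qed
  have bc: "bounded_continuous (\<lambda>y. translate (- y) (slab r (translate r (translate (\<rho> y) (abs_L2 f)))))"
    by (rule bounded_continuous_slab[OF bounded_continuous_translate[OF bounded_continuous_const c\<rho>]])
  have "integrable (lborel \<Otimes>\<^sub>M lborel) (\<lambda>(s, y). ?F s y)"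
  proof (rule integrable_pair_bound[where p = "\<lambda>s. indicator {0..r} s" and q = "\<lambda>y. cmod (a y) * (M * N)"])
    show "(\<lambda>(s, y). ?F s y) \<in> borel_measurable (lborel \<Otimes>\<^sub>M lborel)" by measurable
    show "integrable lborel (\<lambda>y. cmod (a y) * (M * N))"
      by (rule integrable_mult_left[OF integrable_norm[OF a_integrable]])
    show "norm (case (s, y) of (s, y) \<Rightarrow> ?F s y) \<le> norm (indicator {0..r} s :: real) * norm (cmod (a y) * (M * N))" for s y
      using M(1) N(1) mult_mono[OF M(2)[of "s + \<rho> y"] N(2)[of "s + y - r"] M(1) norm_ge_zero]
      by (auto simp: norm_mult indicator_def abs_mult intro: mult_left_mono)
  qed (auto simp: emeasure_lborel_Icc_eq)
  note fub = lborel_pair.Fubini_integral[OF this]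
  have "pairing (slab_sum r (\<lambda>y. translate (\<rho> y) (abs_L2 f))) (abs_L2 g)
    = (LINT y|lborel. pairing (a y *\<^sub>C translate (- y) (slab r (translate r (translate (\<rho> y) (abs_L2 f))))) (abs_L2 g))"
    unfolding slab_sum_def damp_def
    by (rule integral_bounded_linear[OF pairing.bounded_linear_left damp_integrable[OF bc], symmetric])
  also have "\<dots> = (LINT y|lborel. LINT s|lborel. ?F s y)"
    unfolding pairing_scaleC_left L integral_mult_right_zero[symmetric]
    by (simp only: mult.left_commute[of "a _"])
  also have "\<dots> = (LINT s|lborel. LINT y|lborel. ?F s y)" by (rule fub)
  also have "\<dots> = (LINT s|lborel. pairing (indicator {0..r} s *\<^sub>R duhamel E r s (abs_L2 f)) (abs_L2 g))"
    unfolding pairing.scaleR_left R by (rule Bochner_Integration.integral_cong) (auto simp: indicator_def)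
  also have "\<dots> = pairing (LINT s:{0..r}|lborel. duhamel E r s (abs_L2 f)) (abs_L2 g)"
    unfolding set_lebesgue_integral_def
    by (rule integral_bounded_linear[OF pairing.bounded_linear_left duhamel_set_integrable[OF E, unfolded set_integrable_def]])
  finally show "pairing (slab_sum r (\<lambda>y. translate (\<rho> y) (abs_L2 f))) (test_to_L2 \<phi>)
    = pairing (LINT s:{0..r}|lborel. duhamel E r s (abs_L2 f)) (test_to_L2 \<phi>)"
    unfolding \<phi> .
qed

lemma slab_sum_eq_duhamel:
  assumes "composes E \<rho>" "r > 0"
  shows "slab_sum r (\<lambda>y. translate (\<rho> y) u) = (LINT s:{0..r}|lborel. duhamel E r s u)"
proof (rule bounded_linear_eq_on_test[where f = "\<lambda>u. slab_sum r (\<lambda>y. translate (\<rho> y) u)"])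
  show "bounded_linear (\<lambda>u. slab_sum r (\<lambda>y. translate (\<rho> y) u))"
    using assms(1) by (intro bounded_linear_slab_sum) (simp add: composes_def)
  show "bounded_linear (\<lambda>u. LINT s:{0..r}|lborel. duhamel E r s u)"
    using assms by (intro bounded_linear_duhamel_integral[OF assms(1)]) simp
  fix \<phi>
  obtain f where f: "is_test f" "\<phi> = Abs_test_function f" by (rule test_cases)
  show "slab_sum r (\<lambda>y. translate (\<rho> y) (test_to_L2 \<phi>)) = (LINT s:{0..r}|lborel. duhamel E r s (test_to_L2 \<phi>))"
    unfolding f(2) test_to_L2_Abs[OF f(1)] by (rule slab_sum_test[OF assms f(1)])
qed

text \<open>In the Duhamel form, the damping sits between two translations, so their strong
  continuity gives the limit even for a discontinuous damping.\<close>

lemma slab_sum_tendsto: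
  assumes E: "composes E \<rho>"
  shows "((\<lambda>r. slab_sum r (\<lambda>y. translate (\<rho> y) u) /\<^sub>R r) \<longlongrightarrow> Linf_mult a (E u)) (at_right 0)"
proof -
  have "((\<lambda>r. (LINT s:{0..r}|lborel. duhamel E r s u) /\<^sub>R r) \<longlongrightarrow> Linf_mult a (E u)) (at_right 0)"
  proof (rule average_tendsto[OF duhamel_set_integrable[OF E]])
    fix e :: real assume "e > 0"
    have "((\<lambda>p. duhamel E (fst p) (snd p) u) \<longlongrightarrow> duhamel E 0 0 u) (at (0, 0))"
      using duhamel_continuous[OF E, of u] by (simp add: continuous_on_def)
    then obtain d where d: "d > 0" "\<And>p. p \<noteq> (0, 0) \<Longrightarrow> dist p (0, 0) < d \<Longrightarrow> dist (duhamel E (fst p) (snd p) u) (duhamel E 0 0 u) < e"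
      using \<open>e > 0\<close> unfolding tendsto_iff eventually_at by auto
    have D0: "duhamel E 0 0 u = Linf_mult a (E u)" by (simp add: duhamel_def)
    show "\<exists>d>0. \<forall>r s. 0 \<le> s \<and> s \<le> r \<and> r < d \<longrightarrow> norm (duhamel E r s u - Linf_mult a (E u)) \<le> e"
    \<comment> \<open>Since s <= r, the distance from (r, s) to the origin is at most 2 r.\<close>
    proof (intro exI[of _ "d/2"] conjI allI impI)
      fix r s :: real assume rs: "0 \<le> s \<and> s \<le> r \<and> r < d / 2"
      show "norm (duhamel E r s u - Linf_mult a (E u)) \<le> e"
      proof (cases "(r, s) = (0, 0)")
        case True then show ?thesis using D0 \<open>e > 0\<close> by simp
      next
        case False
        have "dist (r, s) (0, 0) \<le> \<bar>r\<bar> + \<bar>s\<bar>"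
          unfolding dist_Pair_Pair using sqrt_sum_squares_le_sum_abs[of r s] by simp
        then have "dist (r, s) (0, 0) < d" using rs by auto
        then show ?thesis using d(2)[OF False] D0 by (simp add: dist_norm less_imp_le)
      qed
    qed (use d in auto)
  qed
  then show ?thesis
    by (rule Lim_transform_eventually)
      (auto simp: eventually_at_right_field slab_sum_eq_duhamel[OF E] intro!: exI[of _ 1])
qed

end

section \<open>Intertwining of the evolutions\<close>

definition evolve :: "real \<Rightarrow> L2 \<times> L2 \<Rightarrow> L2 \<times> L2"
  where "evolve r u = (translate r (fst u), translate r (snd u))"

text \<open>The component \<open>\<psi>\<^sub>2\<close> in the coordinates \<open>f = \<nabla>\<psi>\<^sub>1 + \<psi>\<^sub>2\<close>, \<open>g(x) = (\<nabla>\<psi>\<^sub>1 - \<psi>\<^sub>2)(-x)\<close>.\<close>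

definition velocity :: "L2 \<times> L2 \<Rightarrow> L2"
  where "velocity u = (1/2) *\<^sub>R (fst u - reflect (snd u))"

context damping
begin

lemma damp_damp_swap:
  assumes "continuous_on UNIV (\<lambda>p. h (fst p) (snd p))" "\<And>y z. norm (h y z) \<le> B"
  shows "damp (\<lambda>y. damp (\<lambda>z. h y z)) = damp (\<lambda>z. damp (\<lambda>y. h y z))"
proof -
  have bc: "bounded_continuous (\<lambda>z. h y z)" "bounded_continuous (\<lambda>z. h z y)" for y
    using continuous_on_compose2[OF assms(1) continuous_on_Pair[OF continuous_on_const[of _ y] continuous_on_id]]
      continuous_on_compose2[OF assms(1) continuous_on_Pair[OF continuous_on_id continuous_on_const[of _ y]]] assms(2)
    by (auto intro!: bounded_continuousI)
  have hm: "(\<lambda>p. h (fst p) (snd p)) \<in> borel_measurable borel"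
    using assms(1) by (rule borel_measurable_continuous_onI)
  have hm2: "(\<lambda>p. h (fst p) (snd p)) \<in> borel_measurable (lborel \<Otimes>\<^sub>M lborel)"
    using hm by (simp add: borel_prod[symmetric] cong: measurable_cong_sets)
  have am: "(\<lambda>p. a (fst p) * a (snd p)) \<in> borel_measurable (lborel \<Otimes>\<^sub>M lborel)" by measurable
  have cont: "continuous_on UNIV (\<lambda>p. fst p *\<^sub>C (snd p :: L2))"
    by (rule bounded_bilinear.continuous_on[OF bounded_bilinear_scaleC]) (simp_all add: continuous_on_fst continuous_on_snd)
  have m: "(\<lambda>p. (a (fst p) * a (snd p)) *\<^sub>C h (fst p) (snd p)) \<in> borel_measurable (lborel \<Otimes>\<^sub>M lborel)"
    by (rule borel_measurable_continuous_Pair[OF am hm2 cont])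
  have "integrable (lborel \<Otimes>\<^sub>M lborel) (\<lambda>p. (a (fst p) * a (snd p)) *\<^sub>C h (fst p) (snd p))"
  proof (rule integrable_pair_bound[OF m, where p = "\<lambda>y. cmod (a y)" and q = "\<lambda>z. cmod (a z) * B"])
    show "integrable lborel (\<lambda>y. cmod (a y))" "integrable lborel (\<lambda>z. cmod (a z) * B)"
      by (rule integrable_norm[OF a_integrable], rule integrable_mult_left[OF integrable_norm[OF a_integrable]])
    have "0 \<le> B" using assms(2) norm_ge_zero order_trans by blast
    then show "norm ((a (fst (y, z)) * a (snd (y, z))) *\<^sub>C h (fst (y, z)) (snd (y, z)))
        \<le> norm (cmod (a y)) * norm (cmod (a z) * B)" for y z
      using assms(2)[of y z] by (simp add: norm_scaleC norm_mult mult_left_mono abs_mult mult.assoc)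
  qed
  then have "integrable (lborel \<Otimes>\<^sub>M lborel) (\<lambda>(y, z). a y *\<^sub>C a z *\<^sub>C h y z)"
    by (simp add: scaleC_scaleC case_prod_beta')
  from lborel_pair.Fubini_integral[OF this]
  have "(LINT z|lborel. LINT y|lborel. a y *\<^sub>C a z *\<^sub>C h y z) = (LINT y|lborel. LINT z|lborel. a y *\<^sub>C a z *\<^sub>C h y z)" .
  moreover have "(LINT z|lborel. a y *\<^sub>C a z *\<^sub>C h y z) = a y *\<^sub>C damp (\<lambda>z. h y z)" for y
    unfolding damp_def
    by (rule integral_bounded_linear[OF bounded_linear_scaleC damp_integrable[OF bc(1)]])
  moreover have "(LINT y|lborel. a y *\<^sub>C a z *\<^sub>C h y z) = a z *\<^sub>C damp (\<lambda>y. h y z)" for z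
  proof -
    have "a y *\<^sub>C a z *\<^sub>C h y z = a z *\<^sub>C a y *\<^sub>C h y z" for y
      by (simp add: scaleC_scaleC mult.commute)
    then show ?thesis
      unfolding damp_def
      by (simp only:) (rule integral_bounded_linear[OF bounded_linear_scaleC damp_integrable[OF bc(2)]])
  qed
  ultimately show ?thesis by (simp add: damp_def)
qed

text \<open>The damping does not depend on time, so shifting a solution in time gives the solution
  for the shifted data.\<close>

lemma solution_evolve: "solution (evolve r u) x = translate r (solution u x)"
proof (rule solution_unique[symmetric])
  show "bounded_continuous (\<lambda>x. translate r (solution u x))"
    by (rule bounded_continuous_linear[OF solution_bounded_continuous bounded_linear_translate])
  fix x
  have bc: "bounded_continuous (\<lambda>y. retarded x y (solution u y))"
    by (rule bounded_continuous_kernel[OF kernel_retarded solution_bounded_continuous])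
  have "retarded x y (translate r (solution u y)) = translate r (retarded x y (solution u y))" for y
    by (simp add: add.commute)
  then have "damp (\<lambda>y. retarded x y (translate r (solution u y))) = translate r (damp (\<lambda>y. retarded x y (solution u y)))"
    using damp_clinear[OF bounded_clinear_translate bc] by presburger
  moreover have "incoming (evolve r u) x = translate r (incoming u x)"
    by (simp add: incoming_def evolve_def translate_simps add.commute)
  ultimately show "translate r (solution u x)
    = incoming (evolve r u) x + (- 1/2) *\<^sub>R damp (\<lambda>y. retarded x y (translate r (solution u y)))"
    by (simp only:) (subst solution_eq, simp add: translate_simps)
qed

lemma evolve_scatter:
  assumes "bounded_continuous w"
  shows "evolve r (scatter w) = scatter (\<lambda>y. translate r (w y))"
proof -
  have "translate r (damp (\<lambda>y. translate (- y) (w y))) = damp (\<lambda>y. translate (- y) (translate r (w y)))"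
    "translate r (damp (\<lambda>y. translate y (w y))) = damp (\<lambda>y. translate y (translate r (w y)))"
    using damp_clinear[OF bounded_clinear_translate bounded_continuous_translates(1)[OF assms], of r]
      damp_clinear[OF bounded_clinear_translate bounded_continuous_translates(2)[OF assms], of r]
    by (simp_all add: add.commute)
  then show ?thesis by (simp add: evolve_def scatter_def translate_simps)
qed

lemma scatter_diff:
  assumes "bounded_continuous v" "bounded_continuous w"
  shows "scatter (\<lambda>y. v y - w y) = scatter v - scatter w"
  by (simp add: scatter_def translate_simps damp_diff bounded_continuous_translates assms)

text \<open>Every ingredient of \<open>wave_op\<close> commutes with time translations except the
  cutoff at time 0, whose commutator is the slab.\<close>

lemma wave_op_commutator:
  assumes "r \<ge> 0"
  shows "wave_op (evolve r u) - evolve r (wave_op u) = - scatter (\<lambda>y. slab r (translate r (solution u y)))"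
proof -
  have bc: "bounded_continuous (\<lambda>y. chi (translate r (solution u y)))" "bounded_continuous (\<lambda>y. translate r (chi (solution u y)))"
    by (rule bounded_continuous_linear[OF bounded_continuous_linear[OF solution_bounded_continuous bounded_linear_translate] bounded_linear_chi],
        rule bounded_continuous_linear[OF bounded_continuous_chi_solution bounded_linear_translate])
  have "evolve r (wave_op u) = evolve r u - evolve r (scatter (\<lambda>y. chi (solution u y)))"
    by (simp add: wave_op_def evolve_def translate_simps)
  then show ?thesis
    by (simp add: wave_op_def solution_evolve evolve_scatter[OF bounded_continuous_chi_solution] scatter_diff[OF bc]
        flip: chi_translate_commutator[OF assms])
qed

lemma slab_sum_add:
  assumes "bounded_continuous g" "bounded_continuous h"
  shows "slab_sum r (\<lambda>y. g y + h y) = slab_sum r g + slab_sum r h"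
  unfolding slab_sum_def by (simp add: linear_simps[OF bounded_linear_slab] damp_add bounded_continuous_slab assms)

lemma slab_sum_scaleR:
  assumes "bounded_continuous h"
  shows "slab_sum r (\<lambda>y. c *\<^sub>R h y) = c *\<^sub>R slab_sum r h"
  using damp_scaleC[OF bounded_continuous_slab[OF assms], of "of_real c"]
  by (simp add: slab_sum_def linear_simps[OF bounded_linear_slab] translate_simps scaleC_of_real)

text \<open>Exhibits the scattered part as a superposition, over the emission point z, of elementary
  waves to which \<open>slab_sum_tendsto\<close> applies.\<close>

lemma slab_sum_retarded:
  assumes w: "bounded_continuous w"
  shows "slab_sum r (\<lambda>y. damp (\<lambda>z. retarded y z (w z))) = damp (\<lambda>z. slab_sum r (\<lambda>y. translate (- \<bar>y - z\<bar>) (w z)))"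
proof -
  obtain B where B: "\<And>z. norm (w z) \<le> B" using w unfolding bounded_continuous_def by blast
  have bl: "bounded_clinear (\<lambda>u. translate (- y) (slab r (translate r u)))" for y
    by (rule bounded_clinear_compose[OF bounded_clinear_translate bounded_clinear_compose[OF bounded_clinear_slab bounded_clinear_translate]])
  have "slab_sum r (\<lambda>y. damp (\<lambda>z. retarded y z (w z)))
      = damp (\<lambda>y. damp (\<lambda>z. translate (- y) (slab r (translate r (retarded y z (w z))))))"
    unfolding slab_sum_def damp_clinear[OF bl bounded_continuous_kernel[OF kernel_retarded w]] ..
  also have "\<dots> = damp (\<lambda>z. damp (\<lambda>y. translate (- y) (slab r (translate r (retarded y z (w z))))))"
  proof (rule damp_damp_swap[where B = B])
    have cw: "continuous_on UNIV (\<lambda>p. w (snd p))" for p :: "real \<times> real"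
      by (rule continuous_on_compose2[OF bounded_continuousD[OF w] continuous_on_snd[OF continuous_on_id]]) simp
    show "continuous_on UNIV (\<lambda>p. translate (- fst p) (slab r (translate r (translate (- \<bar>fst p - snd p\<bar>) (w (snd p))))))"
      by (rule continuous_on_translate[OF _ bounded_linear.continuous_on[OF bounded_linear_slab
          bounded_linear.continuous_on[OF bounded_linear_translate continuous_on_translate[OF _ cw]]]])
        (intro continuous_intros)+
    show "norm (translate (- y) (slab r (translate r (translate (- \<bar>y - z\<bar>) (w z))))) \<le> B" for y z
      by (rule order_trans[OF norm_slab_term_le]) (simp add: B)
  qed
  finally show ?thesis by (simp add: slab_sum_def)
qed

text \<open>The bound is uniform in r; it dominates the superposition over z in the limit r ->
  0.\<close>

lemma norm_slab_sum_le:
  assumes "composes E \<rho>" "r > 0"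
  shows "norm (slab_sum r (\<lambda>y. translate (\<rho> y) u) /\<^sub>R r) \<le> 2 * C * norm u"
proof -
  have "norm (slab_sum r (\<lambda>y. translate (\<rho> y) u)) \<le> norm u * (2 * C * r)"
    unfolding slab_sum_eq_duhamel[OF assms] using assms by (intro norm_duhamel_integral_le) auto
  then show ?thesis using assms(2) by (simp add: field_simps)
qed

lemma retarded_trace_continuous:
  assumes "continuous_on UNIV w"
  shows "continuous_on UNIV (\<lambda>z. retarded_trace z (w z))"
  unfolding retarded_trace_def
  by (intro continuous_on_add continuous_on_translate bounded_linear.continuous_on[OF bounded_linear_reflect]
      bounded_linear.continuous_on[OF bounded_linear_chi] assms continuous_on_minus continuous_on_id)

lemma slab_sum_retarded_tendsto:
  assumes w: "bounded_continuous w"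
  shows "((\<lambda>r. slab_sum r (\<lambda>y. damp (\<lambda>z. retarded y z (w z))) /\<^sub>R r)
    \<longlongrightarrow> Linf_mult a (damp (\<lambda>z. retarded_trace z (w z)))) (at_right 0)"
proof -
  obtain B where B: "\<And>z. norm (w z) \<le> B" using w unfolding bounded_continuous_def by blast
  have bct: "bounded_continuous (\<lambda>z. retarded_trace z (w z))"
    by (rule bounded_continuousI[OF retarded_trace_continuous[OF bounded_continuousD[OF w]], of "2 * B"])
      (use norm_retarded_trace_le B in \<open>smt (verit)\<close>)
  have bc: "bounded_continuous (\<lambda>z. slab_sum r (\<lambda>y. translate (- \<bar>y - z\<bar>) (w z)))" for r
    unfolding slab_sum_def
  proof (rule bounded_continuous_damp[where B = B])
    show "continuous_on UNIV (\<lambda>z. translate (- y) (slab r (translate r (translate (- \<bar>y - z\<bar>) (w z)))))" for y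
      by (rule bounded_linear.continuous_on[OF bounded_linear_translate bounded_linear.continuous_on[OF bounded_linear_slab
          bounded_linear.continuous_on[OF bounded_linear_translate continuous_on_translate[OF _ bounded_continuousD[OF w]]]]])
        (intro continuous_intros)
    show "continuous_on UNIV (\<lambda>y. translate (- y) (slab r (translate r (translate (- \<bar>y - z\<bar>) (w z)))))" for z
      by (rule bounded_continuousD[OF bounded_continuous_slab[OF bounded_continuous_translate[OF bounded_continuous_const]]])
        (intro continuous_intros)
    show "norm (translate (- y) (slab r (translate r (translate (- \<bar>y - z\<bar>) (w z))))) \<le> B" for y z
      by (rule order_trans[OF norm_slab_term_le]) (simp add: B)
  qed
  show ?thesis
    unfolding tendsto_at_iff_sequentially o_def
  proof (intro allI impI)
    fix X :: "nat \<Rightarrow> real" assume X: "\<forall>i. X i \<in> {0<..} - {0}" "X \<longlonglongrightarrow> 0"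
    then have pos: "X n > 0" for n by auto
    have Xf: "filterlim X (at_right 0) sequentially"
      using X less_imp_neq[OF pos, symmetric] pos by (auto simp: filterlim_at)
    let ?S = "\<lambda>n z. slab_sum (X n) (\<lambda>y. translate (- \<bar>y - z\<bar>) (w z)) /\<^sub>R X n"
    have "(\<lambda>n. LINT z|lborel. a z *\<^sub>C ?S n z) \<longlonglongrightarrow> (LINT z|lborel. a z *\<^sub>C Linf_mult a (retarded_trace z (w z)))"
    proof (rule integral_dominated_convergence[where w = "\<lambda>z. cmod (a z) * (2 * C * B)"])
      show "(\<lambda>z. a z *\<^sub>C Linf_mult a (retarded_trace z (w z))) \<in> borel_measurable lborel"
        by (rule borel_measurable_integrable[OF damp_integrable[OF bounded_continuous_linear[OF bct bounded_linear_Linf_mult[OF a_Linf]]]])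
      show "(\<lambda>z. a z *\<^sub>C ?S n z) \<in> borel_measurable lborel" for n
        by (rule borel_measurable_integrable[OF damp_integrable[OF bounded_continuous_linear[OF bc bounded_linear_scaleR_right]]])
      show "integrable lborel (\<lambda>z. cmod (a z) * (2 * C * B))"
        by (rule integrable_mult_left[OF integrable_norm[OF a_integrable]])
      show "AE z in lborel. norm (a z *\<^sub>C ?S n z) \<le> cmod (a z) * (2 * C * B)" for n
      proof (rule AE_I2)
        fix z
        have "norm (?S n z) \<le> 2 * C * norm (w z)" by (rule norm_slab_sum_le[OF composes_retarded_trace pos])
        also have "\<dots> \<le> 2 * C * B" using B[of z] C_nonneg by (simp add: mult_left_mono)
        finally show "norm (a z *\<^sub>C ?S n z) \<le> cmod (a z) * (2 * C * B)"
          unfolding norm_scaleC by (rule mult_left_mono) simp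
      qed
      show "AE z in lborel. (\<lambda>n. a z *\<^sub>C ?S n z) \<longlonglongrightarrow> a z *\<^sub>C Linf_mult a (retarded_trace z (w z))"
        by (intro AE_I2 bounded_linear.tendsto[OF bounded_linear_scaleC]
            filterlim_compose[OF slab_sum_tendsto[OF composes_retarded_trace] Xf])
    qed
    moreover have "(LINT z|lborel. a z *\<^sub>C ?S n z) = slab_sum (X n) (\<lambda>y. damp (\<lambda>z. retarded y z (w z))) /\<^sub>R X n" for n
      unfolding slab_sum_retarded[OF w]
      using damp_scaleC[OF bc, of "of_real (inverse (X n))" "X n"]
      unfolding scaleC_of_real by (simp only: damp_def)
    moreover have "(LINT z|lborel. a z *\<^sub>C Linf_mult a (retarded_trace z (w z))) = Linf_mult a (damp (\<lambda>z. retarded_trace z (w z)))"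
      using damp_clinear[OF bounded_clinear_Linf_mult[OF a_Linf] bct] by (simp add: damp_def)
    ultimately show "(\<lambda>n. slab_sum (X n) (\<lambda>y. damp (\<lambda>z. retarded y z (w z))) /\<^sub>R X n)
      \<longlonglongrightarrow> Linf_mult a (damp (\<lambda>z. retarded_trace z (w z)))" by simp
  qed
qed

text \<open>This is the retarded equation at time 0 with each term replaced by its trace. It gives a
  meaning to the velocity at time 0, which the solution as a function with values in
  \<open>L2\<close> does not provide.\<close>

lemma velocity_wave_op:
  "velocity (wave_op u) = (1/2) *\<^sub>R fst u + (- 1/2) *\<^sub>R reflect (snd u)
    + (- 1/2) *\<^sub>R damp (\<lambda>z. retarded_trace z (solution u z))"
proof -
  have bc: "bounded_continuous (\<lambda>y. reflect (translate y (chi (solution u y))))"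
    by (rule bounded_continuous_linear[OF bounded_continuous_translates(2)[OF bounded_continuous_chi_solution] bounded_linear_reflect])
  have "reflect (damp (\<lambda>y. translate y (chi (solution u y)))) = damp (\<lambda>y. reflect (translate y (chi (solution u y))))"
    by (rule damp_clinear[OF bounded_clinear_reflect bounded_continuous_translates(2)[OF bounded_continuous_chi_solution], symmetric])
  then have "damp (\<lambda>z. retarded_trace z (solution u z)) =
      damp (\<lambda>y. translate (- y) (chi (solution u y))) + reflect (damp (\<lambda>y. translate y (chi (solution u y))))"
    unfolding retarded_trace_def damp_add[OF bounded_continuous_translates(1)[OF bounded_continuous_chi_solution] bc] by simp
  then show ?thesis
    by (simp add: velocity_def wave_op_def scatter_def reflect_simps algebra_simps)
qed

text \<open>The retarded equation splits the solution into two free elementary waves and the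
  scattered superposition; the traces in their limits add up to
  \<open>velocity_wave_op\<close>.\<close>

lemma slab_sum_solution_tendsto:
  "((\<lambda>r. slab_sum r (solution u) /\<^sub>R r) \<longlongrightarrow> Linf_mult a (velocity (wave_op u))) (at_right 0)"
proof -
  let ?v = "solution u"
  have bc1: "bounded_continuous (\<lambda>y. translate y (fst u))" "bounded_continuous (\<lambda>y. translate (- y) (snd u))"
    by (rule bounded_continuous_translates[OF bounded_continuous_const])+
  have bc2: "bounded_continuous (\<lambda>y. damp (\<lambda>z. retarded y z (?v z)))"
    by (rule bounded_continuous_damp_kernel[OF kernel_retarded solution_bounded_continuous])
  note bcs = bounded_continuous_linear[OF _ bounded_linear_scaleR_right]
  have "?v = (\<lambda>y. ((1/2) *\<^sub>R translate y (fst u) + (- 1/2) *\<^sub>R translate (- y) (snd u))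
      + (- 1/2) *\<^sub>R damp (\<lambda>z. retarded y z (?v z)))"
  proof
    fix y show "?v y = ((1/2) *\<^sub>R translate y (fst u) + (- 1/2) *\<^sub>R translate (- y) (snd u))
      + (- 1/2) *\<^sub>R damp (\<lambda>z. retarded y z (?v z))"
      by (subst solution_eq) (simp add: incoming_def scaleR_diff_right)
  qed
  then have "slab_sum r ?v = slab_sum r (\<lambda>y. ((1/2) *\<^sub>R translate y (fst u) + (- 1/2) *\<^sub>R translate (- y) (snd u))
      + (- 1/2) *\<^sub>R damp (\<lambda>z. retarded y z (?v z)))" for r by (rule arg_cong)
  also have "\<dots> r = (1/2) *\<^sub>R slab_sum r (\<lambda>y. translate y (fst u)) + (- 1/2) *\<^sub>R slab_sum r (\<lambda>y. translate (- y) (snd u))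
      + (- 1/2) *\<^sub>R slab_sum r (\<lambda>y. damp (\<lambda>z. retarded y z (?v z)))" for r
    by (simp only: slab_sum_add[OF bounded_continuous_add[OF bcs[OF bc1(1)] bcs[OF bc1(2)]] bcs[OF bc2]]
        slab_sum_add[OF bcs[OF bc1(1)] bcs[OF bc1(2)]] slab_sum_scaleR[OF bc1(1)] slab_sum_scaleR[OF bc1(2)] slab_sum_scaleR[OF bc2])
  finally have eq: "slab_sum r ?v /\<^sub>R r = (1/2) *\<^sub>R (slab_sum r (\<lambda>y. translate y (fst u)) /\<^sub>R r)
      + (- 1/2) *\<^sub>R (slab_sum r (\<lambda>y. translate (- y) (snd u)) /\<^sub>R r)
      + (- 1/2) *\<^sub>R (slab_sum r (\<lambda>y. damp (\<lambda>z. retarded y z (?v z))) /\<^sub>R r)" for r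
    by (simp add: scaleR_add_right scaleR_diff_right)
  have "Linf_mult a (velocity (wave_op u)) = (1/2) *\<^sub>R Linf_mult a (fst u) + (- 1/2) *\<^sub>R Linf_mult a (reflect (snd u))
    + (- 1/2) *\<^sub>R Linf_mult a (damp (\<lambda>z. retarded_trace z (?v z)))"
    unfolding velocity_wave_op by (simp only: linear_simps[OF bounded_linear_Linf_mult[OF a_Linf]])
  then show ?thesis
    unfolding eq
    by (simp only:) (intro tendsto_add tendsto_scaleR tendsto_const slab_sum_retarded_tendsto[OF solution_bounded_continuous]
        slab_sum_tendsto[OF composes_id, simplified] slab_sum_tendsto[OF composes_reflect])
qed

end

definition has_weak_deriv_pair :: "L2 \<times> L2 \<Rightarrow> L2 \<times> L2 \<Rightarrow> bool"
  where "has_weak_deriv_pair u w \<longleftrightarrow> has_weak_deriv (fst u) (fst w) \<and> has_weak_deriv (snd u) (snd w)"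

lemma has_weak_deriv_pair_iff_tendsto:
  "has_weak_deriv_pair u w \<longleftrightarrow> ((\<lambda>r. (evolve r u - u) /\<^sub>R r) \<longlongrightarrow> w) (at_right 0)"
proof
  assume "has_weak_deriv_pair u w"
  then have "((\<lambda>r. ((translate r (fst u) - fst u) /\<^sub>R r, (translate r (snd u) - snd u) /\<^sub>R r)) \<longlongrightarrow> (fst w, snd w)) (at_right 0)"
    unfolding has_weak_deriv_pair_def has_weak_deriv_iff_tendsto by (intro tendsto_Pair) auto
  then show "((\<lambda>r. (evolve r u - u) /\<^sub>R r) \<longlongrightarrow> w) (at_right 0)"
    by (simp add: evolve_def minus_prod_def scaleR_prod_def)
next
  assume l: "((\<lambda>r. (evolve r u - u) /\<^sub>R r) \<longlongrightarrow> w) (at_right 0)"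
  from tendsto_fst[OF l] tendsto_snd[OF l] show "has_weak_deriv_pair u w"
    unfolding has_weak_deriv_pair_def has_weak_deriv_iff_tendsto by (simp add: evolve_def)
qed

text \<open>The bounded part of the generator: in the coordinates f and g, the damped operator is
  differentiation of both components plus this map.\<close>

definition damping_op :: "(real \<Rightarrow> complex) \<Rightarrow> L2 \<times> L2 \<Rightarrow> L2 \<times> L2"
  where "damping_op a u = (- Linf_mult a (velocity u), reflect (Linf_mult a (velocity u)))"

lemma damping_op_zero: "damping_op (\<lambda>_. 0) u = 0"
proof -
  have "norm (Linf_mult (\<lambda>_. 0) v) \<le> 0 * norm v" for v
    by (rule norm_Linf_mult_le) (auto simp: in_Linf_def)
  then have "Linf_mult (\<lambda>_. 0) v = 0" for v by simp
  then show ?thesis by (simp add: damping_op_def reflect_simps zero_prod_def)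
qed

lemma velocity_swap: "velocity (prod.swap u) = - reflect (velocity u)"
  by (simp add: velocity_def reflect_simps scaleR_diff_right)

context damping
begin

text \<open>Reflecting the line exchanges the two travelling parts, so the limit for the second
  component follows from the one for the first component with the reflected damping.\<close>

lemma damping_reflect: "damping (\<lambda>x. a (- x)) C"
proof
  show "(\<lambda>x. a (- x)) \<in> borel_measurable borel" by measurable
  show "integrable lborel (\<lambda>x. a (- x))"
    using lborel_integrable_real_affine[OF a_integrable, of "-1" 0] by simp
  show "cmod (a (- x)) \<le> C" for x by (rule a_bounded)
  show "(LINT x|lborel. cmod (a (- x))) < 2"
    using a_norm lborel_integral_real_affine[of "-1" "\<lambda>x. cmod (a x)" 0] by simp
qed

interpretation R: damping "\<lambda>x. a (- x)" C
  by (rule damping_reflect)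

lemma damp_reflect: "R.damp h = damp (\<lambda>y. h (- y))"
  using lborel_integral_real_affine[of "-1" "\<lambda>y. a (- y) *\<^sub>C h y" 0]
  by (simp add: R.damp_def damp_def)

lemma Linf_mult_reflect: "Linf_mult (\<lambda>x. a (- x)) (reflect u) = reflect (Linf_mult a u)"
proof -
  obtain f where f: "square_integrable f" "u = abs_L2 f" by (rule L2_cases)
  then show ?thesis
    by (simp add: reflect_abs Linf_mult_abs[OF _ a_Linf] Linf_mult_abs[OF _ R.a_Linf]
        square_integrable_reflect square_integrable_mult_bounded[OF a_Linf])
qed

lemma damp_minus:
  assumes "bounded_continuous h"
  shows "damp (\<lambda>y. - h y) = - damp h"
  using damp_scaleC[OF assms, of "of_real (-1)"] by (simp only: scaleC_of_real scaleR_minus1_left)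

text \<open>The minus sign arises because f contains the velocity with a plus sign and g with a
  minus sign, and the two are swapped.\<close>

lemma solution_reflect: "R.solution (prod.swap u) x = - solution u (- x)"
proof (rule R.solution_unique[symmetric])
  have bc: "bounded_continuous (\<lambda>x. solution u (- x))"
    using solution_bounded_continuous[of u] unfolding bounded_continuous_def
    by (auto intro!: continuous_on_compose2[of UNIV "solution u"] continuous_intros)
  show "bounded_continuous (\<lambda>x. - solution u (- x))"
    by (rule bounded_continuous_linear[OF bc bounded_linear_minus[OF bounded_linear_ident]])
  fix x
  have "\<bar>x + y\<bar> = \<bar>- x - y\<bar>" for y :: real by simp
  then have "R.damp (\<lambda>y. translate (- \<bar>x - y\<bar>) (- solution u (- y))) = - damp (\<lambda>y. translate (- \<bar>- x - y\<bar>) (solution u y))"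
    unfolding damp_reflect
    by (simp add: translate_simps damp_minus bounded_continuous_kernel[OF kernel_retarded solution_bounded_continuous])
  then show "- solution u (- x) = incoming (prod.swap u) x + (- 1/2) *\<^sub>R R.damp (\<lambda>y. translate (- \<bar>x - y\<bar>) (- solution u (- y)))"
    by (simp only:) (subst solution_eq, simp add: incoming_def scaleR_diff_right)
qed

lemma wave_op_reflect: "R.wave_op (prod.swap u) = prod.swap (wave_op u)"
  by (simp add: R.wave_op_def wave_op_def R.scatter_def scatter_def damp_reflect solution_reflect chi_simps
      translate_simps damp_minus bounded_continuous_translates[OF bounded_continuous_chi_solution] prod_eq_iff)

lemma scatter_slab:
  "scatter (\<lambda>y. slab r (translate r (solution u y))) =
    (slab_sum r (solution u), R.slab_sum r (R.solution (prod.swap u)))"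
proof -
  have "bounded_continuous (\<lambda>y. slab r (translate r (solution u y)))"
    by (rule bounded_continuous_linear[OF bounded_continuous_linear[OF solution_bounded_continuous bounded_linear_translate] bounded_linear_slab])
  from damp_minus[OF bounded_continuous_translates(2)[OF this]] show ?thesis
    by (simp add: scatter_def slab_sum_def R.slab_sum_def damp_reflect solution_reflect translate_simps
        linear_simps[OF bounded_linear_slab])
qed

text \<open>The Duhamel formula for the damped evolution, in infinitesimal form.\<close>

lemma wave_op_commutator_tendsto:
  "((\<lambda>r. (wave_op (evolve r u) - evolve r (wave_op u)) /\<^sub>R r) \<longlongrightarrow> damping_op a (wave_op u)) (at_right 0)"
proof -
  have "((\<lambda>r. R.slab_sum r (R.solution (prod.swap u)) /\<^sub>R r) \<longlongrightarrow>
      Linf_mult (\<lambda>x. a (- x)) (velocity (R.wave_op (prod.swap u)))) (at_right 0)"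
    by (rule R.slab_sum_solution_tendsto)
  then have "((\<lambda>r. R.slab_sum r (R.solution (prod.swap u)) /\<^sub>R r) \<longlongrightarrow>
      - reflect (Linf_mult a (velocity (wave_op u)))) (at_right 0)"
    by (simp add: wave_op_reflect velocity_swap linear_simps[OF bounded_linear_Linf_mult[OF R.a_Linf]] Linf_mult_reflect)
  then have "((\<lambda>r. - (slab_sum r (solution u) /\<^sub>R r, R.slab_sum r (R.solution (prod.swap u)) /\<^sub>R r)) \<longlongrightarrow>
     - (Linf_mult a (velocity (wave_op u)), - reflect (Linf_mult a (velocity (wave_op u))))) (at_right 0)"
    by (intro tendsto_minus tendsto_Pair slab_sum_solution_tendsto)
  then have l: "((\<lambda>r. - (slab_sum r (solution u) /\<^sub>R r, R.slab_sum r (R.solution (prod.swap u)) /\<^sub>R r)) \<longlongrightarrow>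
     damping_op a (wave_op u)) (at_right 0)"
    by (simp add: damping_op_def)
  show ?thesis
  proof (rule Lim_transform_eventually[OF l])
    have "- (slab_sum r (solution u) /\<^sub>R r, R.slab_sum r (R.solution (prod.swap u)) /\<^sub>R r)
        = (wave_op (evolve r u) - evolve r (wave_op u)) /\<^sub>R r" if "r > 0" for r
      using that by (simp add: wave_op_commutator scatter_slab)
    then show "\<forall>\<^sub>F r in at_right 0. - (slab_sum r (solution u) /\<^sub>R r, R.slab_sum r (R.solution (prod.swap u)) /\<^sub>R r)
        = (wave_op (evolve r u) - evolve r (wave_op u)) /\<^sub>R r"
      unfolding eventually_at_right_field by (intro exI[of _ 1]) auto
  qed
qed

text \<open>W applied to the difference quotient of u is the commutator quotient plus the difference
  quotient of W u. The commutator quotient converges for every u, and W and its inverse are bounded,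
  so either difference quotient converges iff the other one does. This gives both inclusions of the
  domains at once.\<close>

lemma has_weak_deriv_pair_wave_op:
  "has_weak_deriv_pair (wave_op u) (wave_op w - damping_op a (wave_op u)) \<longleftrightarrow> has_weak_deriv_pair u w"
proof -
  note lin = linear_simps[OF bounded_clinear_imp[OF bounded_clinear_wave_op]]
  have eq: "wave_op ((evolve r u - u) /\<^sub>R r) = (wave_op (evolve r u) - evolve r (wave_op u)) /\<^sub>R r
      + (evolve r (wave_op u) - wave_op u) /\<^sub>R r" for r
    by (simp add: lin flip: scaleR_add_right)
  show ?thesis
    unfolding has_weak_deriv_pair_iff_tendsto
  proof
    assume "((\<lambda>r. (evolve r (wave_op u) - wave_op u) /\<^sub>R r) \<longlongrightarrow> wave_op w - damping_op a (wave_op u)) (at_right 0)"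
    from tendsto_add[OF wave_op_commutator_tendsto[of u] this]
    have "((\<lambda>r. wave_op ((evolve r u - u) /\<^sub>R r)) \<longlongrightarrow> wave_op w) (at_right 0)"
      by (simp add: eq)
    from bounded_linear.tendsto[OF bounded_clinear_imp[OF bounded_clinear_inv_wave_op] this]
    show "((\<lambda>r. (evolve r u - u) /\<^sub>R r) \<longlongrightarrow> w) (at_right 0)"
      by (simp add: inv_f_f[OF bij_is_inj[OF bij_wave_op]])
  next
    assume "((\<lambda>r. (evolve r u - u) /\<^sub>R r) \<longlongrightarrow> w) (at_right 0)"
    from bounded_linear.tendsto[OF bounded_clinear_imp[OF bounded_clinear_wave_op] this]
    have "((\<lambda>r. wave_op ((evolve r u - u) /\<^sub>R r)) \<longlongrightarrow> wave_op w) (at_right 0)" .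
    from tendsto_diff[OF this wave_op_commutator_tendsto[of u]]
    show "((\<lambda>r. (evolve r (wave_op u) - wave_op u) /\<^sub>R r) \<longlongrightarrow> wave_op w - damping_op a (wave_op u)) (at_right 0)"
      by (simp add: eq)
  qed
qed

end

section \<open>The homogeneous Sobolev space on the line\<close>

text \<open>The antiderivative that vanishes to the left of the support also vanishes to the right
  of it, because the mean is zero.\<close>

lemma smooth_antiderivative:
  assumes h: "smooth h" and supp: "\<And>x. x \<notin> {-Q..Q} \<Longrightarrow> h x = 0" and Q: "Q > 0"
    and zero: "(h has_integral 0) {-Q..Q}"
  obtains H where "is_test H" "\<And>x. (H has_vector_derivative h x) (at x)"
proof -
  have ch: "continuous_on S h" for S
    using smooth_continuous[OF h] by (rule continuous_on_subset) simp
  \<comment> \<open>The margin 1 makes Q and -Q interior points, where two-sided derivatives are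
    then available.\<close>
  obtain g where g: "\<And>x. x \<in> {-Q-1..Q+1} \<Longrightarrow> (g has_vector_derivative h x) (at x within {-Q-1..Q+1})"
    using antiderivative_continuous[OF ch[of "{-Q-1..Q+1}"]] by blast
  define H where "H x = (if x \<in> {-Q..Q} then g x - g (-Q) else 0)" for x
  \<comment> \<open>At the end points c and d, the vanishing of h follows by continuity.\<close>
  have const: "g x = g y" if "x \<in> {c..d}" "y \<in> {c..d}" "{c..d} \<subseteq> {-Q-1..Q+1}" "\<And>z. z \<in> {c<..<d} \<Longrightarrow> h z = 0" for x y c d
  proof -
    have "\<exists>k. \<forall>x\<in>{c..d}. g x = k"
    proof (cases "c < d")
      case True
      show ?thesis
      proof (rule has_vector_derivative_zero_constant[of "{c..d}"])
        fix z assume z: "z \<in> {c..d}"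
        have hz: "h z = 0"
        proof -
          have "h z \<in> closure (h ` {c<..<d})"
          proof -
            have "z \<in> closure {c<..<d}" using z True by simp
            then have "h z \<in> h ` closure {c<..<d}" by blast
            also have "\<dots> \<subseteq> closure (h ` {c<..<d})"
              by (rule image_closure_subset[OF ch closed_closure closure_subset])
            finally show ?thesis .
          qed
          also have "h ` {c<..<d} \<subseteq> {0}" using that(4) by auto
          then have "closure (h ` {c<..<d}) \<subseteq> {0}" by (intro closure_minimal) auto
          finally show ?thesis by blast
        qed
        have "(g has_vector_derivative h z) (at z within {-Q-1..Q+1})" using g z that(3) by blast
        then have "(g has_vector_derivative h z) (at z within {c..d})"
          by (rule has_vector_derivative_within_subset[OF _ that(3)])
        then show "(g has_vector_derivative 0) (at z within {c..d})" using hz by simp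
      qed auto
    next
      case False
      then show ?thesis by (cases "c = d") auto
    qed
    then show ?thesis using that(1,2) by metis
  qed
  have "(h has_integral (g Q - g (-Q))) {-Q..Q}"
  proof (rule fundamental_theorem_of_calculus)
    fix x assume "x \<in> {-Q..Q}"
    then show "(g has_vector_derivative h x) (at x within {-Q..Q})"
      by (intro has_vector_derivative_within_subset[OF g]) auto
  qed (use Q in auto)
  then have gQ: "g Q = g (-Q)" using has_integral_unique[OF zero] by fastforce
  have Heq: "g x - g (-Q) = H x" if x: "x \<in> {-Q-1<..<Q+1}" for x
  proof -
    consider "x \<in> {-Q..Q}" | "x \<in> {-Q-1..-Q}" | "x \<in> {Q..Q+1}" using x by fastforce
    then show ?thesis
    proof cases
      case 2
      have "g x = g (-Q)" by (rule const[OF 2]) (use Q supp in auto)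
      then show ?thesis by (simp add: H_def)
    next
      case 3
      have "g x = g Q" by (rule const[OF 3]) (use Q supp in auto)
      then show ?thesis using gQ by (simp add: H_def)
    qed (simp add: H_def)
  qed
  have dH: "(H has_vector_derivative h x) (at x)" for x
  proof (cases "x \<in> {-Q-1<..<Q+1}")
    case True
    have "(g has_vector_derivative h x) (at x within {-Q-1..Q+1})" using g[of x] True by auto
    then have "(g has_vector_derivative h x) (at x)" using True by (simp add: at_within_Icc_at)
    then have "((\<lambda>x. g x - g (-Q)) has_vector_derivative h x) (at x)"
      using has_vector_derivative_diff[OF _ has_vector_derivative_const] by fastforce
    then show ?thesis
      by (rule has_vector_derivative_transform_within_open[where S = "{-Q-1<..<Q+1}"]) (use True Heq in auto)
  next
    case False
    have x: "x \<in> - {-Q..Q}" using False Q by auto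
    have "((\<lambda>_. 0) has_vector_derivative h x) (at x)" using supp[of x] x by simp
    then show ?thesis
      by (rule has_vector_derivative_transform_within_open[where S = "- {-Q..Q}"]) (use x in \<open>auto simp: H_def\<close>)
  qed
  obtain F where F: "F 0 = h" "\<And>n x. (F n has_vector_derivative F (Suc n) x) (at x)"
    using h unfolding smooth_def by blast
  have "smooth H"
    by (rule smoothI[where F = "case_nat H F"]) (simp_all add: dH F split: nat.split)
  then have "is_test H" by (rule is_testI[where a = "-Q" and b = Q]) (auto simp: H_def)
  then show ?thesis using dH that by blast
qed

text \<open>For |x| <= R / 2 one has R^2 - x^2 >= 3/4 R^2 >= 3/4, so the bump is at least exp (-4/3)
  on an interval of length R.\<close>

lemma bump_integral_ge:
  assumes "R \<ge> 1"
  shows "R * exp (- 4 / 3) \<le> integral {-R..R} (bump 1 R)" "bump 1 R integrable_on {-R..R}"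
proof -
  have "continuous_on UNIV (bump 1 R)"
  proof -
    have "smooth (\<lambda>x. complex_of_real (bump 1 R x) * 1)" by (rule smooth_bump) (rule polynomial_function_const)
    then have "continuous_on UNIV (\<lambda>x. Re (complex_of_real (bump 1 R x)))"
      by (intro continuous_on_Re) (use smooth_continuous in fastforce)
    then show ?thesis by simp
  qed
  then have int: "bump 1 R integrable_on {c..d}" for c d
    by (intro integrable_continuous_real) (rule continuous_on_subset, auto)
  then show "bump 1 R integrable_on {-R..R}" .
  have "R * exp (- 4 / 3) = integral {-R/2..R/2} (\<lambda>_. exp (- 4 / 3) :: real)"
    using assms by simp
  also have "\<dots> \<le> integral {-R/2..R/2} (bump 1 R)"
  proof (rule integral_le[OF _ int])
    fix x assume x: "x \<in> {-R/2..R/2}"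
    have "\<bar>x\<bar> \<le> R / 2" using x by auto
    then have "x\<^sup>2 \<le> (R/2)\<^sup>2" by (simp add: abs_le_square_iff[symmetric])
    then have "R\<^sup>2 - x\<^sup>2 \<ge> 3 / 4 * R\<^sup>2" by (simp add: power_divide)
    moreover have "R\<^sup>2 \<ge> 1" using assms by simp
    ultimately have ge: "R\<^sup>2 - x\<^sup>2 \<ge> 3 / 4" by linarith
    then have "1 / (R\<^sup>2 - x\<^sup>2) \<le> 4 / 3" by (simp add: field_simps)
    then show "exp (- 4 / 3) \<le> bump 1 R x" using ge by (auto simp: bump_def flat_def)
  qed auto
  also have "\<dots> \<le> integral {-R..R} (bump 1 R)"
    using assms by (intro integral_subset_le int) (auto simp: bump_bounds)
  finally show "R * exp (- 4 / 3) \<le> integral {-R..R} (bump 1 R)" .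
qed

text \<open>Subtracting a wide bump from a test function gives it mean zero at small cost in the norm.\<close>

lemma test_deriv_dense:
  assumes "e > 0"
  obtains \<phi> where "norm (u - test_to_L2 (test_deriv \<phi>)) < e"
proof -
  obtain \<psi> where \<psi>: "norm (u - test_to_L2 \<psi>) < e / 2" using test_dense[of "e/2" u] assms by auto
  obtain g where g: "is_test g" "\<psi> = Abs_test_function g" by (rule test_cases)
  obtain Q where Q: "Q > 0" "\<And>x. x \<notin> {-Q..Q} \<Longrightarrow> g x = 0" by (rule is_test_support[OF g(1)]) blast
  have cg: "continuous_on S g" for S
    using smooth_continuous g(1) continuous_on_subset by blast
  define I where "I = integral {-Q..Q} g"
  have I: "(g has_integral I) {-Q..Q}"
    unfolding I_def by (intro integrable_integral integrable_continuous_real cg)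
  have "((\<lambda>R. cmod I / exp (- 4 / 3) * sqrt (2 / R)) \<longlongrightarrow> cmod I / exp (- 4 / 3) * sqrt 0) at_top"
    by (intro tendsto_intros tendsto_divide_0[OF tendsto_const] filterlim_at_top_imp_at_infinity filterlim_ident)
  then have "\<forall>\<^sub>F R in at_top. cmod I / exp (- 4 / 3) * sqrt (2 / R) < e / 2"
    using assms order_tendstoD(2)[of "\<lambda>R. cmod I / exp (- 4 / 3) * sqrt (2 / R)" 0 at_top "e/2"] by simp
  then have "\<forall>\<^sub>F R in at_top. cmod I / exp (- 4 / 3) * sqrt (2 / R) < e / 2 \<and> R \<ge> max Q 1"
    using eventually_ge_at_top[of "max Q 1"] by eventually_elim auto
  then obtain R where R: "cmod I / exp (- 4 / 3) * sqrt (2 / R) < e / 2" "R \<ge> Q" "R \<ge> 1"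
    by (auto dest: eventually_happens)
  define c where "c = integral {-R..R} (bump 1 R)"
  have c: "c \<ge> R * exp (- 4 / 3)" using bump_integral_ge[OF R(3)] by (simp add: c_def)
  have c0: "c > 0" by (rule less_le_trans[OF _ c]) (use R(3) in simp)
  \<comment> \<open>This bump has the same integral I as g. Its height is at most |I| / c with c
    growing at least linearly in R, and its support has length 2 R, so its norm is O(1 / sqrt
    R).\<close>
  define b where "b x = complex_of_real (bump 1 R x) * (I / complex_of_real c)" for x
  have sb: "smooth b" unfolding b_def by (rule smooth_bump) (rule polynomial_function_const)
  have b0: "x \<notin> {-R..R} \<Longrightarrow> b x = 0" for x
    using bump_support[of 1 R x] R(3) by (simp add: b_def)
  have tb: "is_test b" by (rule is_testI[OF sb b0])
  have "((\<lambda>x. complex_of_real (bump 1 R x)) has_integral complex_of_real c) {-R..R}"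
    unfolding c_def using bump_integral_ge(2)[OF R(3)] by (intro has_integral_of_real integrable_integral)
  then have "(b has_integral complex_of_real c * (I / complex_of_real c)) {-R..R}"
    unfolding b_def by (rule has_integral_mult_left)
  then have hb: "(b has_integral I) {-R..R}" using c0 by simp
  have hg: "(g has_integral I) {-R..R}"
    by (rule has_integral_on_superset[OF I]) (use Q(2) R(2) in auto)
  have nb: "norm (test_to_L2 (Abs_test_function b)) < e / 2"
  proof -
    have "norm (abs_L2 b) \<le> cmod I / c * sqrt (R - - R)"
    proof (rule norm_abs_L2_le)
      show "b \<in> borel_measurable lebesgue"
        by (rule borel_measurable_lebesgue_continuous[OF smooth_continuous[OF sb]])
      show "cmod (b x) \<le> cmod I / c * indicator {-R..R} x" for x
      proof (cases "x \<in> {-R..R}")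
        case True
        have "cmod (b x) = bump 1 R x * (cmod I / c)"
          using c0 bump_bounds(1)[of 1 R x] by (simp add: b_def norm_mult norm_divide)
        also have "\<dots> \<le> 1 * (cmod I / c)"
          using c0 by (intro mult_right_mono bump_bounds) auto
        finally show ?thesis using True by simp
      qed (simp add: b0)
    qed (use R(3) c0 in auto)
    also have "\<dots> \<le> cmod I / (R * exp (- 4 / 3)) * sqrt (R - - R)"
      using c c0 R(3) by (intro mult_right_mono divide_left_mono) auto
    also have "\<dots> = cmod I / exp (- 4 / 3) * (sqrt (2 * R) / R)" by (simp add: field_simps)
    also have "sqrt (2 * R) / R = sqrt (2 / R)"
    proof -
      have "2 / R = 2 * R / R\<^sup>2" using R(3) by (simp add: power2_eq_square)
      then have "sqrt (2 / R) = sqrt (2 * R) / sqrt (R\<^sup>2)" by (simp only: real_sqrt_divide)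
      then show ?thesis using R(3) by simp
    qed
    also note R(1)
    finally show ?thesis by (simp only: test_to_L2_Abs[OF tb])
  qed
  define h where "h x = g x - b x" for x
  have "smooth h"
    using smooth_add[of g "\<lambda>x. (-1) * b x"] smooth_cmult[OF sb, of "-1"] g(1) by (simp add: h_def[abs_def])
  moreover have "h x = 0" if "x \<notin> {-R..R}" for x
    using that Q(2)[of x] b0[of x] R(2) by (auto simp: h_def)
  moreover have "(h has_integral 0) {-R..R}"
    using has_integral_diff[OF hg hb] by (simp add: h_def[abs_def])
  ultimately obtain H where H: "is_test H" "\<And>x. (H has_vector_derivative h x) (at x)"
    using R(3) smooth_antiderivative[of h R] by (metis less_le_trans zero_less_one)
  have "test_to_L2 (test_deriv (Abs_test_function H)) = abs_L2 (\<lambda>x. vector_derivative H (at x))"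
    by (simp only: test_deriv_Abs[OF H(1)] test_to_L2_Abs[OF is_test_deriv[OF H(1)]])
  also have "\<dots> = abs_L2 h"
    using vector_derivative_at[OF H(2)] by simp
  also have "\<dots> = test_to_L2 \<psi> - test_to_L2 (Abs_test_function b)"
    using test_square_integrable[OF g(1)] test_square_integrable[OF tb]
    by (simp only: g(2) test_to_L2_Abs[OF g(1)] test_to_L2_Abs[OF tb] abs_L2_arith h_def[abs_def])
  finally have "u - test_to_L2 (test_deriv (Abs_test_function H)) = (u - test_to_L2 \<psi>) + test_to_L2 (Abs_test_function b)"
    by (simp add: algebra_simps)
  then have "norm (u - test_to_L2 (test_deriv (Abs_test_function H))) < e"
    using norm_triangle_ineq[of "u - test_to_L2 \<psi>" "test_to_L2 (Abs_test_function b)"] \<psi> nb by (simp only:)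
  then show ?thesis by (rule that)
qed

section \<open>The gradient as an isometry onto the square integrable functions\<close>

lemma cauchy_completion_cases:
  obtains X where "Cauchy X" "\<xi> = abs_cauchy_completion X"
proof -
  show ?thesis
    using that Quotient3_abs_rep[OF Quotient3_cauchy_completion] Quotient3_rep_reflp[OF Quotient3_cauchy_completion]
    by metis
qed

lemma test_deriv_diff_L2: "test_to_L2 (test_deriv (\<phi> - \<psi>)) = test_to_L2 (test_deriv \<phi>) - test_to_L2 (test_deriv \<psi>)"
  using test_to_L2_add [of "test_deriv (\<phi> - \<psi>)" "test_deriv \<psi>"] by (simp flip: test_deriv_add)

lemma grad_tendsto:
  assumes "Cauchy X"
  shows "(\<lambda>n. test_to_L2 (test_deriv (X n))) \<longlonglongrightarrow> grad (abs_cauchy_completion X)"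
proof -
  have "Cauchy (\<lambda>n. test_to_L2 (test_deriv (X n)))"
    using assms unfolding Cauchy_iff by (simp add: norm_test_function_def test_deriv_diff_L2)
  then have "(\<lambda>n. test_to_L2 (test_deriv (X n))) \<longlonglongrightarrow> lim (\<lambda>n. test_to_L2 (test_deriv (X n)))"
    by (intro convergent_LIMSEQ_iff[THEN iffD1] Cauchy_convergent)
  moreover have "grad (abs_cauchy_completion X) = lim (\<lambda>n. test_to_L2 (test_deriv (X n)))"
    using assms by (simp add: grad.abs_eq)
  ultimately show ?thesis by simp
qed

lemma grad_eqI:
  assumes "Cauchy X" "(\<lambda>n. test_to_L2 (test_deriv (X n))) \<longlonglongrightarrow> l"
  shows "grad (abs_cauchy_completion X) = l"
  using LIMSEQ_unique[OF grad_tendsto[OF assms(1)] assms(2)] .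

lemma norm_grad [simp]: "norm (grad \<xi>) = norm \<xi>"
proof -
  obtain X where X: "Cauchy X" "\<xi> = abs_cauchy_completion X" by (rule cauchy_completion_cases)
  have "(\<lambda>n. norm (X n)) \<longlonglongrightarrow> norm (grad \<xi>)"
    using tendsto_norm[OF grad_tendsto[OF X(1)]] by (simp add: X(2) norm_test_function_def)
  then have "lim (\<lambda>n. norm (X n)) = norm (grad \<xi>)" by (rule limI)
  moreover have "norm \<xi> = lim (\<lambda>n. norm (X n))"
    using X by (simp add: norm_cauchy_completion.abs_eq)
  ultimately show ?thesis by simp
qed

lemma grad_add: "grad (\<xi> + \<eta>) = grad \<xi> + grad \<eta>"
proof -
  obtain X Y where X: "Cauchy X" "\<xi> = abs_cauchy_completion X" and Y: "Cauchy Y" "\<eta> = abs_cauchy_completion Y"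
    by (metis cauchy_completion_cases)
  have "\<xi> + \<eta> = abs_cauchy_completion (\<lambda>n. X n + Y n)"
    using X Y by (simp add: plus_cauchy_completion.abs_eq)
  then show ?thesis
    using tendsto_add[OF grad_tendsto[OF X(1)] grad_tendsto[OF Y(1)]]
    by (simp add: X Y grad_eqI[OF Cauchy_add[OF X(1) Y(1)]] test_deriv_add test_to_L2_add)
qed

lemma grad_scaleC: "grad (c *\<^sub>C \<xi>) = c *\<^sub>C grad \<xi>"
proof -
  obtain X where X: "Cauchy X" "\<xi> = abs_cauchy_completion X" by (rule cauchy_completion_cases)
  have "c *\<^sub>C \<xi> = abs_cauchy_completion (\<lambda>n. c *\<^sub>C X n)"
    using X by (simp add: scaleC_cauchy_completion.abs_eq)
  then show ?thesis
    using bounded_linear.tendsto[OF bounded_linear_scaleC grad_tendsto[OF X(1)], of c]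
    by (simp add: X(2) grad_eqI[OF bounded_linear.Cauchy[OF bounded_linear_scaleC X(1)]] test_deriv_scaleC test_to_L2_scaleC)
qed

lemma bounded_clinear_grad: "bounded_clinear grad"
  by (rule bounded_clinearI[where K = 1]) (simp_all add: grad_add grad_scaleC)

text \<open>Injectivity holds for an isometry. For surjectivity, derivatives of test functions
  approximate any u, and the approximating test functions form a Cauchy sequence because their norm
  is that of the derivative.\<close>

lemma bij_grad: "bij grad"
proof (rule bijI)
  show "inj grad"
  proof (rule injI)
    fix \<xi> \<eta> assume "grad \<xi> = grad \<eta>"
    then have "grad (\<xi> - \<eta>) = 0" by (simp add: linear_simps[OF bounded_clinear_imp[OF bounded_clinear_grad]])
    then have "norm (\<xi> - \<eta>) = 0" using norm_grad[of "\<xi> - \<eta>"] by simp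
    then show "\<xi> = \<eta>" by simp
  qed
  show "surj grad"
  proof (unfold surj_def, rule allI)
    fix u
    have "\<exists>\<phi>. norm (u - test_to_L2 (test_deriv \<phi>)) < 1 / real (Suc n)" for n
      using test_deriv_dense[of "1 / real (Suc n)" u] by (metis zero_less_divide_1_iff of_nat_0_less_iff zero_less_Suc)
    then obtain X where X: "\<And>n. norm (u - test_to_L2 (test_deriv (X n))) < 1 / real (Suc n)" by metis
    have "(\<lambda>n. u - test_to_L2 (test_deriv (X n))) \<longlonglongrightarrow> 0"
    proof (rule Lim_null_comparison)
      show "\<forall>\<^sub>F n in sequentially. norm (u - test_to_L2 (test_deriv (X n))) \<le> 1 / real (Suc n)"
        using X by (intro always_eventually allI less_imp_le)
      show "(\<lambda>n. 1 / real (Suc n)) \<longlonglongrightarrow> 0" by (rule LIMSEQ_Suc[OF lim_1_over_n])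
    qed
    from tendsto_diff[OF tendsto_const[of u] this]
    have l: "(\<lambda>n. test_to_L2 (test_deriv (X n))) \<longlonglongrightarrow> u" by simp
    then have "Cauchy (\<lambda>n. test_to_L2 (test_deriv (X n)))"
      by (rule LIMSEQ_imp_Cauchy)
    then have "Cauchy X"
      unfolding Cauchy_iff by (simp add: norm_test_function_def test_deriv_diff_L2)
    from grad_eqI[OF this l] show "\<exists>\<xi>. u = grad \<xi>" by metis
  qed
qed

lemma grad_inv_grad [simp]: "grad (inv grad u) = u"
  by (rule surj_f_inv_f[OF bij_is_surj[OF bij_grad]])

lemma inv_grad_grad [simp]: "inv grad (grad \<xi>) = \<xi>"
  by (rule inv_f_f[OF bij_is_inj[OF bij_grad]])

lemma bounded_clinear_inv_grad: "bounded_clinear (inv grad)"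
  by (rule bounded_clinear_inv[OF bounded_clinear_grad bij_grad, where K = 1]) simp

lemma H1_to_Hdot1_eq: "H1_to_Hdot1 u = inv grad (weak_deriv u)"
  unfolding H1_to_Hdot1_def by (rule the_equality) (simp, metis inv_grad_grad)

section \<open>Weak derivatives and the wave operators in characteristic coordinates\<close>

lemma has_weak_deriv_add:
  assumes "has_weak_deriv u u'" "has_weak_deriv v v'"
  shows "has_weak_deriv (u + v) (u' + v')"
  using tendsto_add[OF assms[unfolded has_weak_deriv_iff_tendsto]]
  unfolding has_weak_deriv_iff_tendsto by (simp add: algebra_simps)

lemma has_weak_deriv_scaleR:
  assumes "has_weak_deriv u u'"
  shows "has_weak_deriv (c *\<^sub>R u) (c *\<^sub>R u')"
  using tendsto_scaleR[OF tendsto_const[of c] assms[unfolded has_weak_deriv_iff_tendsto]]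
  unfolding has_weak_deriv_iff_tendsto by (simp add: translate_simps scaleR_diff_right mult.commute)

lemma has_weak_deriv_diff:
  assumes "has_weak_deriv u u'" "has_weak_deriv v v'"
  shows "has_weak_deriv (u - v) (u' - v')"
  using has_weak_deriv_add[OF assms(1) has_weak_deriv_scaleR[OF assms(2), of "-1"]] by simp

text \<open>Reflection turns the forward difference quotient into a backward one; an additional
  shift by - r, which tends strongly to the identity, compensates for this.\<close>

lemma has_weak_deriv_reflect:
  assumes "has_weak_deriv u u'"
  shows "has_weak_deriv (reflect u) (- reflect u')"
proof -
  have "((\<lambda>r. - reflect (translate (- r) ((translate r u - u) /\<^sub>R r))) \<longlongrightarrow> - reflect (translate (- 0) u')) (at_right 0)"
    by (intro tendsto_minus bounded_linear.tendsto[OF bounded_linear_reflect] tendsto_translate tendsto_ident_at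
        assms[unfolded has_weak_deriv_iff_tendsto])
  then show ?thesis
    unfolding has_weak_deriv_iff_tendsto
    by (simp add: translate_simps reflect_simps reflect_translate scaleR_diff_right)
qed

text \<open>The Riemann invariants of the wave equation; reflecting the second one makes both travel
  in the same direction.\<close>

definition coords :: "Hdot1 \<times> L2 \<Rightarrow> L2 \<times> L2"
  where "coords p = (grad (fst p) + snd p, reflect (grad (fst p) - snd p))"

definition coords_inv :: "L2 \<times> L2 \<Rightarrow> Hdot1 \<times> L2"
  where "coords_inv u = (inv grad ((1/2) *\<^sub>R (fst u + reflect (snd u))), velocity u)"

lemma half_add_half: "(1/2 :: real) *\<^sub>R x + (1/2) *\<^sub>R x = (x :: 'a::real_vector)"
  by (simp flip: scaleR_add_left)

lemma velocity_coords [simp]: "velocity (coords p) = snd p"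
  by (simp add: velocity_def coords_def scaleR_diff_right scaleR_add_right half_add_half)

lemma coords_inv_coords [simp]: "coords_inv (coords p) = p"
proof -
  have "(1/2) *\<^sub>R (fst (coords p) + reflect (snd (coords p))) = grad (fst p)"
    by (simp add: coords_def scaleR_diff_right scaleR_add_right half_add_half)
  then show ?thesis by (simp add: coords_inv_def)
qed

lemma coords_coords_inv [simp]: "coords (coords_inv u) = u"
proof -
  have "(1/2) *\<^sub>R (x + y) + (1/2) *\<^sub>R (x - y) = x" "(1/2) *\<^sub>R (x + y) - (1/2) *\<^sub>R (x - y) = y" for x y :: L2
    by (simp_all add: scaleR_diff_right scaleR_add_right half_add_half)
  then show ?thesis by (simp add: coords_def coords_inv_def velocity_def)
qed

lemma bounded_clinear_fst: "bounded_clinear (fst :: 'a::complex_normed_vector \<times> 'b::complex_normed_vector \<Rightarrow> 'a)"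
  by (simp add: bounded_clinear_def bounded_linear_fst scaleC_prod_def)

lemma bounded_clinear_snd: "bounded_clinear (snd :: 'a::complex_normed_vector \<times> 'b::complex_normed_vector \<Rightarrow> 'b)"
  by (simp add: bounded_clinear_def bounded_linear_snd scaleC_prod_def)

lemma bounded_clinear_diff:
  assumes "bounded_clinear f" "bounded_clinear g"
  shows "bounded_clinear (\<lambda>x. f x - g x)"
  using assms by (auto simp: bounded_clinear_def scaleC_diff_right intro: bounded_linear_sub)

lemma bounded_clinear_Pair:
  assumes "bounded_clinear f" "bounded_clinear g"
  shows "bounded_clinear (\<lambda>x. (f x, g x))"
  using assms by (auto simp: bounded_clinear_def scaleC_prod_def intro: bounded_linear_Pair)

lemma bounded_clinear_scaleR: "bounded_clinear (\<lambda>x :: 'a::complex_normed_vector. r *\<^sub>R x)"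
  by (simp add: bounded_clinear_def bounded_linear_scaleR_right scaleC_scaleR_commute)

lemma bounded_clinear_coords: "bounded_clinear coords"
  unfolding coords_def[abs_def]
  by (intro bounded_clinear_Pair bounded_clinear_add bounded_clinear_diff bounded_clinear_snd
      bounded_clinear_compose[OF bounded_clinear_reflect] bounded_clinear_compose[OF bounded_clinear_grad bounded_clinear_fst])

lemma bounded_clinear_velocity: "bounded_clinear velocity"
  unfolding velocity_def[abs_def]
  by (intro bounded_clinear_compose[OF bounded_clinear_scaleR] bounded_clinear_diff bounded_clinear_fst
      bounded_clinear_compose[OF bounded_clinear_reflect bounded_clinear_snd])

lemma bounded_clinear_coords_inv: "bounded_clinear coords_inv"
  unfolding coords_inv_def[abs_def]
  by (intro bounded_clinear_Pair bounded_clinear_velocity bounded_clinear_compose[OF bounded_clinear_inv_grad]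
      bounded_clinear_compose[OF bounded_clinear_scaleR] bounded_clinear_add bounded_clinear_fst
      bounded_clinear_compose[OF bounded_clinear_reflect bounded_clinear_snd])

lemma has_weak_deriv_pair_coords:
  assumes "has_weak_deriv (grad (fst p)) u" "has_weak_deriv (snd p) v"
  shows "has_weak_deriv_pair (coords p) (u + v, reflect (v - u))"
  using has_weak_deriv_add[OF assms] has_weak_deriv_reflect[OF has_weak_deriv_diff[OF assms]]
  by (simp add: has_weak_deriv_pair_def coords_def reflect_simps)

lemma has_weak_deriv_pair_coordsD:
  assumes "has_weak_deriv_pair (coords p) w"
  shows "has_weak_deriv (grad (fst p)) ((1/2) *\<^sub>R (fst w - reflect (snd w)))"
    and "has_weak_deriv (snd p) ((1/2) *\<^sub>R (fst w + reflect (snd w)))"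
proof -
  have 1: "has_weak_deriv (grad (fst p) + snd p) (fst w)"
    and 2: "has_weak_deriv (grad (fst p) - snd p) (- reflect (snd w))"
    using assms has_weak_deriv_reflect[of "reflect (grad (fst p) - snd p)" "snd w"]
    by (auto simp: has_weak_deriv_pair_def coords_def)
  have eq: "(1/2) *\<^sub>R ((x + y) + (x - y)) = x" "(1/2) *\<^sub>R ((x + y) - (x - y)) = y" for x y :: L2
    by (simp_all add: scaleR_diff_right scaleR_add_right half_add_half algebra_simps)
  show "has_weak_deriv (grad (fst p)) ((1/2) *\<^sub>R (fst w - reflect (snd w)))"
    using has_weak_deriv_scaleR[OF has_weak_deriv_add[OF 1 2], of "1/2"] by (simp only: eq diff_conv_add_uminus[symmetric])
  show "has_weak_deriv (snd p) ((1/2) *\<^sub>R (fst w + reflect (snd w)))"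
    using has_weak_deriv_scaleR[OF has_weak_deriv_diff[OF 1 2], of "1/2"] by (simp only: eq diff_minus_eq_add)
qed

lemma damped_wave_coords:
  assumes "has_weak_deriv_pair (coords p) w"
  shows "damped_wave a p = Some (coords_inv (w + damping_op a (coords p)))"
proof -
  note d = has_weak_deriv_pair_coordsD[OF assms]
  have "coords (H1_to_Hdot1 (snd p), laplacian (fst p) - Linf_mult a (snd p)) = w + damping_op a (coords p)"
  proof -
    \<comment> \<open>X is the weak derivative of the second component of p, and Y that of the
      gradient of the first one.\<close>
    define X where "X = (1/2) *\<^sub>R (fst w + reflect (snd w))"
    define Y where "Y = (1/2) *\<^sub>R (fst w - reflect (snd w))"
    have "X + Y = fst w" "X - Y = reflect (snd w)"
      by (simp_all add: X_def Y_def scaleR_diff_right scaleR_add_right half_add_half)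
    then have e: "X + (Y - l) = fst w - l" "X - (Y - l) = reflect (snd w) + l" for l
      by (simp_all add: algebra_simps)
    have "(X + (Y - l), reflect (X - (Y - l))) = w + (- l, reflect l)" for l
      unfolding e by (simp add: prod_eq_iff)
    then show ?thesis
      unfolding coords_def H1_to_Hdot1_eq laplacian_def weak_deriv_eq[OF d(1)] weak_deriv_eq[OF d(2)] fst_conv snd_conv
        damping_op_def velocity_coords[unfolded coords_def] grad_inv_grad X_def[symmetric] Y_def[symmetric] .
  qed
  then have "coords_inv (w + damping_op a (coords p)) = (H1_to_Hdot1 (snd p), laplacian (fst p) - Linf_mult a (snd p))"
    by (metis coords_inv_coords)
  moreover have "grad (fst p) \<in> H1" "snd p \<in> H1" using d by (auto simp: H1_def)
  ultimately show ?thesis by (simp add: damped_wave_def case_prod_beta)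
qed

lemma damped_wave_eq_None_iff: "damped_wave a p = None \<longleftrightarrow> (\<nexists>w. has_weak_deriv_pair (coords p) w)"
proof
  assume None: "damped_wave a p = None"
  show "\<nexists>w. has_weak_deriv_pair (coords p) w"
  proof
    assume "\<exists>w. has_weak_deriv_pair (coords p) w"
    then show False using None damped_wave_coords[of p] by fastforce
  qed
next
  assume n: "\<nexists>w. has_weak_deriv_pair (coords p) w"
  have "\<not> (grad (fst p) \<in> H1 \<and> snd p \<in> H1)"
    using n has_weak_deriv_pair_coords[of p] unfolding H1_def by blast
  then show "damped_wave a p = None" by (auto simp: damped_wave_def case_prod_beta)
qed

text \<open>On the domain, \<open>has_weak_deriv_pair_wave_op\<close> cancels the damping term in
  the formula of \<open>damped_wave_coords\<close>; outside it, both sides are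
  \<open>None\<close>.\<close>

lemma (in damping) similar_undamped: "similar (damped_wave a) (damped_wave (\<lambda>_. 0))"
proof -
  define W where "W p = coords_inv (wave_op (coords p))" for p
  define V where "V p = coords_inv (inv wave_op (coords p))" for p
  have WV: "W (V p) = p" for p
    by (simp add: W_def V_def surj_f_inv_f[OF surj_wave_op])
  have VW: "V (W p) = p" for p
    by (simp add: W_def V_def inv_f_f[OF bij_is_inj[OF bij_wave_op]])
  have bij: "bij W" by (rule o_bij[of V]) (simp_all add: fun_eq_iff WV VW)
  have inv: "inv W = V" by (rule inv_equality) (simp_all add: WV VW)
  have "bounded_clinear W" "bounded_clinear V"
    unfolding W_def[abs_def] V_def[abs_def]
    by (intro bounded_clinear_compose[OF bounded_clinear_coords_inv] bounded_clinear_compose[OF _ bounded_clinear_coords]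
        bounded_clinear_wave_op bounded_clinear_inv_wave_op)+
  moreover have "damped_wave a (W p) = map_option W (damped_wave (\<lambda>_. 0) p)" for p
  proof (cases "\<exists>w. has_weak_deriv_pair (coords p) w")
    case True
    then obtain w where w: "has_weak_deriv_pair (coords p) w" by blast
    have cW: "coords (W p) = wave_op (coords p)" by (simp add: W_def)
    have "has_weak_deriv_pair (coords (W p)) (wave_op w - damping_op a (coords (W p)))"
      unfolding cW using w by (simp add: has_weak_deriv_pair_wave_op)
    from damped_wave_coords[OF this, of a]
    have "damped_wave a (W p) = Some (coords_inv (wave_op w))" by simp
    moreover note damping_op_zero
    ultimately show ?thesis using damped_wave_coords[OF w, of "\<lambda>_. 0"] by (simp add: W_def)
  next
    case False
    have "\<nexists>w. has_weak_deriv_pair (coords (W p)) w"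
    proof
      assume "\<exists>w. has_weak_deriv_pair (coords (W p)) w"
      then obtain q where q: "has_weak_deriv_pair (wave_op (coords p)) q" by (auto simp: W_def)
      \<comment> \<open>Surjectivity brings a hypothetical derivative q into the form that
        \<open>has_weak_deriv_pair_wave_op\<close> can pull back to p.\<close>
      obtain w where "q + damping_op a (wave_op (coords p)) = wave_op w"
        using surj_wave_op unfolding surj_def by blast
      then have "q = wave_op w - damping_op a (wave_op (coords p))" by (simp add: algebra_simps)
      then show False using q False has_weak_deriv_pair_wave_op by blast
    qed
    then have "damped_wave a (W p) = None" "damped_wave (\<lambda>_. 0) p = None"
      using False unfolding damped_wave_eq_None_iff by blast+
    then show ?thesis by simp
  qed
  then have "damped_wave a = map_option W \<circ> damped_wave (\<lambda>_. 0) \<circ> inv W"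
    unfolding inv fun_eq_iff o_def by (metis WV)
  ultimately show ?thesis
    unfolding similar_def using bij inv by (intro exI[of _ W]) simp
qed

section \<open>A damping with an eigenvalue\<close>

text \<open>As translations are isometries, translate r u - u has a nonpositive inner product with
  u; in the limit, l times the squared norm of u is at most 0.\<close>

lemma has_weak_deriv_self_eq_0:
  assumes "has_weak_deriv u (l *\<^sub>R u)" "l > 0"
  shows "u = 0"
proof -
  have "((\<lambda>r. ((translate r u - u) /\<^sub>R r) \<bullet> u) \<longlongrightarrow> (l *\<^sub>R u) \<bullet> u) (at_right 0)"
    using assms(1) unfolding has_weak_deriv_iff_tendsto by (intro tendsto_inner tendsto_const)
  moreover have "\<forall>\<^sub>F r in at_right 0. ((translate r u - u) /\<^sub>R r) \<bullet> u \<le> 0"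
    unfolding eventually_at_right_field
  proof (intro exI[of _ 1] conjI allI impI)
    fix r :: real assume "0 < r"
    have "translate r u \<bullet> u \<le> u \<bullet> u"
      using norm_cauchy_schwarz[of "translate r u" u] by (simp add: power2_norm_eq_inner[symmetric] power2_eq_square)
    then show "((translate r u - u) /\<^sub>R r) \<bullet> u \<le> 0"
      using \<open>0 < r\<close> by (simp add: inner_diff_left mult_nonneg_nonpos)
  qed simp
  ultimately have "(l *\<^sub>R u) \<bullet> u \<le> 0" by (intro tendsto_upperbound) auto
  then have "u \<bullet> u \<le> 0" using assms(2) by (simp add: mult_le_0_iff)
  then show ?thesis by (metis inner_eq_zero_iff inner_ge_zero order_antisym)
qed

lemma undamped_no_eigenvalue:
  assumes "damped_wave (\<lambda>_. 0) p = Some (l *\<^sub>R p)" "l > 0"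
  shows "p = 0"
proof -
  obtain w where w: "has_weak_deriv_pair (coords p) w"
    using assms(1) damped_wave_eq_None_iff[of "\<lambda>_. 0" p] by auto
  have "coords_inv w = l *\<^sub>R p"
    using damped_wave_coords[OF w, of "\<lambda>_. 0"] assms(1) by (simp add: damping_op_zero)
  then have "w = l *\<^sub>R coords p"
    by (metis coords_coords_inv linear_simps(5)[OF bounded_clinear_imp[OF bounded_clinear_coords]])
  then have "fst (coords p) = 0" "snd (coords p) = 0"
    using w assms(2) by (auto simp: has_weak_deriv_pair_def intro: has_weak_deriv_self_eq_0)
  then have "coords p = 0" by (simp add: prod_eq_iff)
  then show ?thesis
    by (metis coords_inv_coords linear_simps(3)[OF bounded_clinear_imp[OF bounded_clinear_coords_inv]])
qed

text \<open>The inverse of W would carry the eigenvector to one of the undamped operator with the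
  same positive eigenvalue.\<close>

lemma not_similar_if_eigenvalue:
  assumes "damped_wave a p = Some (l *\<^sub>R p)" "l > 0" "p \<noteq> 0"
  shows "\<not> similar (damped_wave a) (damped_wave (\<lambda>_. 0))"
proof
  assume "similar (damped_wave a) (damped_wave (\<lambda>_. 0))"
  then obtain W where W: "bounded_clinear W" "bij W" "bounded_clinear (inv W)"
    "damped_wave a = map_option W \<circ> damped_wave (\<lambda>_. 0) \<circ> inv W"
    unfolding similar_def by blast
  have "map_option W (damped_wave (\<lambda>_. 0) (inv W p)) = Some (l *\<^sub>R p)"
    using W(4) assms(1) by (metis comp_apply)
  then obtain z where z: "damped_wave (\<lambda>_. 0) (inv W p) = Some z" "W z = l *\<^sub>R p" by auto
  have "z = inv W (l *\<^sub>R p)" using z(2) W(2) by (metis bij_is_inj inv_f_f)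
  also have "\<dots> = l *\<^sub>R inv W p" by (rule linear_simps(5)[OF bounded_clinear_imp[OF W(3)]])
  finally have "inv W p = 0" using undamped_no_eigenvalue z(1) assms(2) by blast
  then have "p = W 0" using W(2) by (metis bij_is_surj surj_f_inv_f)
  then show False using assms(3) linear_simps(3)[OF bounded_clinear_imp[OF W(1)]] by simp
qed

text \<open>Integration by parts against a test function; continuity of f rules out jump terms at
  the points of S.\<close>

lemma has_weak_deriv_piecewise:
  fixes f f' :: "real \<Rightarrow> real"
  assumes S: "finite S" and cont: "continuous_on UNIV f"
    and d: "\<And>x. x \<notin> S \<Longrightarrow> (f has_real_derivative f' x) (at x)"
    and f: "square_integrable (\<lambda>x. of_real (f x))" and f': "square_integrable (\<lambda>x. of_real (f' x))"
  shows "has_weak_deriv (abs_L2 (\<lambda>x. of_real (f x))) (abs_L2 (\<lambda>x. of_real (f' x)))"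
  unfolding has_weak_deriv_def
proof
  fix \<phi>
  obtain g where g: "is_test g" "\<phi> = Abs_test_function g" by (rule test_cases)
  define g1 where "g1 x = vector_derivative g (at x)" for x
  have t1: "is_test g1" unfolding g1_def by (rule is_test_deriv[OF g(1)])
  obtain Q where Q: "Q > 0" "\<And>x. x \<notin> {-Q..Q} \<Longrightarrow> g x = 0" by (rule is_test_support[OF g(1)]) blast
  obtain P where P: "P > 0" "\<And>x. x \<notin> {-P..P} \<Longrightarrow> g1 x = 0" by (rule is_test_support[OF t1]) blast
  have sg: "square_integrable g" "square_integrable g1"
    by (rule test_square_integrable[OF g(1)], rule test_square_integrable[OF t1])
  let ?k = "\<lambda>x. of_real (f x) * g1 x + of_real (f' x) * g x"
  define R where "R = max P Q + 1"
  have "(?k has_integral (of_real (f R) * g R - of_real (f (-R)) * g (-R))) {-R..R}"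
  proof (rule fundamental_theorem_of_calculus_strong[OF S])
    show "continuous_on {-R..R} (\<lambda>x. of_real (f x) * g x)"
      using continuous_on_subset[OF cont] continuous_on_subset[OF smooth_continuous] g(1)
      by (intro continuous_on_mult continuous_on_of_real) auto
    fix x assume "x \<in> {-R..R} - S"
    then have "((\<lambda>x. complex_of_real (f x)) has_vector_derivative of_real (f' x)) (at x)"
      using d[of x] by (intro has_vector_derivative_of_real) (simp add: has_real_derivative_iff_has_vector_derivative)
    moreover have "(g has_vector_derivative g1 x) (at x)"
      unfolding g1_def using g(1) by (intro smooth_has_derivative) simp
    ultimately show "((\<lambda>x. of_real (f x) * g x) has_vector_derivative ?k x) (at x)"
      by (rule has_vector_derivative_mult)
  qed (use Q P in \<open>auto simp: R_def\<close>)
  moreover have "g R = 0" "g (-R) = 0" by (rule Q(2), use Q(1) in \<open>auto simp: R_def\<close>)+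
  ultimately have kR: "(?k has_integral 0) {-R..R}" by simp
  have "?k x = 0" if x: "x \<notin> {-R..R}" for x
  proof -
    have "x \<notin> {-Q..Q}" "x \<notin> {-P..P}" using x by (auto simp: R_def)
    then show ?thesis by (simp add: Q(2) P(2) del: atLeastAtMost_iff)
  qed
  then have k0: "(?k has_integral 0) UNIV"
    by (rule has_integral_on_superset[OF kR]) auto
  note i1 = integrable_times[OF f sg(2)] and i2 = integrable_times[OF f' sg(1)]
  have "(?k has_integral (LINT x|lebesgue. ?k x)) UNIV"
    by (rule has_integral_integral_lebesgue[OF Bochner_Integration.integrable_add[OF i1 i2]])
  then have "(LINT x|lebesgue. ?k x) = 0" using k0 by (rule has_integral_unique)
  then have "(LINT x|lebesgue. of_real (f' x) * g x) = - (LINT x|lebesgue. of_real (f x) * g1 x)"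
    unfolding Bochner_Integration.integral_add[OF i1 i2] by (simp add: eq_neg_iff_add_eq_0 add.commute)
  then show "pairing (abs_L2 (\<lambda>x. of_real (f' x))) (test_to_L2 \<phi>)
    = - pairing (abs_L2 (\<lambda>x. of_real (f x))) (test_to_L2 (test_deriv \<phi>))"
    by (simp only: g(2) test_deriv_Abs[OF g(1)] g1_def[symmetric, abs_def] test_to_L2_Abs[OF g(1)] test_to_L2_Abs[OF t1]
        pairing_abs[OF f' sg(1)] pairing_abs[OF f sg(2)])
qed

lemma integrable_exp_abs:
  fixes c :: real
  assumes "c > 0"
  shows "integrable lebesgue (\<lambda>x :: real. exp (- c * \<bar>x\<bar>))"
proof -
  have "(\<lambda>x. exp (- c * x)) integrable_on {0..}"
    using has_integral_exp_minus_to_infinity[OF assms, of 0] by (auto simp: integrable_on_def)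
  then have "(\<lambda>x. exp (- c * x)) absolutely_integrable_on {0..}"
    by (rule nonnegative_absolutely_integrable_1) simp
  then have i: "integrable lebesgue (\<lambda>x. indicator {0..} x * exp (- c * x))"
    by (simp add: set_integrable_def)
  then have "integrable lebesgue (\<lambda>x. indicator {0..} (- x) * exp (- c * - x))"
    using lebesgue_integrable_real_affine[OF i, of "-1" 0] by simp
  from Bochner_Integration.integrable_add[OF i this]
  show ?thesis
  proof (rule Bochner_Integration.integrable_bound)
    show "(\<lambda>x. exp (- c * \<bar>x\<bar>)) \<in> borel_measurable lebesgue"
      by (rule borel_measurable_lebesgue_continuous) (intro continuous_intros)
    show "AE x in lebesgue. norm (exp (- c * \<bar>x\<bar>))
        \<le> norm (indicator {0..} x * exp (- c * x) + indicator {0..} (- x) * exp (- c * - x))"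
      by (intro AE_I2) (auto simp: indicator_def abs_if)
  qed
qed

lemma square_integrable_exp_bound:
  assumes "continuous_on UNIV f" "\<And>x. \<bar>f x\<bar> \<le> K * exp (- l * \<bar>x\<bar>)" "l > 0"
  shows "square_integrable (\<lambda>x. complex_of_real (f x))"
  unfolding square_integrable_def
proof
  have "continuous_on UNIV (\<lambda>x. complex_of_real (f x))" by (intro continuous_on_of_real assms)
  then show "(\<lambda>x. complex_of_real (f x)) \<in> borel_measurable lebesgue"
    by (rule borel_measurable_lebesgue_continuous)
  have "integrable lebesgue (\<lambda>x. K\<^sup>2 * exp (- (2 * l) * \<bar>x\<bar>))"
    using assms(3) by (intro integrable_mult_right integrable_exp_abs) simp
  then show "integrable lebesgue (\<lambda>x. (cmod (complex_of_real (f x)))\<^sup>2)"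
  proof (rule Bochner_Integration.integrable_bound)
    have "continuous_on UNIV (\<lambda>x. (cmod (complex_of_real (f x)))\<^sup>2)"
      by (intro continuous_on_power continuous_on_norm continuous_on_of_real assms)
    then show "(\<lambda>x. (cmod (complex_of_real (f x)))\<^sup>2) \<in> borel_measurable lebesgue"
      by (rule borel_measurable_lebesgue_continuous)
    show "AE x in lebesgue. norm ((cmod (complex_of_real (f x)))\<^sup>2) \<le> norm (K\<^sup>2 * exp (- (2 * l) * \<bar>x\<bar>))"
    proof (rule AE_I2)
      fix x
      have "(cmod (complex_of_real (f x)))\<^sup>2 \<le> (K * exp (- l * \<bar>x\<bar>))\<^sup>2"
        using assms(2)[of x] by (intro power_mono) auto
      also have "\<dots> = K\<^sup>2 * exp (- (2 * l) * \<bar>x\<bar>)"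
        by (simp add: power_mult_distrib mult.assoc flip: exp_double)
      finally show "norm ((cmod (complex_of_real (f x)))\<^sup>2) \<le> norm (K\<^sup>2 * exp (- (2 * l) * \<bar>x\<bar>))" by simp
    qed
  qed
qed

text \<open>The damping \<open>- 2 k / sin (2 k)\<close> on \<open>[-1, 1]\<close> has the eigenvalue \<open>k tan k\<close>: the bound state
  \<open>cos (k x)\<close> in the well is matched to exponential decay outside. Its mass \<open>4 k / sin (2 k)\<close> tends
  to \<open>2\<close> as \<open>k \<rightarrow> 0\<close>.\<close>

lemma well_not_similar:
  fixes k :: real
  assumes k: "0 < k" "k < 1"
  defines "a \<equiv> \<lambda>x. - complex_of_real (2 * k / sin (2 * k)) * indicator {-1..1} x"
  shows "in_Linf a" "in_L1 a" "L1_norm a = 2 * (2 * k / sin (2 * k))"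
    "\<not> similar (damped_wave a) (damped_wave (\<lambda>_. 0))"
proof -
  define \<alpha> where "\<alpha> = 2 * k / sin (2 * k)"
  define l where "l = k * tan k"
  have sk: "sin k > 0" "cos k > 0"
    using k pi_ge_two by (auto intro!: sin_gt_zero_02 cos_gt_zero)
  have s2: "sin (2 * k) > 0" using sk by (simp add: sin_double)
  have \<alpha>: "\<alpha> > 0" using s2 k by (simp add: \<alpha>_def)
  have l: "l > 0" using sk k by (simp add: l_def tan_def)
  have lc: "l * cos k = k * sin k" using sk by (simp add: l_def tan_def)
  have "(k\<^sup>2 + l\<^sup>2) * (cos k)\<^sup>2 = k\<^sup>2 * (cos k)\<^sup>2 + (l * cos k)\<^sup>2"
    by (simp only: power_mult_distrib distrib_right)
  also have "\<dots> = k\<^sup>2 * ((cos k)\<^sup>2 + (sin k)\<^sup>2)"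
    by (simp only: lc power_mult_distrib distrib_left)
  also have "\<dots> = k\<^sup>2" by simp
  also have "\<dots> = (\<alpha> * l) * (cos k)\<^sup>2"
    using sk by (simp add: \<alpha>_def l_def tan_def sin_double power2_eq_square)
  \<comment> \<open>An eigenvector has second component l times the first one, so inside the well
    the second derivative must equal l^2 - \<alpha> l times the function. This factor has to be -
    k^2 for cos (k x).\<close>
  finally have match: "\<alpha> * l = k\<^sup>2 + l\<^sup>2" using sk by simp
  have a: "a x = - complex_of_real \<alpha> * indicator {-1..1} x" for x by (simp add: a_def \<alpha>_def)
  have na: "cmod (a x) = \<alpha> * indicator {-1..1} x" for x
    using \<alpha> by (simp add: a indicator_def)
  have im: "integrable lebesgue (indicator {-1..1} :: real \<Rightarrow> complex)"
  proof -
    have "integrable lebesgue (indicator {-1..1::real} :: real \<Rightarrow> real)"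
      by (rule integrable_real_indicator) (simp_all add: emeasure_lborel_Icc_eq)
    then have "integrable lebesgue (\<lambda>x. complex_of_real (indicator {-1..1::real} x))"
      by (rule integrable_of_real)
    moreover have "complex_of_real (indicator {-1..1::real} x) = indicator {-1..1} x" for x
      by (simp add: indicator_def)
    ultimately show ?thesis by (simp only:)
  qed
  show "in_L1 a" unfolding in_L1_def a by (rule integrable_mult_right[OF im])
  then have ma: "a \<in> borel_measurable lebesgue" by (auto simp: in_L1_def)
  have ale: "cmod (a x) \<le> \<alpha>" for x using \<alpha> by (auto simp: na indicator_def)
  then show Linf: "in_Linf a"
    unfolding in_Linf_def using ma by blast
  show "L1_norm a = 2 * (2 * k / sin (2 * k))"
    unfolding L1_norm_def na by (simp add: \<alpha>_def)
  \<comment> \<open>Clamping x to the well and letting the decay start at its edge gives single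
    formulas, continuous on the whole line, for the eigenfunction and its derivative.\<close>
  define t where "t x = max (-1) (min 1 x)" for x :: real
  define E where "E x = exp (- l * max 0 (\<bar>x\<bar> - 1))" for x
  define \<psi> where "\<psi> x = cos (k * t x) * E x" for x
  define \<psi>' where "\<psi>' x = - k * sin (k * t x) * E x" for x
  \<comment> \<open>The second derivative jumps at the edges together with the damping. The first
    one is continuous there since l cos k = k sin k, so \<open>has_weak_deriv_piecewise\<close>
    applies twice.\<close>
  define \<psi>'' where "\<psi>'' x = (if x \<in> {-1..1} then - k\<^sup>2 * \<psi> x else l\<^sup>2 * \<psi> x)" for x
  have cont: "continuous_on UNIV \<psi>" "continuous_on UNIV \<psi>'"
    unfolding \<psi>_def \<psi>'_def t_def E_def by (intro continuous_intros)+
  have E: "0 \<le> E x" "E x \<le> exp l * exp (- l * \<bar>x\<bar>)" for x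
  proof -
    have "- l * max 0 (\<bar>x\<bar> - 1) \<le> l + - l * \<bar>x\<bar>"
      using l mult_left_mono[of "\<bar>x\<bar> - 1" "max 0 (\<bar>x\<bar> - 1)" l] by (simp add: algebra_simps)
    then show "E x \<le> exp l * exp (- l * \<bar>x\<bar>)" unfolding E_def by (simp flip: exp_add)
  qed (simp add: E_def)
  have b: "\<bar>\<psi> x\<bar> \<le> exp l * exp (- l * \<bar>x\<bar>)" for x
  proof -
    have "\<bar>\<psi> x\<bar> \<le> 1 * E x" unfolding \<psi>_def abs_mult using E(1)[of x] by (intro mult_mono) auto
    then show ?thesis using E(2)[of x] by simp
  qed
  have b': "\<bar>\<psi>' x\<bar> \<le> (k * exp l) * exp (- l * \<bar>x\<bar>)" for x
  proof -
    have "\<bar>\<psi>' x\<bar> \<le> (k * 1) * E x"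
      unfolding \<psi>'_def abs_mult using E(1)[of x] k by (intro mult_mono) auto
    also have "\<dots> \<le> (k * 1) * (exp l * exp (- l * \<bar>x\<bar>))" using E(2)[of x] k by (intro mult_left_mono) auto
    finally show ?thesis by simp
  qed
  have sq: "square_integrable (\<lambda>x. complex_of_real (\<psi> x))" "square_integrable (\<lambda>x. complex_of_real (\<psi>' x))"
    by (rule square_integrable_exp_bound[OF cont(1) b l], rule square_integrable_exp_bound[OF cont(2) b' l])
  have eq: "complex_of_real (\<psi>'' x) = complex_of_real (l\<^sup>2) * of_real (\<psi> x) + complex_of_real l * (a x * of_real (\<psi> x))" for x
  proof (cases "x \<in> {-1..1}")
    case True
    have "- k\<^sup>2 * \<psi> x = l\<^sup>2 * \<psi> x - (\<alpha> * l) * \<psi> x" unfolding match by (simp add: algebra_simps)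
    then have "complex_of_real (- k\<^sup>2 * \<psi> x) = complex_of_real (l\<^sup>2 * \<psi> x - (\<alpha> * l) * \<psi> x)" by (rule arg_cong)
    then show ?thesis using True by (simp add: \<psi>''_def a mult_ac)
  next
    case False
    then show ?thesis by (simp add: \<psi>''_def a del: atLeastAtMost_iff)
  qed
  have sqa: "square_integrable (\<lambda>x. a x * complex_of_real (\<psi> x))"
    by (rule square_integrable_mult_bounded[OF Linf sq(1)])
  have sq'': "square_integrable (\<lambda>x. complex_of_real (\<psi>'' x))"
    unfolding eq by (intro square_integrable_add square_integrable_cmult sq sqa)
  have d: "(\<psi> has_real_derivative \<psi>' x) (at x)" "(\<psi>' has_real_derivative \<psi>'' x) (at x)" if "x \<notin> {-1, 1}" for x
  proof -
    consider "\<bar>x\<bar> < 1" | "x > 1" | "x < -1" using \<open>x \<notin> {-1, 1}\<close> by fastforce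
    then have "(\<psi> has_real_derivative \<psi>' x) (at x) \<and> (\<psi>' has_real_derivative \<psi>'' x) (at x)"
    proof cases
      case 1
      have e: "t y = y" "E y = 1" if "y \<in> {-1<..<1}" for y using that by (auto simp: t_def E_def max_def)
      have e1: "t x = x" "E x = 1" using 1 by (auto intro!: e)
      have "((\<lambda>x. cos (k * x)) has_real_derivative \<psi>' x) (at x)"
        using 1 e1 by (auto intro!: derivative_eq_intros simp: \<psi>'_def)
      moreover have "((\<lambda>x. - k * sin (k * x)) has_real_derivative \<psi>'' x) (at x)"
        using 1 e1 by (auto intro!: derivative_eq_intros simp: \<psi>''_def \<psi>_def power2_eq_square)
      moreover have xS: "x \<in> {-1<..<1}" using 1 by auto
      ultimately show ?thesis
        by (intro conjI; elim has_field_derivative_transform_within_open[where S = "{-1<..<1}"])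
          (use xS e in \<open>simp_all add: \<psi>_def \<psi>'_def\<close>)
    next
      case 2
      have e: "t y = 1" "E y = exp (- l * (y - 1))" if "y \<in> {1<..}" for y using that by (auto simp: t_def E_def max_def)
      have "((\<lambda>x. cos k * exp (- l * (x - 1))) has_real_derivative \<psi>' x) (at x)"
        using 2 e[of x] lc by (auto intro!: derivative_eq_intros simp: \<psi>'_def algebra_simps)
      moreover have "((\<lambda>x. - k * sin k * exp (- l * (x - 1))) has_real_derivative \<psi>'' x) (at x)"
        using 2 e[of x] lc by (auto intro!: derivative_eq_intros simp: \<psi>''_def \<psi>_def power2_eq_square mult_ac)
      moreover have xS: "x \<in> {1<..}" using 2 by auto
      ultimately show ?thesis
        by (intro conjI; elim has_field_derivative_transform_within_open[where S = "{1<..}"])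
          (use xS e in \<open>simp_all add: \<psi>_def \<psi>'_def\<close>)
    next
      case 3
      have e: "t y = -1" "E y = exp (- l * (- y - 1))" if "y \<in> {..<-1}" for y using that by (auto simp: t_def E_def max_def)
      have "((\<lambda>x. cos k * exp (- l * (- x - 1))) has_real_derivative \<psi>' x) (at x)"
        using 3 e[of x] lc by (auto intro!: derivative_eq_intros simp: \<psi>'_def algebra_simps)
      moreover have "((\<lambda>x. k * sin k * exp (- l * (- x - 1))) has_real_derivative \<psi>'' x) (at x)"
        using 3 e[of x] lc by (auto intro!: derivative_eq_intros simp: \<psi>''_def \<psi>_def power2_eq_square mult_ac)
      moreover have xS: "x \<in> {..<-1}" using 3 by auto
      ultimately show ?thesis
        by (intro conjI; elim has_field_derivative_transform_within_open[where S = "{..<-1}"])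
          (use xS e in \<open>simp_all add: \<psi>_def \<psi>'_def\<close>)
    qed
    then show "(\<psi> has_real_derivative \<psi>' x) (at x)" "(\<psi>' has_real_derivative \<psi>'' x) (at x)" by auto
  qed
  define u where "u = abs_L2 (\<lambda>x. complex_of_real (\<psi> x))"
  define u' where "u' = abs_L2 (\<lambda>x. complex_of_real (\<psi>' x))"
  define u'' where "u'' = abs_L2 (\<lambda>x. complex_of_real (\<psi>'' x))"
  have w: "has_weak_deriv u u'" unfolding u_def u'_def
    by (rule has_weak_deriv_piecewise[OF _ cont(1) d(1) sq(1) sq(2), of "{-1, 1}"]) auto
  have w': "has_weak_deriv u' u''" unfolding u'_def u''_def
    by (rule has_weak_deriv_piecewise[OF _ cont(2) d(2) sq(2) sq'', of "{-1, 1}"]) auto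
  have u'': "u'' = l\<^sup>2 *\<^sub>R u + l *\<^sub>R Linf_mult a u"
    unfolding u''_def u_def Linf_mult_abs[OF sq(1) Linf] eq
    by (simp only: abs_L2_arith(5)[OF sq(1) sq(1)] abs_L2_arith(5)[OF sqa sqa]
        abs_L2_arith(1)[OF square_integrable_cmult[OF sq(1)] square_integrable_cmult[OF sqa]])
  \<comment> \<open>The first component represents the eigenfunction itself, embedded through its
    gradient.\<close>
  let ?p = "(inv grad u', l *\<^sub>R u)"
  have w2: "has_weak_deriv (l *\<^sub>R u) (l *\<^sub>R u')" by (rule has_weak_deriv_scaleR[OF w])
  have "grad (inv grad u') \<in> H1" "l *\<^sub>R u \<in> H1" using w' w2 by (auto simp: H1_def)
  then have "damped_wave a ?p = Some (inv grad (l *\<^sub>R u'), u'' - Linf_mult a (l *\<^sub>R u))"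
    by (simp add: damped_wave_def H1_to_Hdot1_eq weak_deriv_eq[OF w2] laplacian_def weak_deriv_eq[OF w'])
  also have "\<dots> = Some (l *\<^sub>R ?p)"
    by (simp add: u'' linear_simps(5)[OF bounded_clinear_imp[OF bounded_clinear_inv_grad]]
        linear_simps(5)[OF bounded_linear_Linf_mult[OF Linf]] power2_eq_square)
  finally have ev: "damped_wave a ?p = Some (l *\<^sub>R ?p)" .
  have "u \<noteq> 0"
  proof
    assume "u = 0"
    then have "AE x in lebesgue. complex_of_real (\<psi> x) = 0"
      using abs_L2_eq_iff[OF sq(1) square_integrable_zero] by (simp add: u_def zero_L2_def)
    then have "AE x in lebesgue. x \<in> UNIV \<longrightarrow> x \<in> {x. \<psi> x = 0}" by simp
    moreover have "closed {x. \<psi> x = 0}" by (intro closed_Collect_eq cont continuous_on_const)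
    ultimately have "0 \<in> {x. \<psi> x = 0}"
      using mem_closed_if_AE_lebesgue_open[of UNIV "{x. \<psi> x = 0}" 0] by simp
    then show False by (simp add: \<psi>_def t_def E_def)
  qed
  then have "?p \<noteq> 0" using l by (simp add: zero_prod_def)
  then show "\<not> similar (damped_wave a) (damped_wave (\<lambda>_. 0))"
    by (rule not_similar_if_eigenvalue[OF ev l])
qed

lemma well_mass_small:
  assumes "c > (2 :: real)"
  obtains k where "0 < k" "k < 1" "2 * (2 * k / sin (2 * k)) < c"
proof -
  have "((\<lambda>h. (sin (0 + h) - sin 0) / h) \<longlongrightarrow> cos 0) (at (0::real))"
    using DERIV_sin[of 0] by (simp only: DERIV_def)
  then have "((\<lambda>h. sin h / h) \<longlongrightarrow> 1) (at (0::real))" by simp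
  moreover have "2 / c < 1" using assms by simp
  ultimately have "\<forall>\<^sub>F h in at (0::real). sin h / h > 2 / c" by (rule order_tendstoD(1))
  then obtain d where d: "d > 0" "\<And>h. h \<noteq> 0 \<Longrightarrow> dist h 0 < d \<Longrightarrow> sin h / h > 2 / c"
    unfolding eventually_at by blast
  define k where "k = min (1/2) (d/4)"
  have k: "0 < k" "k < 1" "2 * k < d" using d(1) by (auto simp: k_def)
  have "sin (2 * k) / (2 * k) > 2 / c" by (rule d(2)) (use k in auto)
  moreover have "sin (2 * k) > 0" using k by (intro sin_gt_zero_02) auto
  ultimately have "2 * (2 * k / sin (2 * k)) < c" using k assms by (simp add: field_simps)
  then show ?thesis using k that by blast
qed

text \<open>The operator depends only on the class of the damping, so a Borel representative that is
  bounded everywhere may be used.\<close>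

lemma similar_damped_wave:
  assumes Linf: "in_Linf a" and L1: "in_L1 a" and norm: "L1_norm a < 2"
  shows "similar (damped_wave a) (damped_wave (\<lambda>_. 0))"
proof -
  have am: "a \<in> borel_measurable lebesgue" using Linf by (simp add: in_Linf_def)
  have "(\<lambda>x. Re (a x)) \<in> borel_measurable lebesgue" "(\<lambda>x. Im (a x)) \<in> borel_measurable lebesgue"
    using am by measurable
  then obtain f g where fg: "f \<in> borel_measurable lborel" "AE x in lborel. Re (a x) = f x"
    "g \<in> borel_measurable lborel" "AE x in lborel. Im (a x) = g x"
    using completion_ex_borel_measurable_real[of _ lborel] by metis
  obtain C where C: "AE x in lebesgue. cmod (a x) \<le> C" using Linf by (auto simp: in_Linf_def)
  define b where "b x = Complex (f x) (g x)" for x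
  have [measurable]: "f \<in> borel_measurable borel" "g \<in> borel_measurable borel" using fg by simp_all
  have bm: "b \<in> borel_measurable borel" unfolding b_def Complex_eq by measurable
  \<comment> \<open>Setting the representative to 0 where it is too large turns the essential bound
    into one at every point. The bound used below is max C 0, as the sign of C is not given.\<close>
  define c where "c x = (if cmod (b x) \<le> C then b x else 0)" for x
  have cm: "c \<in> borel_measurable borel" unfolding c_def using bm by measurable
  have cm': "c \<in> borel_measurable lebesgue" using measurable_completion[of c lborel borel] cm by simp
  have ae: "AE x in lebesgue. a x = c x"
    using AE_completion[OF fg(2)] AE_completion[OF fg(4)] C
  proof eventually_elim
    case (elim x)
    then have "a x = b x" by (simp add: b_def complex_eq_iff)
    then show ?case using elim by (simp add: c_def)
  qed
  have ci: "integrable lebesgue c"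
    by (rule integrable_cong_AE_imp[OF L1[unfolded in_L1_def] cm' ae])
  have "damping c (max C 0)"
  proof
    show "c \<in> borel_measurable borel" by (rule cm)
    show "integrable lborel c" using ci cm by (simp add: integrable_completion)
    show "cmod (c x) \<le> max C 0" for x by (simp add: c_def le_max_iff_disj)
    have "(LINT x|lborel. cmod (c x)) = (LINT x|lebesgue. cmod (c x))"
      using cm by (intro integral_lebesgue_lborel[symmetric]) measurable
    also have "\<dots> = L1_norm a"
      unfolding L1_norm_def using am cm' ae by (intro integral_cong_AE) (auto elim: eventually_mono)
    finally show "(LINT x|lborel. cmod (c x)) < 2" using norm by simp
  qed
  then interpret damping c "max C 0" .
  have "Linf_mult a = Linf_mult c"
    using Linf_mult_cong_AE[OF Linf a_Linf ae] by (rule ext)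
  then have "damped_wave a = damped_wave c" by (simp only: damped_wave_def)
  then show ?thesis using similar_undamped by simp
qed

theorem theorem7:
  shows "(\<forall>a :: real \<Rightarrow> complex.
            in_Linf a \<and> in_L1 a \<and> L1_norm a < 2 \<longrightarrow>
            similar (damped_wave a) (damped_wave (\<lambda>_. 0))) \<and>
         (\<forall>c :: real. c > 2 \<longrightarrow>
            (\<exists>a :: real \<Rightarrow> complex. in_Linf a \<and> in_L1 a \<and> L1_norm a < c \<and>
               \<not> similar (damped_wave a) (damped_wave (\<lambda>_. 0))))"
proof (intro conjI allI impI)
  fix a :: "real \<Rightarrow> complex"
  assume "in_Linf a \<and> in_L1 a \<and> L1_norm a < 2"
  then show "similar (damped_wave a) (damped_wave (\<lambda>_. 0))"
    by (intro similar_damped_wave) auto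
next
  fix c :: real
  assume "c > 2"
  then obtain k where k: "0 < k" "k < 1" "2 * (2 * k / sin (2 * k)) < c"
    by (rule well_mass_small)
  show "\<exists>a :: real \<Rightarrow> complex. in_Linf a \<and> in_L1 a \<and> L1_norm a < c \<and>
      \<not> similar (damped_wave a) (damped_wave (\<lambda>_. 0))"
    using well_not_similar[OF k(1,2)] k(3) by (intro exI conjI) auto
qed

end
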